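(* Let $d\ge3$ and let $\mathcal{T}\in\mathbb{R}^{n_1\times\cdots\times n_d}$ have a CP-decomposition $\mathcal{T}=[[\mathbf{A}^{(1)},\dots,\mathbf{A}^{(d)}]]$ with $\mathbf{A}^{(k)}\in\mathbb{R}^{n_k\times r}$. Let $s\ge1$ be an integer, $\mu_0>0$, and $c_3>1$. Suppose that (a) $\mu(\mathbf{A}^{(1)})\le\mu_0$ and $\mu(\mathbf{A}^{(2)})\le\mu_0$; (b) $\operatorname{rank}(\mathbf{A}^{(1)})=\operatorname{rank}(\mathbf{A}^{(2)})=r$; (c) every $s\times r$ submatrix of $\mathbf{A}^{(3)}$ has Kruskal rank $\ge2$; (d) for $k=3,\dots,d$, $\mathbf{A}^{(k)}$ has no entries which are exactly $0$. Then the Nonadaptive Tensor Deli algorithm (described in the context) completes $\mathcal{T}$ (recovers factor matrices whose CP tensor equals $\mathcal{T}$) with probability at least $$1-c_1 s(n_1+n_2)^{-c_2}-r\sum_{k=3}^d n_k^{-(c_3-1)}.$$ Furthermore, with high probability, the number of randomly drawn samples is at most $$O\left(s\mu_0 r\max\{n_1,n_2\}\log^2(n_1+n_2)+\mu_0^2r^2\sum_{k=3}^d n_k\log n_k\right).$$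
   Context: Notation: $[n]=\{1,\dots,n\}$; $[[\mathbf{A}^{(1)},\dots,\mathbf{A}^{(d)}]]=\sum_{\ell=1}^r\mathbf{a}^{(1)}_\ell\circ\cdots\circ\mathbf{a}^{(d)}_\ell$. Coherence of an $n\times r$ matrix: $\mu(\mathbf{M})=\frac{n}{r}\max_i\|\mathrm{proj}_{\mathrm{col}(\mathbf{M})}\mathbf{e}_i\|_2^2$. Kruskal rank: largest $k$ with every $k$ columns linearly independent. Constants: $c_0,c_1,c_2>0$ are the absolute constants of Chen (2015): for any rank-$r$ $\mathbf{M}\in\mathbb{R}^{n_1\times n_2}$ with row and column space coherence at most $\mu_0$, if each entry is observed independently with probability $c_0\frac{\mu_0r\log^2(n_1+n_2)}{\min\{n_1,n_2\}}$, then with probability at least $1-c_1(n_1+n_2)^{-c_2}$ nuclear norm minimization ($\min\|\mathbf{X}\|_*$ subject to agreeing with the observed entries) returns $\mathbf{M}$. Subroutines. Jennrich's algorithm on $\mathcal{X}\in\mathbb{R}^{n_1\times n_2\times s}$: with random $\mathbf{u},\mathbf{v}\in\mathbb{R}^s$, form $\mathbf{X}_\mathbf{u}=\sum_ju_j\mathcal{X}_{:,:,j}$, $\mathbf{X}_\mathbf{v}=\sum_jv_j\mathcal{X}_{:,:,j}$ and pair eigenvectors of $\mathbf{X}_\mathbf{u}\mathbf{X}_\mathbf{v}^\dagger$ and $\mathbf{X}_\mathbf{v}\mathbf{X}_\mathbf{u}^\dagger$ with reciprocal eigenvalues, giving paired mode-1 and mode-2 factor columns. Slice-by-slice censored least squares: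 given observed set $\Omega$ of $\mathcal{X}\in\mathbb{R}^{n_1\times n_2\times n}$ and $\mathbf{A}^{(1)},\mathbf{A}^{(2)}$, for each $i\in[n]$ solve $\sum_{\ell}\mathbf{A}^{(1)}_{i_1,\ell}\mathbf{A}^{(2)}_{i_2,\ell}\mathbf{C}_{i,\ell}=\mathcal{X}_{i_1,i_2,i}$ over $(i_1,i_2)$ with $(i_1,i_2,i)\in\Omega$, returning $\mathbf{C}\in\mathbb{R}^{n\times r}$. Algorithm (Nonadaptive Tensor Deli): (1) pick any $S\subset[n_3]$ with $|S|=s$ and any indices $i_3^*\in[n_3],\dots,i_d^*\in[n_d]$; (2) form $\Omega_M\subset[n_1]\times[n_2]\times S\times\{i_4^*\}\times\cdots\times\{i_d^*\}$ by including each entry independently with probability $c_0\frac{\mu_0r\log^2(n_1+n_2)}{\min\{n_1,n_2\}}$; (3) for $k=3,\dots,d$ form $\Omega_k\subset[n_1]\times[n_2]\times\{i_3^*\}\times\cdots\times\{i_{k-1}^*\}\times[n_k]\times\{i_{k+1}^*\}\times\cdots\times\{i_d^*\}$ by including each entry independently with probability $c_3\frac{\mu_0^2r^2\log n_k}{n_1n_2}$; (4) observe $\mathcal{T}$ on $\Omega_M\cup\bigcup_k\Omega_k$; (5) for each $i_3\in S$ complete $\mathcal{T}_{:,:,i_3,i_4^*,\dots,i_d^*}$ by nuclear norm minimization using only locations in $\Omega_M$; (6) apply Jennrich's algorithm to the completed $\mathcal{T}_{:,:,S,i_4^*,\dots,i_d^*}$ to get $\mathbf{A}^{(1)},\mathbf{A}^{(2)}$;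 (7) for $k=3,\dots,d$ set $\mathbf{A}^{(k)}$ to the output of censored least squares on $\mathcal{T}_{:,:,i_3^*,\dots,i_{k-1}^*,:,i_{k+1}^*,\dots,i_d^*}$ with observed set $\Omega_k$; (8) for each $\ell\in[r]$ replace $\mathbf{A}^{(d)}_{:,\ell}$ by $\left(\prod_{k=3}^{d-1}\mathbf{A}^{(k)}_{i_k^*,\ell}\right)^{-1}\mathbf{A}^{(d)}_{:,\ell}$; return $\mathbf{A}^{(1)},\dots,\mathbf{A}^{(d)}$.
   Formalization: In Jennrich's step the mode-2 columns are eigenvectors of X_v^T (X_u^T)^† rather than of X_v X_u^†, whose eigenvectors are mode-1 columns; u, v are standard Gaussian, and sampling probabilities exceeding 1 are replaced by 1. *)

theory Defs
  imports "Jordan_Normal_Form.DL_Rank" "Jordan_Normal_Form.DL_Submatrix"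
          "Jordan_Normal_Form.Char_Poly" "HOL-Probability.Probability"
begin

text \<open>An order-d tensor with mode sizes n 1, ..., n d is a real function on index maps
  i :: nat => nat (0-based entries, modes numbered 1..d, value 0 outside 1..d).
  Factor matrices are JNF matrices A k of size (n k) x r.\<close>

definition tidx :: "nat \<Rightarrow> (nat \<Rightarrow> nat) \<Rightarrow> (nat \<Rightarrow> nat) set" where
  "tidx d n = {i. (\<forall>k\<in>{1..d}. i k < n k) \<and> (\<forall>k. k \<notin> {1..d} \<longrightarrow> i k = 0)}"

definition cp :: "nat \<Rightarrow> nat \<Rightarrow> (nat \<Rightarrow> real mat) \<Rightarrow> (nat \<Rightarrow> nat) \<Rightarrow> real" where
  "cp d r A i = (\<Sum>l<r. \<Prod>k\<in>{1..d}. A k $$ (i k, l))"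

definition col_space :: "real mat \<Rightarrow> real Matrix.vec set" where
  "col_space M = {M *\<^sub>v c | c. c \<in> carrier_vec (dim_col M)}"

definition proj_col :: "real mat \<Rightarrow> real Matrix.vec \<Rightarrow> real Matrix.vec" where
  "proj_col M x = (THE w. w \<in> col_space M \<and> (\<forall>v\<in>col_space M. (x - w) \<bullet> v = 0))"

definition coh :: "real mat \<Rightarrow> nat \<Rightarrow> real" where
  "coh M k = real (dim_row M) / real k *
     Max ((\<lambda>i. proj_col M (unit_vec (dim_row M) i) \<bullet> proj_col M (unit_vec (dim_row M) i))
          ` {..<dim_row M})"

definition coherence :: "real mat \<Rightarrow> real" where
  "coherence M = coh M (dim_col M)"

definition mrank :: "real mat \<Rightarrow> nat" where
  "mrank M = vec_space.rank (dim_row M) M"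

definition cols_lin_indep :: "real mat \<Rightarrow> nat set \<Rightarrow> bool" where
  "cols_lin_indep M L \<longleftrightarrow>
     (\<forall>c::nat \<Rightarrow> real. (\<forall>i<dim_row M. (\<Sum>l\<in>L. c l * M $$ (i, l)) = 0) \<longrightarrow> (\<forall>l\<in>L. c l = 0))"

definition kruskal_rank :: "real mat \<Rightarrow> nat" where
  "kruskal_rank M = (GREATEST k. k \<le> dim_col M \<and>
     (\<forall>L. L \<subseteq> {..<dim_col M} \<and> card L = k \<longrightarrow> cols_lin_indep M L))"

text \<open>Nuclear norm = sum of singular values = sum of square roots of the eigenvalues
  (with multiplicity) of M^T M.\<close>
definition nuc_norm :: "real mat \<Rightarrow> real" where
  "nuc_norm M = sum_mset (image_mset sqrt (proots (char_poly (transpose_mat M * M))))"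

definition pinv :: "real mat \<Rightarrow> real mat" where
  "pinv X = (THE Y. Y \<in> carrier_mat (dim_col X) (dim_row X) \<and>
      X * Y * X = X \<and> Y * X * Y = Y \<and>
      transpose_mat (X * Y) = X * Y \<and> transpose_mat (Y * X) = Y * X)"

section \<open>Subroutines (as relations: any admissible output)\<close>

definition nnm_min :: "nat \<Rightarrow> nat \<Rightarrow> (nat \<times> nat) set \<Rightarrow> real mat \<Rightarrow> real mat \<Rightarrow> bool" where
  "nnm_min n1 n2 Obs M X \<longleftrightarrow> X \<in> carrier_mat n1 n2 \<and>
     (\<forall>(i,j)\<in>Obs. X $$ (i,j) = M $$ (i,j)) \<and>
     (\<forall>Y\<in>carrier_mat n1 n2. (\<forall>(i,j)\<in>Obs. Y $$ (i,j) = M $$ (i,j)) \<longrightarrow> nuc_norm X \<le> nuc_norm Y)"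

text \<open>Bernoulli random subset of D: each element independently with probability p
  (bernoulli_pmf clamps p to [0,1]).\<close>
definition bern_set :: "'a set \<Rightarrow> real \<Rightarrow> 'a set pmf" where
  "bern_set D p = map_pmf (\<lambda>f. {x\<in>D. f x}) (Pi_pmf D False (\<lambda>_. bernoulli_pmf p))"

definition chen_constants :: "real \<Rightarrow> real \<Rightarrow> real \<Rightarrow> bool" where
  "chen_constants c0 c1 c2 \<longleftrightarrow> c0 > 0 \<and> c1 > 0 \<and> c2 > 0 \<and>
     (\<forall>n1 n2 (mu0::real) M. M \<in> carrier_mat n1 n2 \<and> n1 > 0 \<and> n2 > 0 \<and>
        coh M (mrank M) \<le> mu0 \<and> coh (transpose_mat M) (mrank M) \<le> mu0 \<longrightarrow>
        measure_pmf.prob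
          (bern_set ({..<n1} \<times> {..<n2})
             (min 1 (c0 * mu0 * real (mrank M) * (ln (real (n1 + n2)))\<^sup>2 / real (min n1 n2))))
          {Obs. \<forall>X. nnm_min n1 n2 Obs M X \<longrightarrow> X = M}
        \<ge> 1 - c1 * real (n1 + n2) powr (- c2))"

text \<open>Jennrich's algorithm on the n1 x n2 x S tensor given by slices Xs j (j in S), with
  random vectors u, v indexed by S. Mode-1 columns are eigenvectors of X_u X_v^+ with
  nonzero distinct eigenvalues lambda_l, paired with mode-2 columns that are eigenvectors of
  X_v^T (X_u^T)^+ with reciprocal eigenvalue 1/lambda_l.\<close>
definition jennrich_out :: "nat \<Rightarrow> nat \<Rightarrow> nat \<Rightarrow> nat set \<Rightarrow> (nat \<Rightarrow> real mat) \<Rightarrow>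
    (nat \<Rightarrow> real) \<Rightarrow> (nat \<Rightarrow> real) \<Rightarrow> real mat \<Rightarrow> real mat \<Rightarrow> bool" where
  "jennrich_out n1 n2 r S Xs u v B1 B2 \<longleftrightarrow>
     (let Xu = Matrix.mat n1 n2 (\<lambda>(i,j). \<Sum>t\<in>S. u t * Xs t $$ (i,j));
          Xv = Matrix.mat n1 n2 (\<lambda>(i,j). \<Sum>t\<in>S. v t * Xs t $$ (i,j));
          M1 = Xu * pinv Xv;
          M2 = transpose_mat Xv * pinv (transpose_mat Xu)
      in B1 \<in> carrier_mat n1 r \<and> B2 \<in> carrier_mat n2 r \<and>
         (\<exists>lam::nat \<Rightarrow> real. inj_on lam {..<r} \<and>
            (\<forall>l<r. lam l \<noteq> 0 \<and> eigenvector M1 (col B1 l) (lam l) \<and>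
                   eigenvector M2 (col B2 l) (1 / lam l))))"

text \<open>Slice-by-slice censored least squares: X is an n1 x n2 x n tensor (as a function),
  Obs its observed positions; C (n x r) minimizes, row by row, the squared residual.\<close>
definition cls_resid :: "real mat \<Rightarrow> real mat \<Rightarrow> (nat \<times> nat \<times> nat) set \<Rightarrow>
    (nat \<Rightarrow> nat \<Rightarrow> nat \<Rightarrow> real) \<Rightarrow> nat \<Rightarrow> (nat \<Rightarrow> real) \<Rightarrow> real" where
  "cls_resid B1 B2 Obs X i c =
     (\<Sum>(i1,i2,i3)\<in>{q\<in>Obs. snd (snd q) = i}.
        ((\<Sum>l<dim_col B1. B1 $$ (i1,l) * B2 $$ (i2,l) * c l) - X i1 i2 i3)\<^sup>2)"

definition cls_out :: "real mat \<Rightarrow> real mat \<Rightarrow> nat \<Rightarrow> (nat \<times> nat \<times> nat) set \<Rightarrow>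
    (nat \<Rightarrow> nat \<Rightarrow> nat \<Rightarrow> real) \<Rightarrow> real mat \<Rightarrow> bool" where
  "cls_out B1 B2 n Obs X C \<longleftrightarrow> C \<in> carrier_mat n (dim_col B1) \<and>
     (\<forall>i<n. \<forall>c. cls_resid B1 B2 Obs X i (\<lambda>l. C $$ (i,l)) \<le> cls_resid B1 B2 Obs X i c)"

definition fidx :: "nat \<Rightarrow> (nat \<Rightarrow> nat) \<Rightarrow> nat \<Rightarrow> nat \<Rightarrow> nat \<Rightarrow> nat \<Rightarrow> nat \<Rightarrow> nat" where
  "fidx d istar k a b c = (\<lambda>j. if j = 1 then a else if j = 2 then b else if j = k then c
                               else if 3 \<le> j \<and> j \<le> d then istar j else 0)"

text \<open>Admissible outputs B of the algorithm on tensor T (d modes, sizes n, rank r), with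
  chosen S and istar, samples OmM (positions (i1,i2,i3), i3 in S, other modes at istar),
  Oms k (positions (i1,i2,ik) of the k-th fibre slab), and Jennrich vectors u, v.\<close>
definition deli_out :: "nat \<Rightarrow> (nat \<Rightarrow> nat) \<Rightarrow> nat \<Rightarrow> nat set \<Rightarrow> (nat \<Rightarrow> nat) \<Rightarrow>
    ((nat \<Rightarrow> nat) \<Rightarrow> real) \<Rightarrow> (nat \<times> nat \<times> nat) set \<Rightarrow> (nat \<Rightarrow> (nat \<times> nat \<times> nat) set) \<Rightarrow>
    (nat \<Rightarrow> real) \<Rightarrow> (nat \<Rightarrow> real) \<Rightarrow> (nat \<Rightarrow> real mat) \<Rightarrow> bool" where
  "deli_out d n r S istar T OmM Oms u v B \<longleftrightarrow>
     (\<exists>Xs C.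
        (\<forall>t\<in>S. nnm_min (n 1) (n 2) {(a,b). (a,b,t) \<in> OmM}
                   (Matrix.mat (n 1) (n 2) (\<lambda>(a,b). T (fidx d istar 3 a b t))) (Xs t)) \<and>
        jennrich_out (n 1) (n 2) r S Xs u v (B 1) (B 2) \<and>
        (\<forall>k\<in>{3..d}. cls_out (B 1) (B 2) (n k) (Oms k)
                       (\<lambda>a b c. T (fidx d istar k a b c)) (C k)) \<and>
        (\<forall>k\<in>{3..<d}. B k = C k) \<and>
        B d = Matrix.mat (n d) r (\<lambda>(i,l). C d $$ (i,l) / (\<Prod>k\<in>{3..<d}. C k $$ (istar k, l))))"

definition deli_success :: "nat \<Rightarrow> (nat \<Rightarrow> nat) \<Rightarrow> nat \<Rightarrow> nat set \<Rightarrow> (nat \<Rightarrow> nat) \<Rightarrow>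
    ((nat \<Rightarrow> nat) \<Rightarrow> real) \<Rightarrow> (nat \<times> nat \<times> nat) set \<Rightarrow> (nat \<Rightarrow> (nat \<times> nat \<times> nat) set) \<Rightarrow>
    (nat \<Rightarrow> real) \<Rightarrow> (nat \<Rightarrow> real) \<Rightarrow> bool" where
  "deli_success d n r S istar T OmM Oms u v \<longleftrightarrow>
     (\<exists>B. deli_out d n r S istar T OmM Oms u v B) \<and>
     (\<forall>B. deli_out d n r S istar T OmM Oms u v B \<longrightarrow> (\<forall>i\<in>tidx d n. cp d r B i = T i))"

definition deli_samples :: "real \<Rightarrow> real \<Rightarrow> real \<Rightarrow> nat \<Rightarrow> (nat \<Rightarrow> nat) \<Rightarrow> nat \<Rightarrow> nat set \<Rightarrow>
    ((nat \<times> nat \<times> nat) set \<times> (nat \<Rightarrow> (nat \<times> nat \<times> nat) set)) pmf" where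
  "deli_samples c0 c3 mu0 d n r S =
     pair_pmf
       (bern_set ({..<n 1} \<times> {..<n 2} \<times> S)
          (min 1 (c0 * mu0 * real r * (ln (real (n 1 + n 2)))\<^sup>2 / real (min (n 1) (n 2)))))
       (Pi_pmf {3..d} {} (\<lambda>k. bern_set ({..<n 1} \<times> {..<n 2} \<times> {..<n k})
          (min 1 (c3 * mu0\<^sup>2 * (real r)\<^sup>2 * ln (real (n k)) / (real (n 1) * real (n 2))))))"

definition gauss_vec :: "nat set \<Rightarrow> (nat \<Rightarrow> real) measure" where
  "gauss_vec S = PiM S (\<lambda>_. density lborel std_normal_density)"

definition deli_hyps :: "nat \<Rightarrow> (nat \<Rightarrow> nat) \<Rightarrow> nat \<Rightarrow> (nat \<Rightarrow> real mat) \<Rightarrow> nat \<Rightarrow>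
    nat set \<Rightarrow> (nat \<Rightarrow> nat) \<Rightarrow> real \<Rightarrow> bool" where
  "deli_hyps d n r A s S istar mu0 \<longleftrightarrow>
     d \<ge> 3 \<and> s \<ge> 1 \<and> mu0 > 0 \<and>
     (\<forall>k\<in>{1..d}. n k > 0 \<and> A k \<in> carrier_mat (n k) r) \<and>
     S \<subseteq> {..<n 3} \<and> card S = s \<and> (\<forall>k\<in>{3..d}. istar k < n k) \<and>
     coherence (A 1) \<le> mu0 \<and> coherence (A 2) \<le> mu0 \<and>
     mrank (A 1) = r \<and> mrank (A 2) = r \<and>
     (\<forall>S'. S' \<subseteq> {..<n 3} \<and> card S' = s \<longrightarrow> kruskal_rank (submatrix (A 3) S' {..<r}) \<ge> 2) \<and>
     (\<forall>k\<in>{3..d}. \<forall>i<n k. \<forall>l<r. A k $$ (i,l) \<noteq> 0)"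

end

theory Submission
  imports Defs "Jordan_Normal_Form.Schur_Decomposition"
begin

text \<open>
  Matrix completion of the slices succeeds by the hypothesis on Chen's constants, since every slice
  \<open>A 1 D (A 2)\<^sup>T\<close> has the column and row spaces of \<open>A 1\<close> and \<open>A 2\<close>, hence the same coherences; a minimiser
  of the nuclear norm exists by compactness. Jennrich's algorithm diagonalises \<open>A 1 F P\<close>, where \<open>P\<close>
  is a left inverse of \<open>A 1\<close> and the ratios in \<open>F\<close> are nonzero and pairwise distinct for almost all
  Gaussian \<open>u, v\<close>; so it finds both factors up to one common permutation and scalings, and the
  scalings cancel in the recombination of the modes.

  Censored least squares succeeds on a slice as soon as no nonzero element of the span of the
  rank-one matrices \<open>a\<^sub>l b\<^sub>l\<^sup>T\<close> vanishes on the observed set. Let \<open>f\<close> be the dimension of the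
  subspace of elements that do vanish there. The squared value of an element at a position is at most
  \<open>R = \<mu>\<^sup>2 r\<^sup>2 / (n\<^sub>1 n\<^sub>2)\<close> times its squared norm, so at least \<open>f / R\<close> positions lower \<open>f\<close> when
  they are added to the observed set. Russo's formula turns this into the differential inequality
  \<open>F' \<le> - F / R\<close> for the expectation \<open>F p\<close> of \<open>f\<close>, whence a failure probability of at most
  \<open>r exp (- p / R)\<close>, without any matrix concentration inequality.\<close>

section \<open>Bernoulli random sets\<close>

text \<open>Success asks two things of the relational subroutines: some output exists, and every
  output is right. Chen's event says only that every minimiser equals the slice, which an empty set
  of minimisers would satisfy; hence the separate existence proof. The drop of \<open>f\<close> is
  at least 1 because a dimension is an integer. This turns a count of positions into a bound on
  Russo's derivative, and Markov's inequality then bounds the probability that \<open>f\<close> is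
  nonzero by its expectation. For mode k the exponent p / R equals c3 ln n_k, so one row fails with
  probability at most r n_k^(-c3), and the union over the n_k rows gives r n_k^(-(c3 - 1)). The
  condition on the Kruskal rank enters twice: it makes the ratios in \<open>F\<close> distinct for
  almost every \<open>v\<close> once \<open>u\<close> is fixed, and it forces r >= 2, so that
  dividing by r in the coherence is meaningful. For the sample count an exponential moment with
  parameter 1 suffices; it makes the high probability explicit as 1 - exp(- Bd).\<close>

lemma finite_set_bern_set: "finite D \<Longrightarrow> finite (set_pmf (bern_set D p))"
  by (rule finite_subset[of _ "Pow D"]) (auto simp: bern_set_def)

lemma set_bern_set_subset: "S \<in> set_pmf (bern_set D p) \<Longrightarrow> S \<subseteq> D"
  by (auto simp: bern_set_def)

lemma bern_set_empty: "bern_set {} p = return_pmf {}"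
  by (simp add: bern_set_def map_pmf_def)

lemma bern_set_insert:
  assumes "finite D" "x \<notin> D"
  shows "bern_set (insert x D) p =
    bind_pmf (bernoulli_pmf p) (\<lambda>b. map_pmf (\<lambda>S. if b then insert x S else S) (bern_set D p))"
proof -
  have eq: "{y \<in> insert x D. (f(x := b)) y} = (if b then insert x {y \<in> D. f y} else {y \<in> D. f y})"
    for f :: "'a \<Rightarrow> bool" and b
    using assms by auto
  show ?thesis
    unfolding bern_set_def Pi_pmf_insert'[OF assms] map_bind_pmf map_return_pmf eq
    by (simp add: map_pmf_def bind_assoc_pmf bind_return_pmf)
qed

lemma integrable_bern_set:
  fixes f :: "'a set \<Rightarrow> real"
  shows "finite D \<Longrightarrow> integrable (measure_pmf (bern_set D p)) f"
  by (rule integrable_measure_pmf_finite[OF finite_set_bern_set])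

text \<open>Conditioning on whether \<open>x\<close> is drawn. The range of \<open>p\<close>
  matters: outside {0..1} the Bernoulli parameter is clamped and the weights are wrong.\<close>

lemma expectation_bern_set_insert:
  fixes f :: "'a set \<Rightarrow> real"
  assumes "finite D" "x \<notin> D" "p \<in> {0..1}"
  shows "measure_pmf.expectation (bern_set (insert x D) p) f =
     p * measure_pmf.expectation (bern_set D p) (\<lambda>S. f (insert x S))
     + (1 - p) * measure_pmf.expectation (bern_set D p) f"
  unfolding bern_set_insert[OF assms(1,2)]
  using assms
  by (subst pmf_expectation_bind[where A = UNIV])
     (auto simp: finite_set_bern_set UNIV_bool)

lemma expectation_bern_set_cong:
  fixes f g :: "'a set \<Rightarrow> real"
  assumes "\<And>S. S \<subseteq> D \<Longrightarrow> f S = g S"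
  shows "measure_pmf.expectation (bern_set D p) f = measure_pmf.expectation (bern_set D p) g"
  by (rule integral_cong_AE) (auto simp: AE_measure_pmf_iff assms set_bern_set_subset)

lemma expectation_bern_set_mono:
  fixes f g :: "'a set \<Rightarrow> real"
  assumes "finite D" "\<And>S. S \<subseteq> D \<Longrightarrow> f S \<le> g S"
  shows "measure_pmf.expectation (bern_set D p) f \<le> measure_pmf.expectation (bern_set D p) g"
  by (rule integral_mono_AE)
     (auto simp: AE_measure_pmf_iff assms set_bern_set_subset integrable_bern_set)

text \<open>Induction on \<open>D\<close>, conditioning on the new point. In the product rule the
  weights p and 1 - p contribute the difference of the two conditional expectations, which is the
  summand of the new point; the induction hypothesis for both conditioned functions gives the other
  summands. Taking out \<open>x\<close> in \<open>f (S - {x})\<close> makes a summand independent of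
  whether \<open>x\<close> was drawn.\<close>

lemma russo_formula:
  fixes f :: "'a set \<Rightarrow> real"
  assumes "finite D" "p \<in> {0..1}"
  shows "((\<lambda>p. measure_pmf.expectation (bern_set D p) f) has_real_derivative
     measure_pmf.expectation (bern_set D p) (\<lambda>S. \<Sum>x\<in>D. f (insert x S) - f (S - {x})))
     (at p within {0..1})"
  using assms
proof (induction D arbitrary: f rule: finite_induct)
  case empty
  then show ?case by (simp add: bern_set_empty)
next
  case (insert x D)
  let ?E = "\<lambda>q f. measure_pmf.expectation (bern_set D q) f"
  let ?d = "\<lambda>f S. \<Sum>y\<in>D. f (insert y S) - f (S - {y})"
  let ?fx = "\<lambda>S. f (insert x S)"
  note int = integrable_bern_set[OF insert.hyps(1), of p]
  have "((\<lambda>q. q * ?E q ?fx + (1 - q) * ?E q f) has_real_derivative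
      (1 * ?E p ?fx + ?E p (?d ?fx) * p) + ((0 - 1) * ?E p f + ?E p (?d f) * (1 - p)))
      (at p within {0..1})"
    by (intro DERIV_add DERIV_mult DERIV_diff DERIV_ident DERIV_const insert.IH insert.prems)
  moreover have "(1 * ?E p ?fx + ?E p (?d ?fx) * p) + ((0 - 1) * ?E p f + ?E p (?d f) * (1 - p)) =
     measure_pmf.expectation (bern_set (insert x D) p)
       (\<lambda>S. \<Sum>y\<in>insert x D. f (insert y S) - f (S - {y}))"
  proof -
    have 1: "?E p (\<lambda>S. \<Sum>y\<in>insert x D. f (insert y (insert x S)) - f (insert x S - {y}))
       = ?E p (\<lambda>S. ?d ?fx S + (?fx S - f S))"
    proof (rule expectation_bern_set_cong)
      fix S assume "S \<subseteq> D"
      have "insert x S - {x} = S" using \<open>S \<subseteq> D\<close> insert.hyps by auto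
      moreover have "insert x S - {y} = insert x (S - {y})" "insert y (insert x S) = insert x (insert y S)"
        if "y \<in> D" for y using that insert.hyps by auto
      ultimately show "(\<Sum>y\<in>insert x D. f (insert y (insert x S)) - f (insert x S - {y}))
        = ?d ?fx S + (?fx S - f S)"
        using insert.hyps by simp
    qed
    have 2: "?E p (\<lambda>S. \<Sum>y\<in>insert x D. f (insert y S) - f (S - {y}))
       = ?E p (\<lambda>S. ?d f S + (?fx S - f S))"
    proof (rule expectation_bern_set_cong)
      fix S assume "S \<subseteq> D"
      have "S - {x} = S" using \<open>S \<subseteq> D\<close> insert.hyps by auto
      then show "(\<Sum>y\<in>insert x D. f (insert y S) - f (S - {y})) = ?d f S + (?fx S - f S)"
        using insert.hyps by simp
    qed
    have 3: "?E p (\<lambda>S. ?d ?fx S + (?fx S - f S)) = ?E p (?d ?fx) + (?E p ?fx - ?E p f)"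
      by (simp add: Bochner_Integration.integral_add Bochner_Integration.integral_diff int
          del: sum_subtractf)
    have 4: "?E p (\<lambda>S. ?d f S + (?fx S - f S)) = ?E p (?d f) + (?E p ?fx - ?E p f)"
      by (simp add: Bochner_Integration.integral_add Bochner_Integration.integral_diff int
          del: sum_subtractf)
    show ?thesis
      unfolding expectation_bern_set_insert[OF insert.hyps insert.prems] 1 2 3 4
      by (simp add: algebra_simps)
  qed
  ultimately have D: "((\<lambda>q. q * ?E q ?fx + (1 - q) * ?E q f) has_real_derivative
      measure_pmf.expectation (bern_set (insert x D) p)
       (\<lambda>S. \<Sum>y\<in>insert x D. f (insert y S) - f (S - {y}))) (at p within {0..1})"
    by simp
  \<comment> \<open>The product expression agrees with the expectation only on {0..1}; a derivative
    within that interval allows the exchange.\<close>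
  show ?case
    using D unfolding has_field_derivative_def
    by (rule has_derivative_transform[rotated 2])
       (use insert.prems in \<open>auto simp: expectation_bern_set_insert[OF insert.hyps]\<close>)
qed

text \<open>A Gronwall argument: an insertion that lowers \<open>f\<close> by 1 contributes at most
  -1 to Russo's sum and any other one at most 0, so \<open>drop\<close> bounds the derivative of the
  expectation by -1/R times the expectation.\<close>

lemma expectation_bern_set_exp_decay:
  fixes f :: "'a set \<Rightarrow> real" and R :: real
  assumes "finite D" "p \<in> {0..1}" "R > 0"
    and anti: "\<And>S T. S \<subseteq> T \<Longrightarrow> T \<subseteq> D \<Longrightarrow> f T \<le> f S"
    and drop: "\<And>S. S \<subseteq> D \<Longrightarrow> f S \<le> R * card {x \<in> D. f (insert x S) \<le> f S - 1}"
  shows "measure_pmf.expectation (bern_set D p) f \<le> f {} * exp (- p / R)"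
proof -
  define F where "F q = measure_pmf.expectation (bern_set D q) f" for q
  define F' where "F' q = measure_pmf.expectation (bern_set D q)
     (\<lambda>S. \<Sum>x\<in>D. f (insert x S) - f (S - {x}))" for q
  have DF: "(F has_real_derivative F' q) (at q within {0..1})" if "q \<in> {0..1}" for q
    using russo_formula[OF assms(1) that, of f] unfolding F_def[abs_def] F'_def .
  have le: "F' q \<le> - F q / R" for q
  proof -
    have "F' q \<le> measure_pmf.expectation (bern_set D q) (\<lambda>S. - f S / R)"
      unfolding F'_def
    proof (rule expectation_bern_set_mono[OF assms(1)])
      fix S assume S: "S \<subseteq> D"
      have "(\<Sum>x\<in>D. f (insert x S) - f (S - {x})) \<le> (\<Sum>x\<in>D. if f (insert x S) \<le> f S - 1 then - 1 else 0)"
      proof (rule sum_mono)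
        fix x assume "x \<in> D"
        then show "f (insert x S) - f (S - {x}) \<le> (if f (insert x S) \<le> f S - 1 then - 1 else 0)"
          using anti[OF Diff_subset S, of "{x}"] anti[OF subset_insertI, of x S] S by auto
      qed
      also have "\<dots> = - real (card {x \<in> D. f (insert x S) \<le> f S - 1})"
        using assms(1) by (simp add: sum.If_cases Int_def)
      also have "\<dots> \<le> - f S / R"
        using drop[OF S] assms(3) by (simp add: field_simps)
      finally show "(\<Sum>x\<in>D. f (insert x S) - f (S - {x})) \<le> - f S / R" .
    qed
    also have "\<dots> = - F q / R" unfolding F_def by simp
    finally show ?thesis .
  qed
  \<comment> \<open>With this integrating factor the differential inequality says that
    \<open>G\<close> does not increase; at q = 0 the random set is empty.\<close>
  define G where "G q = F q * exp (q / R)" for q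
  have DG: "(G has_real_derivative (F' q * exp (q / R) + (exp (q / R) * (1 / R)) * F q)) (at q within {0..1})"
    if "q \<in> {0..1}" for q
    unfolding G_def[abs_def] using that assms(3) by (auto intro!: derivative_eq_intros DF)
  have "G p \<le> G 0"
  proof (cases "p = 0")
    case False
    then have p: "0 < p" "p \<le> 1" using assms(2) by auto
    have "continuous_on {0..1} G"
      using DG by (meson DERIV_continuous continuous_on_eq_continuous_within)
    then have cont: "continuous_on {0..p} G"
      by (rule continuous_on_subset) (use p in auto)
    show ?thesis
    proof (rule DERIV_nonpos_imp_decreasing_open[of 0 p G])
      fix q assume q: "0 < q" "q < p"
      \<comment> \<open>In the interior the derivative within the interval is an ordinary one; the
        end points need only continuity.\<close>
      then have q01: "q \<in> {0..1}" and w: "at q within {0..1} = at q" using p by (auto simp: at_within_Icc_at)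
      have "F' q * exp (q / R) + (exp (q / R) * (1 / R)) * F q \<le> 0"
      proof -
        have "F' q * exp (q / R) \<le> (- F q / R) * exp (q / R)"
          by (rule mult_right_mono[OF le]) simp
        then show ?thesis by (simp add: mult.commute)
      qed
      then show "\<exists>y. (G has_real_derivative y) (at q) \<and> y \<le> 0"
        using DG[OF q01] w by auto
    qed (use p cont in auto)
  qed simp
  moreover have "F 0 = f {}"
  proof -
    have "F 0 = f {}" using assms(1) unfolding F_def
      by (induction D rule: finite_induct) (auto simp: bern_set_empty expectation_bern_set_insert)
    then show ?thesis .
  qed
  ultimately have "F p * exp (p / R) \<le> f {}" by (simp add: G_def)
  then show ?thesis unfolding F_def by (simp add: exp_minus field_simps)
qed

section \<open>Exponential moments and slices of Bernoulli sets\<close>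

lemma bern_set_1: "finite D \<Longrightarrow> bern_set D 1 = return_pmf D"
proof (induction D rule: finite_induct)
  case (insert x D)
  have "bernoulli_pmf 1 = return_pmf True" by (auto intro!: pmf_eqI simp: pmf_return split: split_indicator)
  with insert show ?case by (simp add: bern_set_insert bind_return_pmf)
qed (simp add: bern_set_empty)

text \<open>Each point contributes a factor 1 + p (e - 1), which is at most 1 + 2 p <= exp (2 p)
  because e <= 3.\<close>

lemma expectation_exp_card_bern_set:
  assumes "finite D" "p \<in> {0..1}"
  shows "measure_pmf.expectation (bern_set D p) (\<lambda>S. exp (real (card S))) \<le> exp (2 * p * card D)"
  using assms(1)
proof (induction D rule: finite_induct)
  case (insert x D)
  let ?E = "measure_pmf.expectation (bern_set D p)"
  have card: "card (insert x S) = Suc (card S)" if "S \<subseteq> D" for S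
    using that insert.hyps by (meson card_insert_disjoint finite_subset subset_iff)
  have "?E (\<lambda>S. exp (real (card (insert x S)))) = ?E (\<lambda>S. exp (real (card S)) * exp 1)"
    using insert.hyps by (intro expectation_bern_set_cong)
      (simp add: card exp_add[symmetric] add.commute)
  then have "measure_pmf.expectation (bern_set (insert x D) p) (\<lambda>S. exp (real (card S)))
     = (1 + p * (exp 1 - 1)) * ?E (\<lambda>S. exp (real (card S)))"
    using expectation_bern_set_insert[OF insert.hyps assms(2), of "\<lambda>S. exp (real (card S))"]
    by (simp add: algebra_simps)
  also have "\<dots> \<le> exp (2 * p) * exp (2 * p * card D)"
  proof (rule mult_mono[OF _ insert.IH])
    have "p * (exp 1 - 1) \<le> p * 2"
      using assms(2) exp_le by (intro mult_left_mono) auto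
    then show "1 + p * (exp 1 - 1) \<le> exp (2 * p)"
      using exp_ge_add_one_self[of "2 * p"] by linarith
  qed auto
  finally show ?case using insert.hyps by (simp add: exp_add[symmetric] algebra_simps)
qed (simp add: bern_set_empty)

text \<open>Meant for h (a,b) = (a,b,i): the part of a random set of triples with third coordinate i
  is a Bernoulli set of pairs. Injectivity on the whole type keeps points outside \<open>E\<close>
  away from the image of \<open>E\<close>.\<close>

lemma map_bern_set_vimage:
  assumes "finite D" "inj h" "h ` E \<subseteq> D"
  shows "map_pmf (\<lambda>S. {x \<in> E. h x \<in> S}) (bern_set D p) = bern_set E p"
proof -
  have h: "inj_on h E" using assms(2) by (rule inj_on_subset) simp
  have E: "finite E" using finite_imageD[OF finite_subset[OF assms(3,1)] h] .
  have "bij_betw h E (h ` E)" using h by (simp add: bij_betw_def)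
  moreover have "h x \<notin> h ` E" if "x \<notin> E" for x using that assms(2) by (auto dest: injD)
  ultimately have 1: "Pi_pmf E False (\<lambda>_. bernoulli_pmf p) = map_pmf (\<lambda>g. g \<circ> h) (Pi_pmf (h ` E) False (\<lambda>_. bernoulli_pmf p))"
    using E by (intro Pi_pmf_bij_betw) auto
  have "{x \<in> E. ((\<lambda>x. if x \<in> h ` E then f x else False) \<circ> h) x} = {x \<in> E. h x \<in> {y \<in> D. f y}}" for f
    using assms(3) by auto
  then show ?thesis
    unfolding bern_set_def 1 Pi_pmf_subset[OF assms(1,3)] pmf.map_comp o_def by simp
qed

section \<open>Random sets that determine a linear space of functions\<close>

text \<open>Zero rows make the system square. Since r < m, row r of \<open>M\<close> is zero, so the
  transpose kills a unit vector and the determinant is 0.\<close>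

lemma homogeneous_system_nontrivial:
  fixes a :: "nat \<Rightarrow> nat \<Rightarrow> real"
  assumes "r < m"
  shows "\<exists>y. (\<exists>j<m. y j \<noteq> 0) \<and> (\<forall>l<r. (\<Sum>j<m. a l j * y j) = 0)"
proof -
  define M where "M = Matrix.mat m m (\<lambda>(l,j). if l < r then a l j else 0)"
  have M: "M \<in> carrier_mat m m" by (simp add: M_def)
  have "transpose_mat M *\<^sub>v unit_vec m r = 0\<^sub>v m"
    using assms by (intro eq_vecI) (auto simp: M_def)
  moreover have "unit_vec m r \<noteq> (0\<^sub>v m :: real Matrix.vec)"
    "(unit_vec m r :: real Matrix.vec) \<in> carrier_vec m"
    using assms by auto
  ultimately have "Determinant.det (transpose_mat M) = 0"
    using det_0_iff_vec_prod_zero[of "transpose_mat M" m] M by (metis transpose_carrier_mat)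
  then have "Determinant.det M = 0" using Determinant.det_transpose[OF M] by simp
  then obtain v where v: "v \<in> carrier_vec m" "v \<noteq> 0\<^sub>v m" "M *\<^sub>v v = 0\<^sub>v m"
    using det_0_iff_vec_prod_zero[OF M] by auto
  have "(\<Sum>j<m. a l j * v $ j) = 0" if "l < r" for l
  proof -
    have "(M *\<^sub>v v) $ l = (\<Sum>j<m. a l j * v $ j)"
      using that assms v(1) by (auto simp: M_def scalar_prod_def atLeast0LessThan intro!: sum.cong)
    then show ?thesis using v(3) that assms by simp
  qed
  moreover have "\<exists>j<m. v $ j \<noteq> 0"
    using v(1,2) by (metis carrier_vecD eq_vecI index_zero_vec)
  ultimately show ?thesis by (intro exI[of _ "\<lambda>j. v $ j"]) auto
qed

text \<open>The elements are functions on the whole type; a finite ground set comes in only through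
  the inner product of \<open>orthonormal_family\<close>.\<close>

definition linspan :: "nat \<Rightarrow> (nat \<Rightarrow> 'a \<Rightarrow> real) \<Rightarrow> ('a \<Rightarrow> real) set" where
  "linspan r \<phi> = range (\<lambda>c x. \<Sum>l<r. c l * \<phi> l x)"

definition vanishing :: "('a \<Rightarrow> real) set \<Rightarrow> 'a set \<Rightarrow> ('a \<Rightarrow> real) set" where
  "vanishing W S = {w \<in> W. \<forall>x\<in>S. w x = 0}"

definition orthonormal_family :: "'a set \<Rightarrow> ('a \<Rightarrow> real) set \<Rightarrow> nat \<Rightarrow> (nat \<Rightarrow> 'a \<Rightarrow> real) \<Rightarrow> bool" where
  "orthonormal_family D V m b \<longleftrightarrow> (\<forall>i<m. b i \<in> V) \<and>
     (\<forall>i<m. \<forall>j<m. (\<Sum>x\<in>D. b i x * b j x) = (if i = j then 1 else 0))"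

text \<open>The dimension of \<open>V\<close> restricted to \<open>D\<close>; a maximal size exists in \<open>linspan r \<phi>\<close>, where it is at
  most \<open>r\<close>.\<close>
definition odim :: "'a set \<Rightarrow> ('a \<Rightarrow> real) set \<Rightarrow> nat" where
  "odim D V = (GREATEST m. \<exists>b. orthonormal_family D V m b)"

lemma linspan_add: "v \<in> linspan r \<phi> \<Longrightarrow> w \<in> linspan r \<phi> \<Longrightarrow> (\<lambda>x. v x + w x) \<in> linspan r \<phi>"
proof -
  assume "v \<in> linspan r \<phi>" "w \<in> linspan r \<phi>"
  then obtain c d where "v = (\<lambda>x. \<Sum>l<r. c l * \<phi> l x)" "w = (\<lambda>x. \<Sum>l<r. d l * \<phi> l x)"
    by (auto simp: linspan_def)
  then have "(\<lambda>x. v x + w x) = (\<lambda>x. \<Sum>l<r. (c l + d l) * \<phi> l x)"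
    by (simp add: distrib_right sum.distrib)
  then show ?thesis unfolding linspan_def by (intro image_eqI[of _ _ "\<lambda>l. c l + d l"]) auto
qed

lemma linspan_scale: "v \<in> linspan r \<phi> \<Longrightarrow> (\<lambda>x. a * v x) \<in> linspan r \<phi>"
proof -
  assume "v \<in> linspan r \<phi>"
  then obtain c where "v = (\<lambda>x. \<Sum>l<r. c l * \<phi> l x)" by (auto simp: linspan_def)
  then have "(\<lambda>x. a * v x) = (\<lambda>x. \<Sum>l<r. (a * c l) * \<phi> l x)"
    by (simp add: sum_distrib_left mult.assoc)
  then show ?thesis unfolding linspan_def by (intro image_eqI[of _ _ "\<lambda>l. a * c l"]) auto
qed

text \<open>The summand \<open>a * w x\<close> starts the induction on m. The choice a = 1 serves
  Gram-Schmidt, a = 0 plain combinations of the \<open>b i\<close>.\<close>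

lemma vanishing_combination:
  fixes m :: nat
  assumes "w \<in> vanishing (linspan r \<phi>) S" "\<And>i. i < m \<Longrightarrow> b i \<in> vanishing (linspan r \<phi>) S"
  shows "(\<lambda>x. a * w x + (\<Sum>i<m. c i * b i x)) \<in> vanishing (linspan r \<phi>) S"
  using assms(2)
proof (induction m)
  case 0
  then show ?case using assms(1) by (auto simp: vanishing_def linspan_scale)
next
  case (Suc m)
  have "(\<lambda>x. a * w x + (\<Sum>i<m. c i * b i x)) \<in> vanishing (linspan r \<phi>) S"
    using Suc by auto
  moreover have "(\<lambda>x. c m * b m x) \<in> vanishing (linspan r \<phi>) S"
    using Suc.prems[of m] by (auto simp: vanishing_def linspan_scale)
  ultimately have "(\<lambda>x. (a * w x + (\<Sum>i<m. c i * b i x)) + c m * b m x) \<in> vanishing (linspan r \<phi>) S"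
    by (auto simp: vanishing_def intro!: linspan_add)
  then show ?case by (simp add: add.assoc)
qed

text \<open>More than r elements of a span of r functions satisfy a nontrivial linear relation; its
  inner product with \<open>b j\<close> returns the coefficient \<open>y j\<close>, which would have
  to be 0.\<close>

lemma orthonormal_family_le:
  assumes "orthonormal_family D (vanishing (linspan r \<phi>) S) m b"
  shows "m \<le> r"
proof (rule ccontr)
  assume "\<not> m \<le> r"
  have "\<forall>i\<in>{..<m}. \<exists>c. b i = (\<lambda>x. \<Sum>l<r. c l * \<phi> l x)"
    using assms by (auto simp: orthonormal_family_def vanishing_def linspan_def image_iff)
  from bchoice[OF this] obtain c where c: "\<And>i x. i < m \<Longrightarrow> b i x = (\<Sum>l<r. c i l * \<phi> l x)"
    by auto
  obtain y where y: "\<exists>j<m. y j \<noteq> 0" "\<forall>l<r. (\<Sum>j<m. c j l * y j) = 0"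
    using homogeneous_system_nontrivial[of r m "\<lambda>l j. c j l"] \<open>\<not> m \<le> r\<close> by auto
  have zero: "(\<Sum>j<m. y j * b j x) = 0" for x
  proof -
    have "(\<Sum>j<m. y j * b j x) = (\<Sum>j<m. \<Sum>l<r. (c j l * y j) * \<phi> l x)"
      by (intro sum.cong) (auto simp: c sum_distrib_left algebra_simps)
    also have "\<dots> = (\<Sum>l<r. (\<Sum>j<m. c j l * y j) * \<phi> l x)"
      by (subst sum.swap) (simp add: sum_distrib_right)
    finally show ?thesis using y(2) by simp
  qed
  obtain j where j: "j < m" "y j \<noteq> 0" using y(1) by auto
  have "0 = (\<Sum>x\<in>D. b j x * (\<Sum>i<m. y i * b i x))" using zero by simp
  also have "\<dots> = (\<Sum>i<m. y i * (\<Sum>x\<in>D. b j x * b i x))"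
    by (simp add: sum_distrib_left algebra_simps) (rule sum.swap)
  also have "\<dots> = (\<Sum>i<m. y i * (if j = i then 1 else 0))"
    using assms j(1) by (intro sum.cong) (auto simp: orthonormal_family_def)
  also have "\<dots> = y j" using j(1) by (simp add: if_distrib cong: if_cong)
  finally show False using j(2) by simp
qed

lemma orthonormal_family_0: "orthonormal_family D V 0 b"
  by (simp add: orthonormal_family_def)

lemma odim_attained: "\<exists>b. orthonormal_family D (vanishing (linspan r \<phi>) S) (odim D (vanishing (linspan r \<phi>) S)) b"
  unfolding odim_def
proof (rule GreatestI_nat[where b = r and P = "\<lambda>m. \<exists>b. orthonormal_family D (vanishing (linspan r \<phi>) S) m b"])
  show "\<exists>b. orthonormal_family D (vanishing (linspan r \<phi>) S) 0 b"
    using orthonormal_family_0 by (rule exI)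
qed (auto dest: orthonormal_family_le)

lemma odim_ge:
  assumes "orthonormal_family D (vanishing (linspan r \<phi>) S) m b"
  shows "m \<le> odim D (vanishing (linspan r \<phi>) S)"
  unfolding odim_def
  by (rule Greatest_le_nat[where b = r and P = "\<lambda>m. \<exists>b. orthonormal_family D (vanishing (linspan r \<phi>) S) m b"])
     (use assms in \<open>auto dest: orthonormal_family_le\<close>)

lemma odim_le: "odim D (vanishing (linspan r \<phi>) S) \<le> r"
  using odim_attained[of D r \<phi> S] orthonormal_family_le[of D r \<phi> S] by auto

lemma odim_vanishing_antimono:
  assumes "S \<subseteq> T"
  shows "odim D (vanishing (linspan r \<phi>) T) \<le> odim D (vanishing (linspan r \<phi>) S)"
proof -
  obtain b where "orthonormal_family D (vanishing (linspan r \<phi>) T) (odim D (vanishing (linspan r \<phi>) T)) b"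
    using odim_attained[of D r \<phi> T] by auto
  then have "orthonormal_family D (vanishing (linspan r \<phi>) S) (odim D (vanishing (linspan r \<phi>) T)) b"
    using assms by (auto simp: orthonormal_family_def vanishing_def)
  then show ?thesis by (rule odim_ge)
qed

text \<open>Gram-Schmidt: the \<open>b i\<close> vanish at \<open>x\<close>, so subtracting from
  \<open>w\<close> its projection onto them leaves the value at \<open>x\<close> unchanged. The
  remainder therefore has positive norm on \<open>D\<close> and can be normalised.\<close>

lemma orthonormal_family_extend:
  assumes "finite D" and b: "orthonormal_family D (vanishing (linspan r \<phi>) (insert x S)) m b"
    and w: "w \<in> vanishing (linspan r \<phi>) S" "x \<in> D" "w x \<noteq> 0"
  shows "Suc m \<le> odim D (vanishing (linspan r \<phi>) S)"
proof -
  let ?ip = "\<lambda>f g :: 'a \<Rightarrow> real. \<Sum>x\<in>D. f x * g x"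
  define w' where "w' y = w y - (\<Sum>i<m. ?ip w (b i) * b i y)" for y
  have bx: "b i x = 0" "b i \<in> vanishing (linspan r \<phi>) S" if "i < m" for i
    using b that by (auto simp: orthonormal_family_def vanishing_def)
  have w'x: "w' x = w x" by (simp add: w'_def bx)
  have w'V: "w' \<in> vanishing (linspan r \<phi>) S"
    using vanishing_combination[OF w(1) bx(2), where a = 1 and c = "\<lambda>i. - ?ip w (b i)" and m = m]
    by (simp add: w'_def[abs_def] sum_negf)
  have orth: "?ip w' (b j) = 0" if j: "j < m" for j
  proof -
    have "?ip w' (b j) = ?ip w (b j) - (\<Sum>i<m. ?ip w (b i) * ?ip (b i) (b j))"
      unfolding w'_def
      by (simp add: left_diff_distrib sum_subtractf sum_distrib_right sum_distrib_left mult.assoc)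
         (rule sum.swap)
    also have "(\<Sum>i<m. ?ip w (b i) * ?ip (b i) (b j)) = (\<Sum>i<m. ?ip w (b i) * (if i = j then 1 else 0))"
      using b j by (intro sum.cong) (auto simp: orthonormal_family_def)
    finally show ?thesis using j by (simp add: if_distrib cong: if_cong)
  qed
  define N where "N = ?ip w' w'"
  have "0 < w' x * w' x" using w'x w(3) by (auto simp: zero_less_mult_iff)
  also have "\<dots> \<le> N" unfolding N_def using assms(1) w(2)
    by (intro member_le_sum) auto
  finally have N: "N > 0" .
  define b' where "b' = b(m := (\<lambda>y. (1 / sqrt N) * w' y))"
  have "?ip (b' m) (b' m) = (1 / sqrt N) * (1 / sqrt N) * N"
    unfolding b'_def N_def by (simp add: sum_distrib_left sum_divide_distrib algebra_simps)
  then have "?ip (b' m) (b' m) = 1" using N by simp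
  moreover have "?ip (b' m) (b' j) = 0" "?ip (b' j) (b' m) = 0" if "j < m" for j
  proof -
    have "?ip (b' m) (b' j) = (1 / sqrt N) * ?ip w' (b j)"
      using that by (simp add: b'_def sum_divide_distrib)
    then show "?ip (b' m) (b' j) = 0" using orth[OF that] by simp
    then show "?ip (b' j) (b' m) = 0" by (simp add: mult.commute)
  qed
  moreover have "?ip (b' i) (b' j) = (if i = j then 1 else 0)" if "i < m" "j < m" for i j
    using that b by (simp add: b'_def orthonormal_family_def)
  moreover have "b' i \<in> vanishing (linspan r \<phi>) S" if "i < Suc m" for i
  proof (cases "i = m")
    case True
    have "(\<lambda>y. (1 / sqrt N) * w' y) \<in> vanishing (linspan r \<phi>) S"
      using w'V linspan_scale[of w' r \<phi> "1 / sqrt N"] by (auto simp: vanishing_def)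
    then show ?thesis using True by (simp add: b'_def)
  next
    case False
    then show ?thesis using that bx(2)[of i] by (simp add: b'_def)
  qed
  ultimately have "orthonormal_family D (vanishing (linspan r \<phi>) S) (Suc m) b'"
    by (auto simp: orthonormal_family_def less_Suc_eq)
  then show ?thesis by (rule odim_ge)
qed

text \<open>Trace bound: for an orthonormal basis \<open>b\<close> of the vanishing space, the leverage scores
  \<open>\<Sum>i. (b i x)\<^sup>2\<close> sum to the dimension and are at most \<open>R\<close> each.\<close>
lemma odim_le_card_drop:
  fixes \<phi> :: "nat \<Rightarrow> 'a \<Rightarrow> real" and R :: real
  assumes "finite D" "R > 0"
    and lev: "\<And>w x. w \<in> linspan r \<phi> \<Longrightarrow> x \<in> D \<Longrightarrow> (w x)\<^sup>2 \<le> R * (\<Sum>y\<in>D. (w y)\<^sup>2)"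
  defines "f \<equiv> \<lambda>S. real (odim D (vanishing (linspan r \<phi>) S))"
  shows "f S \<le> R * card {x \<in> D. f (insert x S) \<le> f S - 1}"
proof -
  obtain b m where b: "orthonormal_family D (vanishing (linspan r \<phi>) S) m b" and m: "f S = real m"
    using odim_attained[of D r \<phi> S] that unfolding f_def by auto
  define \<tau> where "\<tau> x = (\<Sum>i<m. (b i x)\<^sup>2)" for x
  have \<tau>0: "\<tau> x \<ge> 0" for x by (simp add: \<tau>_def sum_nonneg)
  have bV: "b i \<in> vanishing (linspan r \<phi>) S" if "i < m" for i using b that by (simp add: orthonormal_family_def)
  have "f S = (\<Sum>i<m. \<Sum>x\<in>D. b i x * b i x)"
    using b m by (simp add: orthonormal_family_def)
  also have "\<dots> = (\<Sum>x\<in>D. \<tau> x)"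
    unfolding \<tau>_def power2_eq_square by (rule sum.swap)
  also have "\<dots> = (\<Sum>x\<in>{x\<in>D. \<tau> x \<noteq> 0}. \<tau> x)"
    using assms(1) by (intro sum.mono_neutral_right) auto
  also have "\<dots> \<le> (\<Sum>x\<in>{x\<in>D. \<tau> x \<noteq> 0}. R)"
  proof (rule sum_mono)
    fix x assume "x \<in> {x\<in>D. \<tau> x \<noteq> 0}"
    then have x: "x \<in> D" "\<tau> x > 0" using \<tau>0[of x] by auto
    \<comment> \<open>The reproducing kernel of the vanishing space at \<open>x\<close>: its value
      at \<open>x\<close> and its squared norm are both \<open>\<tau> x\<close>, so
      \<open>lev\<close> bounds the square of \<open>\<tau> x\<close> by R times
      \<open>\<tau> x\<close>.\<close>
    define w where "w y = (\<Sum>i<m. b i x * b i y)" for y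
    have m0: "m > 0" using x(2) by (cases m) (auto simp: \<tau>_def)
    have wV: "w \<in> vanishing (linspan r \<phi>) S"
      using vanishing_combination[OF bV[OF m0] bV, where a = 0 and c = "\<lambda>i. b i x" and m = m] by (simp add: w_def[abs_def])
    have wx: "w x = \<tau> x" by (simp add: w_def \<tau>_def power2_eq_square)
    have "(\<Sum>y\<in>D. (w y)\<^sup>2) = (\<Sum>y\<in>D. \<Sum>i<m. \<Sum>j<m. (b i x * b j x) * (b i y * b j y))"
      unfolding w_def power2_eq_square sum_product by (simp add: algebra_simps)
    also have "\<dots> = (\<Sum>i<m. \<Sum>y\<in>D. \<Sum>j<m. (b i x * b j x) * (b i y * b j y))"
      by (rule sum.swap)
    also have "\<dots> = (\<Sum>i<m. \<Sum>j<m. \<Sum>y\<in>D. (b i x * b j x) * (b i y * b j y))"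
      by (rule sum.cong[OF refl]) (rule sum.swap)
    also have "\<dots> = (\<Sum>i<m. \<Sum>j<m. (b i x * b j x) * (if i = j then 1 else 0))"
      using b by (intro sum.cong refl) (auto simp: orthonormal_family_def sum_distrib_left[symmetric])
    also have "\<dots> = \<tau> x" by (simp add: \<tau>_def power2_eq_square if_distrib cong: if_cong)
    finally have "(\<tau> x)\<^sup>2 \<le> R * \<tau> x"
      using lev[of w x] x(1) wV wx by (auto simp: vanishing_def)
    then show "\<tau> x \<le> R" using x(2) by (simp add: power2_eq_square)
  qed
  also have "\<dots> = R * card {x\<in>D. \<tau> x \<noteq> 0}" by simp
  also have "\<dots> \<le> R * card {x \<in> D. f (insert x S) \<le> f S - 1}"
  proof (intro mult_left_mono of_nat_mono card_mono subsetI)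
    fix x assume x: "x \<in> {x\<in>D. \<tau> x \<noteq> 0}"
    \<comment> \<open>A nonzero score means that some basis function does not vanish at
      \<open>x\<close>, so the further condition at \<open>x\<close> costs a dimension.\<close>
    have "\<exists>i<m. b i x \<noteq> 0"
      by (rule ccontr) (use x in \<open>simp add: \<tau>_def\<close>)
    then obtain i where i: "i < m" "b i x \<noteq> 0" by auto
    obtain b' where "orthonormal_family D (vanishing (linspan r \<phi>) (insert x S)) (odim D (vanishing (linspan r \<phi>) (insert x S))) b'"
      using odim_attained[of D r \<phi> "insert x S"] by auto
    from orthonormal_family_extend[OF assms(1) this bV[OF i(1)] _ i(2)] x
    show "x \<in> {x \<in> D. f (insert x S) \<le> f S - 1}" by (simp add: f_def)
  qed (use assms in auto)
  finally show ?thesis .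
qed

text \<open>Markov's inequality for an integer quantity: on a bad set the dimension of the vanishing
  space is at least 1. For p >= 1 all of \<open>D\<close> is drawn, and \<open>D\<close> itself is
  never bad.\<close>

lemma prob_bern_set_not_determining:
  fixes \<phi> :: "nat \<Rightarrow> 'a \<Rightarrow> real" and R p :: real
  assumes D: "finite D" "R > 0" "p \<ge> 0"
    and lev: "\<And>w x. w \<in> linspan r \<phi> \<Longrightarrow> x \<in> D \<Longrightarrow> (w x)\<^sup>2 \<le> R * (\<Sum>y\<in>D. (w y)\<^sup>2)"
  shows "measure_pmf.prob (bern_set D (min 1 p))
     {S. \<exists>w\<in>linspan r \<phi>. (\<forall>x\<in>S. w x = 0) \<and> (\<exists>x\<in>D. w x \<noteq> 0)} \<le> r * exp (- p / R)"
    (is "measure_pmf.prob _ ?B \<le> _")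
proof (cases "p < 1")
  case False
  then have "bern_set D (min 1 p) = return_pmf D" using bern_set_1[OF D(1)] by (simp add: min_def)
  moreover have "D \<notin> ?B" by auto
  ultimately show ?thesis by (simp add: measure_return)
next
  case True
  then have p: "min 1 p = p" "p \<in> {0..1}" using D by auto
  define f where "f S = real (odim D (vanishing (linspan r \<phi>) S))" for S
  have "measure_pmf.prob (bern_set D p) ?B = measure_pmf.expectation (bern_set D p) (indicator ?B)"
    by simp
  also have "\<dots> \<le> measure_pmf.expectation (bern_set D p) f"
  proof (rule expectation_bern_set_mono[OF D(1)])
    fix S assume "S \<subseteq> D"
    show "indicator ?B S \<le> f S"
    proof (cases "S \<in> ?B")
      case True
      then obtain w x where w: "w \<in> vanishing (linspan r \<phi>) S" "x \<in> D" "w x \<noteq> 0"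
        by (auto simp: vanishing_def)
      have "Suc 0 \<le> odim D (vanishing (linspan r \<phi>) S)"
        by (rule orthonormal_family_extend[OF D(1) orthonormal_family_0 w])
      then show ?thesis using True by (simp add: f_def)
    qed (simp add: f_def)
  qed
  also have "\<dots> \<le> f {} * exp (- p / R)"
    using odim_le_card_drop[OF D(1,2) lev, of r \<phi>] odim_vanishing_antimono
    by (intro expectation_bern_set_exp_decay[OF D(1) p(2) D(2)]) (auto simp: f_def)
  also have "\<dots> \<le> r * exp (- p / R)"
    using odim_le[of D r \<phi> "{}"] by (intro mult_right_mono) (auto simp: f_def)
  finally show ?thesis using p by simp
qed

section \<open>Sample counts and Gaussian vectors\<close>

lemma nn_integral_exp_card_bern_set:
  assumes "finite D" "p \<in> {0..1}"
  shows "(\<integral>\<^sup>+S. ennreal (exp (real (card S))) \<partial>measure_pmf (bern_set D p)) \<le> ennreal (exp (2 * p * card D))"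
  by (subst nn_integral_eq_integral)
     (use assms expectation_exp_card_bern_set[OF assms] in \<open>simp_all add: integrable_bern_set ennreal_leI\<close>)

text \<open>Chernoff's bound with parameter 1: the exponential moment of the total factors over the
  independent sets, and each factor is at most the exponential of twice the mean.\<close>

lemma prob_total_card_le:
  fixes p0 t :: real and p :: "'k \<Rightarrow> real"
  assumes "finite K" "finite D0" "\<And>k. k \<in> K \<Longrightarrow> finite (D k)"
    and "p0 \<in> {0..1}" "\<And>k. k \<in> K \<Longrightarrow> p k \<in> {0..1}"
  shows "measure_pmf.prob (pair_pmf (bern_set D0 p0) (Pi_pmf K {} (\<lambda>k. bern_set (D k) (p k))))
      {(M, N). real (card M + (\<Sum>k\<in>K. card (N k))) \<le> t}
    \<ge> 1 - exp (2 * (p0 * card D0 + (\<Sum>k\<in>K. p k * card (D k))) - t)"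
proof -
  let ?P = "Pi_pmf K {} (\<lambda>k. bern_set (D k) (p k))"
  let ?Q = "pair_pmf (bern_set D0 p0) ?P"
  let ?e = "\<lambda>S. ennreal (exp (real (card S)))"
  let ?B = "{(M, N). real (card M + (\<Sum>k\<in>K. card (N k))) > t}"
  have "emeasure (measure_pmf ?Q) ?B = (\<integral>\<^sup>+x. indicator ?B x \<partial>measure_pmf ?Q)" by simp
  also have "\<dots> \<le> (\<integral>\<^sup>+(M, N). ennreal (exp (- t)) * (?e M * (\<Prod>k\<in>K. ?e (N k))) \<partial>measure_pmf ?Q)"
  proof (rule nn_integral_mono, clarify)
    fix M N
    have "exp (- t) * (exp (card M) * (\<Prod>k\<in>K. exp (card (N k)))) =
        exp (real (card M + (\<Sum>k\<in>K. card (N k))) - t)"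
      using assms(1) by (simp add: exp_add[symmetric] exp_sum[symmetric])
    then have "ennreal (exp (- t)) * (?e M * (\<Prod>k\<in>K. ?e (N k))) =
        ennreal (exp (real (card M + (\<Sum>k\<in>K. card (N k))) - t))"
      by (simp add: prod_ennreal ennreal_mult[symmetric] prod_nonneg)
    then show "indicator ?B (M, N) \<le> ennreal (exp (- t)) * (?e M * (\<Prod>k\<in>K. ?e (N k)))"
      by (auto simp: indicator_def intro!: ennreal_leI[of 1, simplified])
  qed
  also have "\<dots> = ennreal (exp (- t)) * (\<integral>\<^sup>+M. \<integral>\<^sup>+N. ?e M * (\<Prod>k\<in>K. ?e (N k)) \<partial>measure_pmf ?P \<partial>measure_pmf (bern_set D0 p0))"
    by (subst nn_integral_pair_pmf') (simp add: nn_integral_cmult)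
  also have "\<dots> = ennreal (exp (- t)) * ((\<integral>\<^sup>+M. ?e M \<partial>measure_pmf (bern_set D0 p0)) * (\<Prod>k\<in>K. \<integral>\<^sup>+S. ?e S \<partial>measure_pmf (bern_set (D k) (p k))))"
  proof -
    have "(\<integral>\<^sup>+N. (\<Prod>k\<in>K. ?e (N k)) \<partial>measure_pmf ?P) =
        (\<Prod>k\<in>K. \<integral>\<^sup>+S. ?e S \<partial>measure_pmf (bern_set (D k) (p k)))"
      by (rule nn_integral_prod_Pi_pmf[OF assms(1)])
    then show ?thesis by (simp add: nn_integral_cmult nn_integral_multc)
  qed
  also have "\<dots> \<le> ennreal (exp (- t)) * (ennreal (exp (2 * p0 * card D0)) * (\<Prod>k\<in>K. ennreal (exp (2 * p k * card (D k)))))"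
    using assms by (intro mult_left_mono mult_mono prod_mono_ennreal nn_integral_exp_card_bern_set) auto
  also have "\<dots> = ennreal (exp (- t) * (exp (2 * p0 * card D0) * (\<Prod>k\<in>K. exp (2 * p k * card (D k)))))"
    by (simp add: prod_ennreal ennreal_mult[symmetric] prod_nonneg)
  also have "exp (- t) * (exp (2 * p0 * card D0) * (\<Prod>k\<in>K. exp (2 * p k * card (D k)))) =
     exp (2 * (p0 * card D0 + (\<Sum>k\<in>K. p k * card (D k))) - t)"
    using assms(1) by (simp add: exp_sum[symmetric] exp_add[symmetric] sum_distrib_left algebra_simps)
  finally have "measure_pmf.prob ?Q ?B \<le> exp (2 * (p0 * card D0 + (\<Sum>k\<in>K. p k * card (D k))) - t)"
    by (simp add: measure_pmf.emeasure_eq_measure)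
  moreover have eq: "{(M, N). real (card M + (\<Sum>k\<in>K. card (N k))) \<le> t} = UNIV - ?B" by auto
  have "measure_pmf.prob ?Q (UNIV - ?B) = 1 - measure_pmf.prob ?Q ?B"
    by (subst measure_pmf.prob_compl[symmetric]) auto
  ultimately show ?thesis unfolding eq by linarith
qed

section \<open>Gaussian vectors avoid a fixed hyperplane\<close>

lemma emeasure_std_normal_singleton: "emeasure (density lborel std_normal_density) {y::real} = 0"
  by (subst emeasure_density) (auto intro!: nn_integral_null_set simp: null_sets_def mult.commute)

text \<open>By Fubini: with the other coordinates fixed, the equation determines the coordinate
  \<open>u t\<close>, and a single point is null for the normal law.\<close>

lemma AE_gauss_vec_linear_ne_0:
  fixes c :: "nat \<Rightarrow> real"
  assumes "finite S" "t \<in> S" "c t \<noteq> 0"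
  shows "AE u in gauss_vec S. (\<Sum>i\<in>S. c i * u i) \<noteq> 0"
proof -
  let ?N = "density lborel std_normal_density"
  interpret N: prob_space ?N by (rule prob_space_normal_density) simp
  interpret product_sigma_finite "\<lambda>_::nat. ?N" by unfold_locales
  define I where "I = S - {t}"
  have S: "S = insert t I" "finite I" "t \<notin> I" using assms by (auto simp: I_def)
  have meas: "{u \<in> space (PiM S (\<lambda>_. ?N)). (\<Sum>i\<in>S. c i * u i) = 0} \<in> sets (PiM S (\<lambda>_. ?N))"
  proof -
    have [measurable]: "(\<lambda>u. \<Sum>i\<in>S. c i * u i) \<in> borel_measurable (PiM S (\<lambda>_. ?N))"
    proof (intro borel_measurable_sum borel_measurable_times borel_measurable_const)
      fix i assume "i \<in> S"
      then have "(\<lambda>u. u i) \<in> measurable (PiM S (\<lambda>_. ?N)) ?N" by (rule measurable_component_singleton)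
      then show "(\<lambda>u. u i) \<in> borel_measurable (PiM S (\<lambda>_. ?N))" by (simp cong: measurable_cong_sets)
    qed
    show ?thesis by measurable
  qed
  let ?B = "{u \<in> space (PiM S (\<lambda>_. ?N)). (\<Sum>i\<in>S. c i * u i) = 0}"
  have "emeasure (PiM S (\<lambda>_. ?N)) ?B = (\<integral>\<^sup>+u. indicator ?B u \<partial>PiM (insert t I) (\<lambda>_. ?N))"
    using meas S by simp
  also have "\<dots> = (\<integral>\<^sup>+x. (\<integral>\<^sup>+y. indicator ?B (x(t := y)) \<partial>?N) \<partial>PiM I (\<lambda>_. ?N))"
    using S meas by (intro product_nn_integral_insert) auto
  also have "\<dots> = (\<integral>\<^sup>+x. 0 \<partial>PiM I (\<lambda>_. ?N))"
  proof (rule nn_integral_cong)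
    fix x
    have "(\<integral>\<^sup>+y. indicator ?B (x(t := y)) \<partial>?N) \<le> (\<integral>\<^sup>+y. indicator {- (\<Sum>i\<in>I. c i * x i) / c t} y \<partial>?N)"
    proof (rule nn_integral_mono)
      fix y :: real
      have "(\<Sum>i\<in>I. c i * (x(t := y)) i) = (\<Sum>i\<in>I. c i * x i)"
        using S by (intro sum.cong) auto
      then have "(\<Sum>i\<in>S. c i * (x(t := y)) i) = c t * y + (\<Sum>i\<in>I. c i * x i)"
        using S by simp
      then show "(indicator ?B (x(t := y)) :: ennreal) \<le> indicator {- (\<Sum>i\<in>I. c i * x i) / c t} y"
        using assms(3) by (auto simp: indicator_def field_simps add_eq_0_iff)
    qed
    also have "\<dots> = emeasure ?N {- (\<Sum>i\<in>I. c i * x i) / c t}" by simp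
    finally show "(\<integral>\<^sup>+y. indicator ?B (x(t := y)) \<partial>?N) = 0"
      using emeasure_std_normal_singleton by simp
  qed
  finally have "emeasure (PiM S (\<lambda>_. ?N)) ?B = 0" by simp
  then show ?thesis unfolding gauss_vec_def using meas
    by (intro AE_I[where N = ?B]) auto
qed

section \<open>Full column rank, coherence and pseudoinverses\<close>

lemma mult_mat_assoc_dim:
  "dim_col A = dim_row B \<Longrightarrow> dim_col B = dim_row C \<Longrightarrow> (A * B) * C = A * (B * (C :: real mat))"
  by (rule assoc_mult_mat[of _ "dim_row A" "dim_col A" _ "dim_col B" _ "dim_col C"]; intro carrier_matI; simp)

lemma mult_mat_vec_assoc_dim:
  "dim_col A = dim_row B \<Longrightarrow> dim_col B = dim_vec v \<Longrightarrow> (A * B) *\<^sub>v v = A *\<^sub>v (B *\<^sub>v (v :: real Matrix.vec))"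
  by (rule assoc_mult_mat_vec[of _ "dim_row A" "dim_col A" _ "dim_col B"]; (intro carrier_matI carrier_vecI)?; simp)

lemma transpose_mult_dim:
  "dim_col A = dim_row B \<Longrightarrow> transpose_mat (A * (B :: real mat)) = transpose_mat B * transpose_mat A"
  by (rule transpose_mult[of _ "dim_row A" "dim_col A" _ "dim_col B"]; intro carrier_matI; simp)

lemma mult_mat_cancel:
  assumes "K * L = 1\<^sub>m (dim_row Z)" "dim_col K = dim_row L" "dim_col L = dim_row (Z :: real mat)"
  shows "K * (L * Z) = Z"
proof -
  have "K * (L * Z) = (K * L) * Z" using assms(2,3) by (simp add: mult_mat_assoc_dim)
  then show ?thesis using assms by simp
qed

lemma scalar_prod_self_eq_0:
  fixes v :: "real Matrix.vec"
  assumes "scalar_prod v v = 0"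
  shows "v = 0\<^sub>v (dim_vec v)"
proof (rule eq_vecI)
  fix i assume i: "i < dim_vec (0\<^sub>v (dim_vec v))"
  have "(\<Sum>i\<in>{0..<dim_vec v}. v $ i * v $ i) = 0" using assms by (simp add: scalar_prod_def)
  then have "\<forall>i\<in>{0..<dim_vec v}. v $ i * v $ i = 0"
    by (subst (asm) sum_nonneg_eq_0_iff) auto
  then show "v $ i = 0\<^sub>v (dim_vec v) $ i" using i by auto
qed simp

lemma full_mrank_mult_vec_eq_0:
  assumes A: "A \<in> carrier_mat n r" and "mrank A = r"
    and v: "v \<in> carrier_vec r" "A *\<^sub>v v = 0\<^sub>v n"
  shows "v = 0\<^sub>v r"
proof (rule ccontr)
  assume v0: "v \<noteq> 0\<^sub>v r"
  interpret vec_space "TYPE(real)" n .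
  have rk: "rank A = r" using assms by (auto simp: mrank_def)
  obtain U where U: "maximal U (\<lambda>T. T \<subseteq> set (cols A) \<and> lin_indpt T)"
    using maximal_exists[of "\<lambda>T. T \<subseteq> set (cols A) \<and> lin_indpt T" "card (set (cols A))" "{}"]
    by (meson List.finite_set card_mono empty_iff empty_subsetI finite_lin_indpt2 rev_finite_subset)
  have "r = card U" using rank_card_indpt[OF A U] rk by simp
  also have "\<dots> \<le> card (set (cols A))" using U by (simp add: card_mono maximal_def)
  \<comment> \<open>Linear independence is a property of the set of columns, so repeated columns
    must be excluded before a kernel vector can contradict it.\<close>
  finally have "distinct (cols A)"
    using A card_length[of "cols A"] by (intro card_distinct) auto
  then show False
    using full_rank_lin_indpt[OF A rk] lin_depI[OF A v(1) v0 v(2)] by blast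
qed

lemma full_mrank_indep:
  fixes c :: "nat \<Rightarrow> real"
  assumes A: "A \<in> carrier_mat n r" "mrank A = r"
    and z: "\<And>i. i < n \<Longrightarrow> (\<Sum>l<r. c l * A $$ (i,l)) = 0" and "l < r"
  shows "c l = 0"
proof -
  have "A *\<^sub>v Matrix.vec r c = 0\<^sub>v n"
    using A(1) z by (intro eq_vecI) (auto simp: scalar_prod_def atLeast0LessThan mult.commute)
  then have "Matrix.vec r c = 0\<^sub>v r" using full_mrank_mult_vec_eq_0[OF A] by simp
  then show ?thesis using assms(4) by (metis index_vec index_zero_vec(1))
qed

text \<open>P is the inverse of A^T A times A^T; the Gram matrix is invertible because its quadratic
  form at v is |A v|^2. The symmetry of \<open>A * P\<close> makes it the orthogonal projection onto
  the column space, which both \<open>proj_col\<close> and the Penrose conditions rely on.\<close>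

lemma full_mrank_left_inverse:
  assumes A: "A \<in> carrier_mat n r" "mrank A = r"
  obtains P where "P \<in> carrier_mat r n" "P * A = 1\<^sub>m r" "transpose_mat (A * P) = A * P"
proof -
  define G where "G = transpose_mat A * A"
  have G: "G \<in> carrier_mat r r" and GT: "transpose_mat G = G"
    using A by (auto simp: G_def transpose_mult_dim)
  have "Determinant.det G \<noteq> 0"
  proof
    assume "Determinant.det G = 0"
    then obtain v where v: "v \<in> carrier_vec r" "v \<noteq> 0\<^sub>v r" "G *\<^sub>v v = 0\<^sub>v r"
      using det_0_iff_vec_prod_zero[OF G] by auto
    have "scalar_prod (A *\<^sub>v v) (A *\<^sub>v v) = scalar_prod (transpose_mat A *\<^sub>v (A *\<^sub>v v)) v"
      using A v(1) by (subst transpose_vec_mult_scalar[of A n r]) auto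
    also have "transpose_mat A *\<^sub>v (A *\<^sub>v v) = G *\<^sub>v v"
      unfolding G_def using A v(1) by (subst mult_mat_vec_assoc_dim) auto
    finally have "A *\<^sub>v v = 0\<^sub>v n"
      using v A scalar_prod_self_eq_0[of "A *\<^sub>v v"] by auto
    then show False using full_mrank_mult_vec_eq_0[OF A v(1)] v(2) by simp
  qed
  then have "G \<in> Units (ring_mat TYPE(real) r ())" by (rule det_non_zero_imp_unit[OF G])
  then obtain H where H: "H \<in> carrier_mat r r" "H * G = 1\<^sub>m r" "G * H = 1\<^sub>m r"
    by (auto simp: Units_def ring_mat_def)
  \<comment> \<open>\<open>G\<close> is symmetric, so the transpose of its right inverse
    \<open>H\<close> is a left inverse, and the two coincide.\<close>
  have "transpose_mat H * G = 1\<^sub>m r"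
    using transpose_mult[OF G H(1)] unfolding H(3) GT by simp
  then have "transpose_mat H * G * H = H" using H by simp
  moreover have "transpose_mat H * G * H = transpose_mat H"
    using G H by (subst mult_mat_assoc_dim) auto
  ultimately have HT: "transpose_mat H = H" by simp
  show ?thesis
  proof (rule that[of "H * transpose_mat A"])
    show "H * transpose_mat A * A = 1\<^sub>m r"
      using A H by (subst mult_mat_assoc_dim) (auto simp: G_def)
    show "transpose_mat (A * (H * transpose_mat A)) = A * (H * transpose_mat A)"
      using A H by (simp add: transpose_mult_dim HT mult_mat_assoc_dim)
  qed (use A H in auto)
qed

section \<open>Orthogonal projections and coherence\<close>

lemma proj_col_eqI:
  assumes w: "w \<in> col_space M" and x: "x \<in> carrier_vec (dim_row M)"
    and orth: "\<And>v. v \<in> col_space M \<Longrightarrow> scalar_prod (x - w) v = 0"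
  shows "proj_col M x = w"
  unfolding proj_col_def
proof (rule the_equality)
  show "w \<in> col_space M \<and> (\<forall>v\<in>col_space M. scalar_prod (x - w) v = 0)" using w orth by auto
next
  fix w' assume w': "w' \<in> col_space M \<and> (\<forall>v\<in>col_space M. scalar_prod (x - w') v = 0)"
  have c: "w \<in> carrier_vec (dim_row M)" "w' \<in> carrier_vec (dim_row M)"
    using w w' by (auto simp: col_space_def intro!: carrier_vecI)
  obtain a b where ab: "w = M *\<^sub>v a" "w' = M *\<^sub>v b" "a \<in> carrier_vec (dim_col M)" "b \<in> carrier_vec (dim_col M)"
    using w w' by (auto simp: col_space_def)
  have "w' - w = M *\<^sub>v (b - a)"
    using ab by (simp add: mult_minus_distrib_mat_vec[of M "dim_row M" "dim_col M"])
  then have d: "w' - w \<in> col_space M" using ab by (auto simp: col_space_def intro!: exI[of _ "b - a"])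
  have "w' - w = (x - w) - (x - w')"
    using c x by (intro eq_vecI) auto
  then have "scalar_prod (w' - w) (w' - w) = scalar_prod (x - w) (w' - w) - scalar_prod (x - w') (w' - w)"
    using c x by (metis minus_carrier_vec minus_scalar_prod_distrib)
  then have "w' - w = 0\<^sub>v (dim_row M)"
    using orth[OF d] w' d c scalar_prod_self_eq_0[of "w' - w"] by auto
  then have "(w' - w) $ i = 0" if "i < dim_row M" for i using that by simp
  then show "w' = w" using c by (intro eq_vecI) auto
qed

text \<open>Makes the description in \<open>proj_col\<close> proper: A (P x) is the projection,
  because \<open>A * P\<close> is symmetric and fixes the column space.\<close>

lemma proj_col_full_rank:
  assumes A: "A \<in> carrier_mat n r" "mrank A = r" and x: "x \<in> carrier_vec n"
  shows "proj_col A x \<in> col_space A" "\<And>v. v \<in> col_space A \<Longrightarrow> scalar_prod (x - proj_col A x) v = 0"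
proof -
  obtain P where P: "P \<in> carrier_mat r n" "P * A = 1\<^sub>m r" "transpose_mat (A * P) = A * P"
    using full_mrank_left_inverse[OF A] by blast
  define w where "w = A *\<^sub>v (P *\<^sub>v x)"
  have w: "w \<in> col_space A" using A P x by (auto simp: w_def col_space_def)
  have wc: "w \<in> carrier_vec n" using A P x by (auto simp: w_def)
  have orth: "scalar_prod (x - w) v = 0" if v: "v \<in> col_space A" for v
  proof -
    obtain c where c: "c \<in> carrier_vec r" "v = A *\<^sub>v c" using v A by (auto simp: col_space_def)
    have vc: "v \<in> carrier_vec n" using c A by auto
    have "P *\<^sub>v (A *\<^sub>v c) = (P * A) *\<^sub>v c"
      using A P c by (subst mult_mat_vec_assoc_dim) auto
    then have "P *\<^sub>v (A *\<^sub>v c) = c" using c P by simp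
    moreover have "A * P *\<^sub>v v = A *\<^sub>v (P *\<^sub>v v)"
      using A P vc by (subst mult_mat_vec_assoc_dim) auto
    ultimately have APv: "A * P *\<^sub>v v = v" using c by simp
    have "scalar_prod w v = scalar_prod v (A * P *\<^sub>v x)"
      using A P x vc wc comm_scalar_prod[OF wc vc] by (simp add: w_def mult_mat_vec_assoc_dim)
    also have "\<dots> = scalar_prod (transpose_mat (A * P) *\<^sub>v v) x"
      using A P x vc by (subst transpose_vec_mult_scalar[of "A * P" n n]) auto
    also have "\<dots> = scalar_prod x v" using P(3) APv comm_scalar_prod[OF x vc] by simp
    finally show ?thesis using minus_scalar_prod_distrib[OF x wc vc] by simp
  qed
  have "proj_col A x = w" using proj_col_eqI[OF w _ orth] x A by auto
  then show "proj_col A x \<in> col_space A" "\<And>v. v \<in> col_space A \<Longrightarrow> scalar_prod (x - proj_col A x) v = 0"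
    using w orth by auto
qed

text \<open>Coordinate i of an element w of the column space is the inner product of w with the
  projection of the i-th unit vector. Cauchy-Schwarz applies, and coherence bounds the squared norm
  of that projection by \<mu> r / n.\<close>

lemma coherence_leverage:
  assumes A: "A \<in> carrier_mat n r" "mrank A = r" and r: "r > 0"
    and coh: "coherence A \<le> \<mu>" and i: "i < n"
  shows "(\<Sum>l<r. c l * A $$ (i,l))\<^sup>2 \<le> \<mu> * r / n * (\<Sum>j<n. (\<Sum>l<r. c l * A $$ (j,l))\<^sup>2)"
proof -
  define w where "w = A *\<^sub>v Matrix.vec r c"
  have w: "w \<in> carrier_vec n" "w \<in> col_space A" using A by (auto simp: w_def col_space_def)
  have wi: "w $ j = (\<Sum>l<r. c l * A $$ (j,l))" if "j < n" for j
    using A that by (simp add: w_def scalar_prod_def atLeast0LessThan mult.commute)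
  define p where "p = proj_col A (unit_vec n i)"
  have pA: "p \<in> col_space A" and orth: "scalar_prod (unit_vec n i - p) w = 0"
    using proj_col_full_rank[OF A, of "unit_vec n i"] w by (auto simp: p_def)
  have pc: "p \<in> carrier_vec n" using pA A by (auto simp: col_space_def)
  have "scalar_prod p p \<le> Max ((\<lambda>i. scalar_prod (proj_col A (unit_vec (dim_row A) i)) (proj_col A (unit_vec (dim_row A) i)))
          ` {..<dim_row A})" (is "_ \<le> ?M")
    using A i by (intro Max_ge) (auto simp: p_def)
  moreover have "real n / real r * ?M \<le> \<mu>" using coh A by (simp add: coherence_def coh_def)
  then have "?M \<le> \<mu> * r / n" using r i by (simp add: field_simps)
  ultimately have pp: "scalar_prod p p \<le> \<mu> * r / n" by linarith
  have "w $ i = scalar_prod (unit_vec n i) w" using w i by simp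
  also have "\<dots> = scalar_prod p w"
    using orth minus_scalar_prod_distrib[of "unit_vec n i" n p w] pc w by simp
  finally have wip: "w $ i = (\<Sum>j<n. p $ j * w $ j)" using w by (simp add: scalar_prod_def atLeast0LessThan)
  have "(w $ i)\<^sup>2 \<le> (\<Sum>j<n. (p $ j)\<^sup>2) * (\<Sum>j<n. (w $ j)\<^sup>2)"
    unfolding wip by (rule Cauchy_Schwarz_ineq_sum)
  also have "(\<Sum>j<n. (p $ j)\<^sup>2) = scalar_prod p p"
    using pc by (simp add: scalar_prod_def atLeast0LessThan power2_eq_square)
  also have "scalar_prod p p * (\<Sum>j<n. (w $ j)\<^sup>2) \<le> \<mu> * r / n * (\<Sum>j<n. (w $ j)\<^sup>2)"
    by (intro mult_right_mono pp sum_nonneg) auto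
  finally show ?thesis using wi i by simp
qed

lemma coh_cong:
  assumes "dim_row M = dim_row N" "col_space M = col_space N"
  shows "coh M k = coh N k"
proof -
  have "proj_col M = proj_col N" by (intro ext) (simp add: proj_col_def assms)
  then show ?thesis by (simp add: coh_def assms)
qed

lemma mrank_cong:
  assumes "dim_row M = dim_row N" "col_space M = col_space N"
  shows "mrank M = mrank N"
proof -
  interpret vec_space "TYPE(real)" "dim_row N" .
  have *: "span (set (cols K)) = Defs.col_space K" if "dim_row K = dim_row N" for K :: "real mat"
  proof -
    have "K \<in> carrier_mat (dim_row N) (dim_col K)" using that by auto
    from col_space_eq[OF this] show ?thesis
      unfolding vec_space.col_space_def by (auto simp: Defs.col_space_def intro!: carrier_vecI)
  qed
  show ?thesis using *[of M] *[of N] assms by (simp add: mrank_def rank_def)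
qed

section \<open>Moore-Penrose inverses\<close>

lemma pinv_eqI:
  assumes Y: "Y \<in> carrier_mat (dim_col X) (dim_row X)"
    and p: "X * Y * X = X" "Y * X * Y = Y" "transpose_mat (X * Y) = X * Y" "transpose_mat (Y * X) = Y * X"
  shows "pinv X = Y"
  unfolding pinv_def
proof (rule the_equality)
  fix Z assume Z: "Z \<in> carrier_mat (dim_col X) (dim_row X) \<and> X * Z * X = X \<and> Z * X * Z = Z \<and>
      transpose_mat (X * Z) = X * Z \<and> transpose_mat (Z * X) = Z * X"
  have dims: "dim_row Y = dim_col X" "dim_col Y = dim_row X" "dim_row Z = dim_col X" "dim_col Z = dim_row X"
    using Y Z by auto
  have "(X * Z) * (X * Y) = (X * Z * X) * Y" "(X * Y) * (X * Z) = (X * Y * X) * Z"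
    "(Z * X) * (Y * X) = Z * (X * Y * X)" "(Y * X) * (Z * X) = Y * (X * Z * X)"
    using dims by (simp_all add: mult_mat_assoc_dim)
  then have e: "(X * Z) * (X * Y) = X * Y" "(X * Y) * (X * Z) = X * Z"
    "(Z * X) * (Y * X) = Z * X" "(Y * X) * (Z * X) = Y * X"
    using Z p by simp_all
  \<comment> \<open>X Y and X Z absorb each other and are symmetric; transposing the product swaps
    the order and so identifies the two. The same works for Y X and Z X.\<close>
  have "X * Y = transpose_mat ((X * Z) * (X * Y))" using e p by simp
  also have "\<dots> = transpose_mat (X * Y) * transpose_mat (X * Z)"
    using dims by (intro transpose_mult_dim) simp
  also have "\<dots> = X * Z" using Z p e by simp
  finally have 1: "X * Y = X * Z" .
  have "Y * X = transpose_mat ((Y * X) * (Z * X))" using e p by simp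
  also have "\<dots> = transpose_mat (Z * X) * transpose_mat (Y * X)"
    using dims by (intro transpose_mult_dim) simp
  also have "\<dots> = Z * X" using Z p e by simp
  finally have 2: "Y * X = Z * X" .
  have "Z = (Z * X) * Z" using Z by simp
  also have "\<dots> = Y * (X * Z)" using dims by (simp add: 2[symmetric] mult_mat_assoc_dim)
  also have "\<dots> = Y * X * Y" using dims by (simp add: 1[symmetric] mult_mat_assoc_dim)
  finally show "Z = Y" using p by simp
qed (use assms in auto)

text \<open>All Penrose conditions reduce to two products: in one order the matrices collapse to
  \<open>A * P\<close>, in the other to \<open>B * Q\<close>, and both are symmetric.\<close>

lemma pinv_factored:
  assumes A: "A \<in> carrier_mat n r" "P \<in> carrier_mat r n" "P * A = 1\<^sub>m r" "transpose_mat (A * P) = A * P"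
    and B: "B \<in> carrier_mat m r" "Q \<in> carrier_mat r m" "Q * B = 1\<^sub>m r" "transpose_mat (B * Q) = B * Q"
    and D: "D \<in> carrier_mat r r" "E \<in> carrier_mat r r" "D * E = 1\<^sub>m r" "E * D = 1\<^sub>m r"
  shows "pinv (A * (D * transpose_mat B)) = transpose_mat Q * (E * P)"
proof -
  note dims = A(1,2)[THEN carrier_matD(1)] A(1,2)[THEN carrier_matD(2)]
     B(1,2)[THEN carrier_matD(1)] B(1,2)[THEN carrier_matD(2)]
     D(1,2)[THEN carrier_matD(1)] D(1,2)[THEN carrier_matD(2)]
  have BQ: "transpose_mat B * transpose_mat Q = 1\<^sub>m r"
    using transpose_mult[OF B(2,1)] unfolding B(3) by simp
  have c: "P * (A * Z) = Z" "D * (E * Z) = Z" "E * (D * Z) = Z" "transpose_mat B * (transpose_mat Q * Z) = Z"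
    if "dim_row Z = r" for Z
    using that by (simp_all add: mult_mat_cancel A B D BQ dims)
  note s = dims mult_mat_assoc_dim c BQ A(3) B(3) D(3,4)
  let ?X = "A * (D * transpose_mat B)" and ?Y = "transpose_mat Q * (E * P)"
  have XY: "?X * ?Y = A * P" by (simp add: s)
  have "?Y * ?X = transpose_mat Q * transpose_mat B" by (simp add: s)
  then have YX: "?Y * ?X = B * Q" using B by (simp add: transpose_mult_dim)
  show ?thesis
  proof (rule pinv_eqI)
    show "?X * ?Y * ?X = ?X" unfolding XY by (simp add: s)
    show "?Y * ?X * ?Y = ?Y" by (simp add: s)
  qed (use A B D XY YX in auto)
qed

section \<open>Jennrich's algorithm\<close>

text \<open>A nonzero eigenvalue puts \<open>x\<close> into the range of \<open>A\<close>, so x = A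
  y with y = P x. Then y is an eigenvector of the diagonal matrix, and distinct diagonal entries
  confine it to one coordinate.\<close>

lemma eigenvector_diagonalizable:
  fixes A :: "real mat"
  assumes A: "A \<in> carrier_mat n r" "P \<in> carrier_mat r n" "P * A = 1\<^sub>m r"
    and f: "inj_on f {..<r}" and ev: "eigenvector (A * (mat_diag r f * P)) x \<kappa>" "\<kappa> \<noteq> 0"
  obtains m \<alpha> where "m < r" "\<alpha> \<noteq> 0" "\<kappa> = f m" "x = \<alpha> \<cdot>\<^sub>v col A m"
proof -
  have x: "x \<in> carrier_vec n" "x \<noteq> 0\<^sub>v n" "(A * (mat_diag r f * P)) *\<^sub>v x = \<kappa> \<cdot>\<^sub>v x"
    using ev A by (auto simp: eigenvector_def)
  define y where "y = P *\<^sub>v x"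
  define z where "z = mat_diag r f *\<^sub>v y"
  have y: "y \<in> carrier_vec r" using A x by (auto simp: y_def)
  have z: "z \<in> carrier_vec r" unfolding z_def by (rule mult_mat_vec_carrier[OF mat_diag_dim y])
  have "(A * (mat_diag r f * P)) *\<^sub>v x = A *\<^sub>v ((mat_diag r f * P) *\<^sub>v x)"
    using A x by (intro mult_mat_vec_assoc_dim) (auto simp: mat_diag_def)
  also have "(mat_diag r f * P) *\<^sub>v x = z"
    unfolding z_def y_def using A x by (intro mult_mat_vec_assoc_dim) (auto simp: mat_diag_def)
  finally have Az: "A *\<^sub>v z = \<kappa> \<cdot>\<^sub>v x" using x by simp
  have "P *\<^sub>v (A *\<^sub>v z) = (P * A) *\<^sub>v z"
    using A z by (intro mult_mat_vec_assoc_dim[symmetric]) auto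
  then have "P *\<^sub>v (A *\<^sub>v z) = z" using A z by simp
  moreover have "P *\<^sub>v (\<kappa> \<cdot>\<^sub>v x) = \<kappa> \<cdot>\<^sub>v y"
    unfolding y_def using A x by (intro mult_mat_vec) auto
  ultimately have zy: "z = \<kappa> \<cdot>\<^sub>v y" using Az by simp
  have "A *\<^sub>v (\<kappa> \<cdot>\<^sub>v y) = \<kappa> \<cdot>\<^sub>v (A *\<^sub>v y)"
    using A y by (intro mult_mat_vec) auto
  then have "\<kappa> \<cdot>\<^sub>v (A *\<^sub>v y) = \<kappa> \<cdot>\<^sub>v x" using Az zy by simp
  then have "(inverse \<kappa> * \<kappa>) \<cdot>\<^sub>v (A *\<^sub>v y) = (inverse \<kappa> * \<kappa>) \<cdot>\<^sub>v x"
    by (metis smult_smult_assoc)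
  then have xy: "x = A *\<^sub>v y" using ev(2) by simp
  have fy: "f i * y $ i = \<kappa> * y $ i" if "i < r" for i
  proof -
    have "z $ i = (\<Sum>j\<in>{0..<r}. (if i = j then f j else 0) * y $ j)"
      using that y by (simp add: z_def mat_diag_def scalar_prod_def)
    also have "\<dots> = (\<Sum>j\<in>{0..<r}. (if i = j then f j * y $ j else 0))"
      by (intro sum.cong) auto
    also have "\<dots> = f i * y $ i" using that by simp
    finally show ?thesis using zy that y by auto
  qed
  have "y \<noteq> 0\<^sub>v r" using xy x A by auto
  then obtain m where m: "m < r" "y $ m \<noteq> 0"
    using y by (metis carrier_vecD eq_vecI index_zero_vec)
  have fm: "f m = \<kappa>" using fy[OF m(1)] m(2) by simp
  have "y $ i = 0" if "i < r" "i \<noteq> m" for i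
    using fy[OF that(1)] fm f that m(1) by (auto dest: inj_onD)
  then have "y = y $ m \<cdot>\<^sub>v unit_vec r m"
    using y m(1) by (intro eq_vecI) auto
  then have "x = A *\<^sub>v (y $ m \<cdot>\<^sub>v unit_vec r m)" using xy by metis
  also have "\<dots> = y $ m \<cdot>\<^sub>v (A *\<^sub>v unit_vec r m)"
    using A by (intro mult_mat_vec) auto
  also have "A *\<^sub>v unit_vec r m = col A m"
    using A m(1) by (intro eq_vecI) auto
  finally show ?thesis using that m fm by blast
qed

lemma eigenvector_diagonalizable_col:
  fixes A :: "real mat"
  assumes A: "A \<in> carrier_mat n r" "P \<in> carrier_mat r n" "P * A = 1\<^sub>m r" and m: "m < r"
  shows "eigenvector (A * (mat_diag r f * P)) (col A m) (f m)"
proof -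
  have cA: "A *\<^sub>v unit_vec r m = col A m" using A m by (intro eq_vecI) auto
  have cc: "col A m \<in> carrier_vec n" using A m by auto
  have "P *\<^sub>v (A *\<^sub>v unit_vec r m) = (P * A) *\<^sub>v unit_vec r m"
    using A by (intro mult_mat_vec_assoc_dim[symmetric]) auto
  then have Pc: "P *\<^sub>v col A m = unit_vec r m" using A cA by simp
  have "col A m \<noteq> 0\<^sub>v n"
  proof
    assume "col A m = 0\<^sub>v n"
    then have "P *\<^sub>v 0\<^sub>v n = unit_vec r m" using Pc by simp
    then have "(P *\<^sub>v 0\<^sub>v n) $ m = 1" using m by simp
    then show False using A m by (simp add: scalar_prod_def)
  qed
  moreover have "(A * (mat_diag r f * P)) *\<^sub>v col A m = f m \<cdot>\<^sub>v col A m"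
  proof -
    have "(A * (mat_diag r f * P)) *\<^sub>v col A m = A *\<^sub>v ((mat_diag r f * P) *\<^sub>v col A m)"
      using A cc by (intro mult_mat_vec_assoc_dim) (auto simp: mat_diag_def)
    also have "(mat_diag r f * P) *\<^sub>v col A m = mat_diag r f *\<^sub>v unit_vec r m"
      unfolding Pc[symmetric] using A cc by (intro mult_mat_vec_assoc_dim) (auto simp: mat_diag_def)
    also have "mat_diag r f *\<^sub>v unit_vec r m = f m \<cdot>\<^sub>v unit_vec r m"
      using m by (intro eq_vecI) (auto simp: mat_diag_def)
    also have "A *\<^sub>v (f m \<cdot>\<^sub>v unit_vec r m) = f m \<cdot>\<^sub>v (A *\<^sub>v unit_vec r m)"
      using A by (intro mult_mat_vec) auto
    finally show ?thesis using cA by simp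
  qed
  ultimately show ?thesis using A cc by (auto simp: eigenvector_def)
qed

lemma diagonal_factorization:
  fixes A B :: "real mat"
  assumes "A \<in> carrier_mat n r" "B \<in> carrier_mat m r"
  shows "A * (mat_diag r f * transpose_mat B) =
    Matrix.mat n m (\<lambda>(i,j). \<Sum>l<r. f l * A $$ (i,l) * B $$ (j,l))"
proof -
  have "mat_diag r f * transpose_mat B = Matrix.mat r m (\<lambda>(i,j). f i * B $$ (j,i))"
    using assms by (subst mat_diag_mult_left[of _ r m]) (auto intro!: eq_matI)
  then show ?thesis using assms
    by (intro eq_matI) (auto simp: scalar_prod_def atLeast0LessThan mult_ac intro!: sum.cong)
qed

lemma pinv_product_diagonal:
  fixes f g :: "nat \<Rightarrow> real"
  assumes A: "A \<in> carrier_mat n r" "P \<in> carrier_mat r n" "P * A = 1\<^sub>m r" "transpose_mat (A * P) = A * P"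
    and B: "B \<in> carrier_mat m r" "Q \<in> carrier_mat r m" "Q * B = 1\<^sub>m r" "transpose_mat (B * Q) = B * Q"
    and g: "\<And>l. l < r \<Longrightarrow> g l \<noteq> 0"
  shows "A * (mat_diag r f * transpose_mat B) * pinv (A * (mat_diag r g * transpose_mat B))
    = A * (mat_diag r (\<lambda>l. f l / g l) * P)"
proof -
  let ?h = "\<lambda>l. 1 / g l"
  have 1: "mat_diag r g * mat_diag r ?h = 1\<^sub>m r" "mat_diag r ?h * mat_diag r g = 1\<^sub>m r"
    unfolding mat_diag_diag using g by (auto simp: mat_diag_def intro!: eq_matI)
  have pinv: "pinv (A * (mat_diag r g * transpose_mat B)) = transpose_mat Q * (mat_diag r ?h * P)"
    by (rule pinv_factored[OF A B mat_diag_dim mat_diag_dim 1])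
  have BQ: "transpose_mat B * transpose_mat Q = 1\<^sub>m r"
    using transpose_mult[OF B(2,1)] unfolding B(3) by simp
  have dd: "dim_row (mat_diag r k) = r" "dim_col (mat_diag r k) = r" for k :: "nat \<Rightarrow> real"
    by (simp_all add: mat_diag_def)
  note dims = A(1,2)[THEN carrier_matD(1)] A(1,2)[THEN carrier_matD(2)]
     B(1,2)[THEN carrier_matD(1)] B(1,2)[THEN carrier_matD(2)] dd
  have c1: "transpose_mat B * (transpose_mat Q * Z) = Z" if "dim_row Z = r" for Z
    by (rule mult_mat_cancel) (simp_all add: BQ dims that)
  have c2: "mat_diag r f * (mat_diag r ?h * P) = mat_diag r (\<lambda>l. f l / g l) * P"
    by (subst mult_mat_assoc_dim[symmetric]) (simp_all add: dims)
  show ?thesis unfolding pinv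
    by (simp add: mult_mat_assoc_dim dims c1 c2)
qed

text \<open>Transposition exchanges \<open>A\<close> and \<open>B\<close>, and the second product
  also exchanges f and g; therefore it carries the reciprocal ratios on its diagonal.\<close>

lemma jennrich_products:
  fixes f g :: "nat \<Rightarrow> real"
  assumes A: "A \<in> carrier_mat n r" "mrank A = r" and B: "B \<in> carrier_mat m r" "mrank B = r"
    and fg: "\<And>l. l < r \<Longrightarrow> f l \<noteq> 0" "\<And>l. l < r \<Longrightarrow> g l \<noteq> 0"
  defines "X \<equiv> \<lambda>f. Matrix.mat n m (\<lambda>(i,j). \<Sum>l<r. f l * A $$ (i,l) * B $$ (j,l))"
  obtains P Q where "P \<in> carrier_mat r n" "P * A = 1\<^sub>m r" "Q \<in> carrier_mat r m" "Q * B = 1\<^sub>m r"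
    "X f * pinv (X g) = A * (mat_diag r (\<lambda>l. f l / g l) * P)"
    "transpose_mat (X g) * pinv (transpose_mat (X f)) = B * (mat_diag r (\<lambda>l. 1 / (f l / g l)) * Q)"
proof -
  obtain P where P: "P \<in> carrier_mat r n" "P * A = 1\<^sub>m r" "transpose_mat (A * P) = A * P"
    using full_mrank_left_inverse[OF A] by blast
  obtain Q where Q: "Q \<in> carrier_mat r m" "Q * B = 1\<^sub>m r" "transpose_mat (B * Q) = B * Q"
    using full_mrank_left_inverse[OF B] by blast
  have X: "X f = A * (mat_diag r f * transpose_mat B)" for f
    unfolding X_def diagonal_factorization[OF A(1) B(1)] ..
  have XT: "transpose_mat (X f) = B * (mat_diag r f * transpose_mat A)" for f
    unfolding X_def diagonal_factorization[OF B(1) A(1)]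
    by (intro eq_matI) (auto simp: algebra_simps intro!: sum.cong)
  show ?thesis
  proof (rule that[OF P(1,2) Q(1,2)])
    show "X f * pinv (X g) = A * (mat_diag r (\<lambda>l. f l / g l) * P)"
      unfolding X by (rule pinv_product_diagonal[OF A(1) P B(1) Q fg(2)])
    show "transpose_mat (X g) * pinv (transpose_mat (X f)) = B * (mat_diag r (\<lambda>l. 1 / (f l / g l)) * Q)"
      unfolding XT using pinv_product_diagonal[OF B(1) Q A(1) P fg(1), where f = g] by simp
  qed
qed

section \<open>Jennrich's algorithm on exactly completed slices\<close>

context
  fixes n1 n2 r :: nat and A B :: "real mat" and S :: "nat set"
    and Xs :: "nat \<Rightarrow> real mat" and g :: "nat \<Rightarrow> nat \<Rightarrow> real" and u v :: "nat \<Rightarrow> real"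
    and du dv :: "nat \<Rightarrow> real"
  assumes A: "A \<in> carrier_mat n1 r" "mrank A = r" and B: "B \<in> carrier_mat n2 r" "mrank B = r"
    and Xs: "\<And>t. t \<in> S \<Longrightarrow> Xs t = Matrix.mat n1 n2 (\<lambda>(i,j). \<Sum>l<r. g t l * A $$ (i,l) * B $$ (j,l))"
    and du: "\<And>l. l < r \<Longrightarrow> du l = (\<Sum>t\<in>S. u t * g t l)" "\<And>l. l < r \<Longrightarrow> du l \<noteq> 0"
    and dv: "\<And>l. l < r \<Longrightarrow> dv l = (\<Sum>t\<in>S. v t * g t l)" "\<And>l. l < r \<Longrightarrow> dv l \<noteq> 0"
    and neq: "\<And>l m. l < r \<Longrightarrow> m < r \<Longrightarrow> l \<noteq> m \<Longrightarrow> du l * dv m \<noteq> du m * dv l"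
begin

lemma jennrich_slices:
  assumes "\<And>l. l < r \<Longrightarrow> d l = (\<Sum>t\<in>S. w t * g t l)"
  shows "Matrix.mat n1 n2 (\<lambda>(i,j). \<Sum>t\<in>S. w t * Xs t $$ (i,j)) =
    Matrix.mat n1 n2 (\<lambda>(i,j). \<Sum>l<r. d l * A $$ (i,l) * B $$ (j,l))"
proof (rule eq_matI; clarsimp)
  fix i j assume ij: "i < n1" "j < n2"
  have "(\<Sum>t\<in>S. w t * Xs t $$ (i,j)) = (\<Sum>t\<in>S. \<Sum>l<r. w t * g t l * (A $$ (i,l) * B $$ (j,l)))"
    using ij by (intro sum.cong) (simp_all add: Xs sum_distrib_left mult.assoc)
  also have "\<dots> = (\<Sum>l<r. \<Sum>t\<in>S. w t * g t l * (A $$ (i,l) * B $$ (j,l)))" by (rule sum.swap)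
  also have "\<dots> = (\<Sum>l<r. d l * A $$ (i,l) * B $$ (j,l))"
    by (intro sum.cong) (simp_all add: assms sum_distrib_right mult.assoc)
  finally show "(\<Sum>t\<in>S. w t * Xs t $$ (i,j)) = (\<Sum>l<r. d l * A $$ (i,l) * B $$ (j,l))" .
qed

text \<open>\<open>neq\<close> is the distinctness of the ratios multiplied out. In that form it is
  linear in \<open>v\<close>, which suits the hyperplane argument for Gaussian vectors.\<close>

lemma jennrich_ratio_inj: "inj_on (\<lambda>l. du l / dv l) {..<r}"
proof (rule inj_onI, rule ccontr)
  fix l m assume "l \<in> {..<r}" "m \<in> {..<r}" "du l / dv l = du m / dv m" "l \<noteq> m"
  then show False using neq[of l m] dv(2)[of l] dv(2)[of m] by (simp add: field_simps)
qed

lemma jennrich_slice_products: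
  obtains P Q where "P \<in> carrier_mat r n1" "P * A = 1\<^sub>m r" "Q \<in> carrier_mat r n2" "Q * B = 1\<^sub>m r"
    "Matrix.mat n1 n2 (\<lambda>(i,j). \<Sum>t\<in>S. u t * Xs t $$ (i,j)) * pinv (Matrix.mat n1 n2 (\<lambda>(i,j). \<Sum>t\<in>S. v t * Xs t $$ (i,j)))
      = A * (mat_diag r (\<lambda>l. du l / dv l) * P)"
    "transpose_mat (Matrix.mat n1 n2 (\<lambda>(i,j). \<Sum>t\<in>S. v t * Xs t $$ (i,j))) * pinv (transpose_mat (Matrix.mat n1 n2 (\<lambda>(i,j). \<Sum>t\<in>S. u t * Xs t $$ (i,j))))
      = B * (mat_diag r (\<lambda>l. 1 / (du l / dv l)) * Q)"
proof (rule jennrich_products[OF A B du(2) dv(2)])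
  fix P Q
  assume PQ: "P \<in> carrier_mat r n1" "P * A = 1\<^sub>m r" "Q \<in> carrier_mat r n2" "Q * B = 1\<^sub>m r"
    "Matrix.mat n1 n2 (\<lambda>(i,j). \<Sum>l<r. du l * A $$ (i,l) * B $$ (j,l)) * pinv (Matrix.mat n1 n2 (\<lambda>(i,j). \<Sum>l<r. dv l * A $$ (i,l) * B $$ (j,l)))
      = A * (mat_diag r (\<lambda>l. du l / dv l) * P)"
    "transpose_mat (Matrix.mat n1 n2 (\<lambda>(i,j). \<Sum>l<r. dv l * A $$ (i,l) * B $$ (j,l))) * pinv (transpose_mat (Matrix.mat n1 n2 (\<lambda>(i,j). \<Sum>l<r. du l * A $$ (i,l) * B $$ (j,l))))
      = B * (mat_diag r (\<lambda>l. 1 / (du l / dv l)) * Q)"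
  show thesis
    by (rule that[OF PQ(1-4)]) (simp_all only: jennrich_slices[OF du(1)] jennrich_slices[OF dv(1)] PQ(5,6))
qed

lemma jennrich_out_exact: "jennrich_out n1 n2 r S Xs u v A B"
proof -
  obtain P Q where PQ: "P \<in> carrier_mat r n1" "P * A = 1\<^sub>m r" "Q \<in> carrier_mat r n2" "Q * B = 1\<^sub>m r"
    "Matrix.mat n1 n2 (\<lambda>(i,j). \<Sum>t\<in>S. u t * Xs t $$ (i,j)) * pinv (Matrix.mat n1 n2 (\<lambda>(i,j). \<Sum>t\<in>S. v t * Xs t $$ (i,j)))
      = A * (mat_diag r (\<lambda>l. du l / dv l) * P)"
    "transpose_mat (Matrix.mat n1 n2 (\<lambda>(i,j). \<Sum>t\<in>S. v t * Xs t $$ (i,j))) * pinv (transpose_mat (Matrix.mat n1 n2 (\<lambda>(i,j). \<Sum>t\<in>S. u t * Xs t $$ (i,j))))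
      = B * (mat_diag r (\<lambda>l. 1 / (du l / dv l)) * Q)"
    by (rule jennrich_slice_products)
  show ?thesis
    unfolding jennrich_out_def Let_def PQ(5,6)
    using A(1) B(1) du(2) dv(2) jennrich_ratio_inj
      eigenvector_diagonalizable_col[OF A(1) PQ(1,2), of _ "\<lambda>l. du l / dv l"]
      eigenvector_diagonalizable_col[OF B(1) PQ(3,4), of _ "\<lambda>l. 1 / (du l / dv l)"]
    by (intro conjI exI[of _ "\<lambda>l. du l / dv l"]) auto
qed

text \<open>The reciprocal eigenvalues tie the modes together: both columns with index l belong to
  the same ratio, so one permutation serves both, while the scalings of the two modes are
  unrelated.\<close>

lemma jennrich_out_unique:
  assumes out: "jennrich_out n1 n2 r S Xs u v B1 B2"
  obtains \<pi> \<alpha> \<beta> where "bij_betw \<pi> {..<r} {..<r}" "\<And>l. l < r \<Longrightarrow> \<alpha> l \<noteq> 0" "\<And>l. l < r \<Longrightarrow> \<beta> l \<noteq> 0"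
    "\<And>i l. i < n1 \<Longrightarrow> l < r \<Longrightarrow> B1 $$ (i,l) = \<alpha> l * A $$ (i, \<pi> l)"
    "\<And>i l. i < n2 \<Longrightarrow> l < r \<Longrightarrow> B2 $$ (i,l) = \<beta> l * B $$ (i, \<pi> l)"
    "B1 \<in> carrier_mat n1 r" "B2 \<in> carrier_mat n2 r"
proof -
  obtain P Q where PQ: "P \<in> carrier_mat r n1" "P * A = 1\<^sub>m r" "Q \<in> carrier_mat r n2" "Q * B = 1\<^sub>m r"
    "Matrix.mat n1 n2 (\<lambda>(i,j). \<Sum>t\<in>S. u t * Xs t $$ (i,j)) * pinv (Matrix.mat n1 n2 (\<lambda>(i,j). \<Sum>t\<in>S. v t * Xs t $$ (i,j)))
      = A * (mat_diag r (\<lambda>l. du l / dv l) * P)"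
    "transpose_mat (Matrix.mat n1 n2 (\<lambda>(i,j). \<Sum>t\<in>S. v t * Xs t $$ (i,j))) * pinv (transpose_mat (Matrix.mat n1 n2 (\<lambda>(i,j). \<Sum>t\<in>S. u t * Xs t $$ (i,j))))
      = B * (mat_diag r (\<lambda>l. 1 / (du l / dv l)) * Q)"
    by (rule jennrich_slice_products)
  let ?f = "\<lambda>l. du l / dv l"
  have injf: "inj_on (\<lambda>l. 1 / ?f l) {..<r}"
  proof (rule inj_onI)
    fix l m assume lm: "l \<in> {..<r}" "m \<in> {..<r}" and eq: "1 / ?f l = 1 / ?f m"
    have "?f l = ?f m" using eq unfolding inverse_eq_divide[symmetric] inverse_eq_iff_eq .
    then show "l = m" using inj_onD[OF jennrich_ratio_inj] lm by blast
  qed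
  obtain lam where lam: "inj_on lam {..<r}" and
    ev: "\<And>l. l < r \<Longrightarrow> lam l \<noteq> 0 \<and> eigenvector (A * (mat_diag r ?f * P)) (col B1 l) (lam l)
       \<and> eigenvector (B * (mat_diag r (\<lambda>l. 1 / ?f l) * Q)) (col B2 l) (1 / lam l)"
    and BB: "B1 \<in> carrier_mat n1 r" "B2 \<in> carrier_mat n2 r"
    using out unfolding jennrich_out_def Let_def PQ(5,6) by blast
  have "\<exists>m a b. m < r \<and> a \<noteq> 0 \<and> b \<noteq> 0 \<and> lam l = ?f m \<and> col B1 l = a \<cdot>\<^sub>v col A m \<and> col B2 l = b \<cdot>\<^sub>v col B m"
    if l: "l < r" for l
  proof -
    have e: "lam l \<noteq> 0" "eigenvector (A * (mat_diag r ?f * P)) (col B1 l) (lam l)"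
       "eigenvector (B * (mat_diag r (\<lambda>l. 1 / ?f l) * Q)) (col B2 l) (1 / lam l)" "1 / lam l \<noteq> 0"
      using ev[OF l] by auto
    obtain m a where m: "m < r" "a \<noteq> 0" "lam l = ?f m" "col B1 l = a \<cdot>\<^sub>v col A m"
      using eigenvector_diagonalizable[OF A(1) PQ(1,2) jennrich_ratio_inj e(2,1)] by metis
    obtain m' b where m': "m' < r" "b \<noteq> 0" "1 / lam l = 1 / ?f m'" "col B2 l = b \<cdot>\<^sub>v col B m'"
      using eigenvector_diagonalizable[OF B(1) PQ(3,4) injf e(3,4)] by metis
    have "1 / ?f m = 1 / ?f m'" using m(3) m'(3) by simp
    then have "m = m'" using inj_onD[OF injf] m(1) m'(1) by auto
    then show ?thesis using m m' by blast
  qed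
  then obtain \<pi> \<alpha> \<beta> where p: "\<And>l. l < r \<Longrightarrow> \<pi> l < r \<and> \<alpha> l \<noteq> 0 \<and> \<beta> l \<noteq> 0 \<and> lam l = ?f (\<pi> l)
      \<and> col B1 l = \<alpha> l \<cdot>\<^sub>v col A (\<pi> l) \<and> col B2 l = \<beta> l \<cdot>\<^sub>v col B (\<pi> l)"
    by metis
  \<comment> \<open>Distinct eigenvalues \<open>lam l\<close> force distinct indices, and an
    injection of a finite set into itself is onto.\<close>
  have "inj_on \<pi> {..<r}"
    using lam p by (metis (no_types, lifting) inj_on_def lessThan_iff)
  moreover have "\<pi> ` {..<r} \<subseteq> {..<r}" using p by auto
  ultimately have bij: "bij_betw \<pi> {..<r} {..<r}"
    by (simp add: bij_betw_def endo_inj_surj)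
  have e1: "B1 $$ (i,l) = \<alpha> l * A $$ (i, \<pi> l)" if "i < n1" "l < r" for i l
  proof -
    have "B1 $$ (i,l) = col B1 l $ i" using that BB by simp
    also have "col B1 l = \<alpha> l \<cdot>\<^sub>v col A (\<pi> l)" using p[OF that(2)] by blast
    also have "\<dots> $ i = \<alpha> l * A $$ (i, \<pi> l)" using that p[OF that(2)] A(1) by simp
    finally show ?thesis .
  qed
  have e2: "B2 $$ (i,l) = \<beta> l * B $$ (i, \<pi> l)" if "i < n2" "l < r" for i l
  proof -
    have "B2 $$ (i,l) = col B2 l $ i" using that BB by simp
    also have "col B2 l = \<beta> l \<cdot>\<^sub>v col B (\<pi> l)" using p[OF that(2)] by blast
    also have "\<dots> $ i = \<beta> l * B $$ (i, \<pi> l)" using that p[OF that(2)] B(1) by simp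
    finally show ?thesis .
  qed
  show ?thesis by (rule that[OF bij _ _ e1 e2 BB]) (use p in blast)+
qed

end

section \<open>Existence of nuclear norm minimisers\<close>

text \<open>The Rayleigh quotient over the complex numbers: the eigenvalue equation yields a |v|^2 =
  |M v|^2, so \<open>a\<close> is real and nonnegative at once.\<close>

lemma gram_eigenvalue_nonneg_real:
  fixes M :: "real mat" and a :: complex
  assumes M: "M \<in> carrier_mat m n"
    and ev: "eigenvector (map_mat complex_of_real (transpose_mat M * M)) v a"
  shows "\<exists>l\<ge>0. a = complex_of_real l"
proof -
  let ?G = "map_mat complex_of_real (transpose_mat M * M)"
  have v: "v \<in> carrier_vec n" "v \<noteq> 0\<^sub>v n" "?G *\<^sub>v v = a \<cdot>\<^sub>v v"
    using ev M by (auto simp: eigenvector_def)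
  have cn: "cnj z * z = (complex_of_real (cmod z))\<^sup>2" for z
    by (metis complex_norm_square mult.commute of_real_power)
  define w where "w i = (\<Sum>k<n. complex_of_real (M $$ (i,k)) * v $ k)" for i
  define t where "t = (\<Sum>j<n. (cmod (v $ j))\<^sup>2)"
  define s where "s = (\<Sum>i<m. (cmod (w i))\<^sup>2)"
  have Gv: "(?G *\<^sub>v v) $ j = (\<Sum>i<m. complex_of_real (M $$ (i,j)) * w i)" if j: "j < n" for j
  proof -
    have "(?G *\<^sub>v v) $ j = (\<Sum>k<n. (\<Sum>i<m. complex_of_real (M $$ (i,j)) * complex_of_real (M $$ (i,k))) * v $ k)"
      using M j v(1) by (simp add: scalar_prod_def atLeast0LessThan)
    also have "\<dots> = (\<Sum>k<n. \<Sum>i<m. complex_of_real (M $$ (i,j)) * (complex_of_real (M $$ (i,k)) * v $ k))"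
      by (simp add: sum_distrib_right mult.assoc)
    also have "\<dots> = (\<Sum>i<m. \<Sum>k<n. complex_of_real (M $$ (i,j)) * (complex_of_real (M $$ (i,k)) * v $ k))"
      by (rule sum.swap)
    also have "\<dots> = (\<Sum>i<m. complex_of_real (M $$ (i,j)) * w i)"
      by (simp add: w_def sum_distrib_left)
    finally show ?thesis .
  qed
  have "(\<Sum>j<n. cnj (v $ j) * (?G *\<^sub>v v) $ j) = (\<Sum>j<n. \<Sum>i<m. cnj (complex_of_real (M $$ (i,j)) * v $ j) * w i)"
    by (intro sum.cong) (simp_all add: Gv sum_distrib_left mult_ac)
  also have "\<dots> = (\<Sum>i<m. \<Sum>j<n. cnj (complex_of_real (M $$ (i,j)) * v $ j) * w i)" by (rule sum.swap)
  also have "\<dots> = (\<Sum>i<m. cnj (w i) * w i)"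
    by (simp add: w_def sum_distrib_right)
  also have "\<dots> = complex_of_real s"
    by (simp add: s_def cn)
  finally have 1: "(\<Sum>j<n. cnj (v $ j) * (?G *\<^sub>v v) $ j) = complex_of_real s" .
  have "(\<Sum>j<n. cnj (v $ j) * (?G *\<^sub>v v) $ j) = (\<Sum>j<n. a * (cnj (v $ j) * v $ j))"
    unfolding v(3) using v(1) by (intro sum.cong) simp_all
  also have "\<dots> = a * complex_of_real t"
    by (simp add: t_def cn sum_distrib_left)
  finally have at: "a * complex_of_real t = complex_of_real s" using 1 by simp
  obtain j where j: "j < n" "v $ j \<noteq> 0"
    using v(1,2) by (metis carrier_vecD eq_vecI index_zero_vec)
  have "0 < (cmod (v $ j))\<^sup>2" using j by simp
  also have "\<dots> \<le> t" unfolding t_def using j by (intro member_le_sum) auto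
  finally have t: "t > 0" .
  have "a = complex_of_real (s / t)" using at t by (simp add: field_simps)
  moreover have "s / t \<ge> 0" using t by (simp add: s_def sum_nonneg)
  ultimately show ?thesis by blast
qed

text \<open>The polynomial splits over the complex numbers, its roots are eigenvalues and hence
  real, and comparing coefficients brings the factorisation back to the reals.\<close>

lemma char_poly_gram_splits:
  fixes M :: "real mat"
  assumes M: "M \<in> carrier_mat m n"
  obtains ls where "char_poly (transpose_mat M * M) = (\<Prod>a\<leftarrow>ls. [:- a, 1:])" "length ls = n"
    "\<And>l. l \<in> set ls \<Longrightarrow> l \<ge> 0"
proof -
  let ?G = "transpose_mat M * M"
  let ?C = "map_mat complex_of_real ?G"
  have G: "?G \<in> carrier_mat n n" "?C \<in> carrier_mat n n" using M by auto
  obtain as where as: "char_poly ?C = (\<Prod>a\<leftarrow>as. [:- a, 1:])" "length as = n"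
    using char_poly_factorized[OF G(2)] by blast
  have real: "\<exists>l\<ge>0. a = complex_of_real l" if "a \<in> set as" for a
  proof -
    have "poly (char_poly ?C) a = 0" unfolding as(1) using that by (rule linear_poly_root)
    then have "eigenvalue ?C a" using eigenvalue_root_char_poly[OF G(2)] by blast
    then show ?thesis using gram_eigenvalue_nonneg_real[OF M] unfolding eigenvalue_def by blast
  qed
  define ls where "ls = map Re as"
  have "as = map complex_of_real ls"
    unfolding ls_def map_map by (rule map_idI[symmetric]) (use real in force)
  then have "map_poly complex_of_real (char_poly ?G) = (\<Prod>a\<leftarrow>map complex_of_real ls. [:- a, 1:])"
    using as(1) of_real_hom.char_poly_hom[OF G(1), where ?'a = complex] by simp
  also have "\<dots> = map_poly complex_of_real (\<Prod>a\<leftarrow>ls. [:- a, 1:])"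
  proof (induction ls)
    case (Cons a ls)
    have "map_poly complex_of_real (p * q) = map_poly complex_of_real p * map_poly complex_of_real q" for p q
      by (intro poly_eqI) (simp add: coeff_map_poly coeff_mult)
    moreover have "map_poly complex_of_real [:- a, 1:] = [:- complex_of_real a, 1:]"
      by (simp add: map_poly_pCons)
    ultimately show ?case using Cons by (simp del: mult_pCons_left)
  qed simp
  finally have eq: "map_poly complex_of_real (char_poly ?G) = map_poly complex_of_real (\<Prod>a\<leftarrow>ls. [:- a, 1:])" .
  have "coeff (char_poly ?G) k = coeff (\<Prod>a\<leftarrow>ls. [:- a, 1:]) k" for k
    using arg_cong[OF eq, of "\<lambda>p. coeff p k"] by (simp add: coeff_map_poly)
  then have "char_poly ?G = (\<Prod>a\<leftarrow>ls. [:- a, 1:])" by (rule poly_eqI)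
  moreover have "length ls = n" using as(2) by (simp add: ls_def)
  moreover have "l \<ge> 0" if "l \<in> set ls" for l using that real by (force simp: ls_def)
  ultimately show ?thesis using that by blast
qed

lemma proots_linear_factors: "proots (\<Prod>a\<leftarrow>ls. [:- a, 1 :: real:]) = mset ls"
proof (induction ls)
  case (Cons a ls)
  have "(\<Prod>a\<leftarrow>ls. [:- a, 1 :: real:]) \<noteq> 0" by (auto simp: prod_list_zero_iff)
  then show ?case using Cons by (simp add: proots_mult del: mult_pCons_left)
qed simp

lemma nuc_norm_eq:
  assumes "char_poly (transpose_mat M * M) = (\<Prod>a\<leftarrow>ls. [:- a, 1:])"
  shows "nuc_norm M = (\<Sum>l\<leftarrow>ls. sqrt l)"
  unfolding nuc_norm_def assms proots_linear_factors
  by (simp add: sum_mset_sum_list[symmetric] del: sum_mset_sum_list)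

section \<open>Traces, determinants and convergent subsequences\<close>

lemma trace_mult_commute:
  fixes A B :: "real mat"
  assumes "A \<in> carrier_mat n m" "B \<in> carrier_mat m n"
  shows "(\<Sum>i<n. (A * B) $$ (i,i)) = (\<Sum>i<m. (B * A) $$ (i,i))"
proof -
  have "(\<Sum>i<n. (A * B) $$ (i,i)) = (\<Sum>i<n. \<Sum>j<m. A $$ (i,j) * B $$ (j,i))"
    using assms by (simp add: scalar_prod_def atLeast0LessThan)
  also have "\<dots> = (\<Sum>j<m. \<Sum>i<n. A $$ (i,j) * B $$ (j,i))" by (rule sum.swap)
  also have "\<dots> = (\<Sum>i<m. (B * A) $$ (i,i))"
    using assms by (simp add: scalar_prod_def atLeast0LessThan mult.commute)
  finally show ?thesis .
qed

text \<open>The trace is invariant under similarity, and \<open>ls\<close> is the diagonal of the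
  Schur form.\<close>

lemma trace_eq_sum_roots:
  fixes A :: "real mat"
  assumes A: "A \<in> carrier_mat n n" and c: "char_poly A = (\<Prod>a\<leftarrow>ls. [:- a, 1:])"
  shows "(\<Sum>i<n. A $$ (i,i)) = sum_list ls"
proof -
  obtain B P Q where BPQ: "schur_decomposition A ls = (B,P,Q)" by (cases "schur_decomposition A ls") auto
  from schur_decomposition[OF A c BPQ]
  have w: "similar_mat_wit A B P Q" and d: "diag_mat B = ls" by auto
  have car: "B \<in> carrier_mat n n" "P \<in> carrier_mat n n" "Q \<in> carrier_mat n n"
    and eq: "Q * P = 1\<^sub>m n" "A = P * B * Q"
    using w A by (auto simp: similar_mat_wit_def Let_def)
  have "(\<Sum>i<n. A $$ (i,i)) = (\<Sum>i<n. (Q * (P * B)) $$ (i,i))"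
    unfolding eq(2) by (rule trace_mult_commute) (use car in auto)
  also have "Q * (P * B) = B"
    using car eq(1) by (simp flip: assoc_mult_mat[of Q n n P n B n])
  also have "(\<Sum>i<n. B $$ (i,i)) = sum_list ls"
    unfolding d[symmetric] diag_mat_def using car by (simp add: sum_list_distinct_conv_sum_set atLeast0LessThan)
  finally show ?thesis .
qed

lemma det_tendsto:
  fixes A :: "nat \<Rightarrow> real mat"
  assumes car: "\<And>k. A k \<in> carrier_mat n n" "B \<in> carrier_mat n n"
    and lim: "\<And>i j. i < n \<Longrightarrow> j < n \<Longrightarrow> (\<lambda>k. A k $$ (i,j)) \<longlonglongrightarrow> B $$ (i,j)"
  shows "(\<lambda>k. Determinant.det (A k)) \<longlonglongrightarrow> Determinant.det B"
  unfolding det_def'[OF car(1)] det_def'[OF car(2)]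
proof (intro tendsto_sum tendsto_mult tendsto_const tendsto_prod)
  fix p i assume "p \<in> {p. p permutes {0..<n}}" "i \<in> {0..<n}"
  then show "(\<lambda>k. A k $$ (i, p i)) \<longlonglongrightarrow> B $$ (i, p i)"
    using lim permutes_in_image[of p "{0..<n}" i] by auto
qed

lemma finite_bounded_imp_convergent_subseq:
  fixes f :: "nat \<Rightarrow> 'i \<Rightarrow> real"
  assumes "finite I" "\<And>k i. i \<in> I \<Longrightarrow> \<bar>f k i\<bar> \<le> K i"
  shows "\<exists>r L. strict_mono (r :: nat \<Rightarrow> nat) \<and> (\<forall>i\<in>I. (\<lambda>k. f (r k) i) \<longlonglongrightarrow> L i)"
  using assms
proof (induction I rule: finite_induct)
  case empty
  then show ?case by (intro exI[of _ id]) (auto simp: strict_mono_def)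
next
  case (insert x I)
  then obtain r L where r: "strict_mono (r :: nat \<Rightarrow> nat)" "\<forall>i\<in>I. (\<lambda>k. f (r k) i) \<longlonglongrightarrow> L i"
    by blast
  have "\<forall>k. f (r k) x \<in> {- K x..K x}" using insert.prems[of x] by (auto simp: abs_le_iff minus_le_iff)
  then obtain l q where q: "strict_mono (q :: nat \<Rightarrow> nat)" "((\<lambda>k. f (r k) x) \<circ> q) \<longlonglongrightarrow> l"
    using compact_Icc[of "- K x" "K x"] unfolding compact_eq_seq_compact_metric seq_compact_def by metis
  have "(\<lambda>k. f ((r \<circ> q) k) i) \<longlonglongrightarrow> (L(x := l)) i" if "i \<in> insert x I" for i
  proof (cases "i = x")
    case True
    then show ?thesis using q(2) by (simp add: o_def)
  next
    case False
    then have "(\<lambda>k. f (r k) i) \<longlonglongrightarrow> L i" using that r(2) by auto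
    from LIMSEQ_subseq_LIMSEQ[OF this q(1)] False show ?thesis by (simp add: o_def)
  qed
  moreover have "strict_mono (r \<circ> q)" using r(1) q(1) by (rule strict_mono_o)
  ultimately show ?case by blast
qed

text \<open>The entries and the eigenvalues \<open>ev\<close> of the Gram matrices of a minimising sequence are bounded. Along
  a subsequence both converge, and the characteristic polynomials show that the limits of the
  eigenvalues are the eigenvalues of the limit; this replaces continuity of the nuclear norm.\<close>
lemma nnm_min_exists:
  fixes M :: "real mat"
  assumes M: "M \<in> carrier_mat m n" and Obs: "Obs \<subseteq> {..<m} \<times> {..<n}"
  shows "\<exists>X. nnm_min m n Obs M X"
proof -
  define F where "F = {Y \<in> carrier_mat m n. \<forall>(i,j)\<in>Obs. Y $$ (i,j) = M $$ (i,j)}"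
  have MF: "M \<in> F" using M by (auto simp: F_def)
  define ev where "ev Y = (SOME ls. char_poly (transpose_mat Y * Y) = (\<Prod>a\<leftarrow>ls. [:- a, 1:]) \<and> length ls = n \<and> (\<forall>l\<in>set ls. l \<ge> 0))"
    for Y :: "real mat"
  have ev: "char_poly (transpose_mat Y * Y) = (\<Prod>a\<leftarrow>ev Y. [:- a, 1:]) \<and> length (ev Y) = n \<and> (\<forall>l\<in>set (ev Y). l \<ge> 0)"
    if Y: "Y \<in> carrier_mat m n" for Y
    unfolding ev_def by (rule someI_ex) (rule char_poly_gram_splits[OF Y], blast)
  have evn: "ev Y ! i \<ge> 0" if "Y \<in> carrier_mat m n" "i < n" for Y i
    using ev[OF that(1)] that(2) by auto
  have nn: "nuc_norm Y = (\<Sum>i<n. sqrt (ev Y ! i))" if "Y \<in> carrier_mat m n" for Y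
    using nuc_norm_eq[of Y "ev Y"] ev[OF that]
    by (simp add: sum_list_sum_nth atLeast0LessThan)
  have pcp: "poly (char_poly (transpose_mat Y * Y)) x = (\<Prod>i<n. x - ev Y ! i)"
    if Y: "Y \<in> carrier_mat m n" for Y x
  proof -
    have "poly (\<Prod>a\<leftarrow>ls. [:- a, 1:]) x = (\<Prod>i<length ls. x - ls ! i)" for ls :: "real list"
      by (induction ls) (simp_all del: prod.lessThan_Suc add: prod.lessThan_Suc_shift poly_prod_list left_diff_distrib)
    then show ?thesis using ev[OF Y] by auto
  qed
  define c where "c = Inf (nuc_norm ` F)"
  have nn0: "nuc_norm Y \<ge> 0" if "Y \<in> carrier_mat m n" for Y
    using that evn by (auto simp: nn intro!: sum_nonneg)
  have bdd: "bdd_below (nuc_norm ` F)"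
    by (rule bdd_belowI[of _ 0]) (auto simp: F_def nn0)
  have c_le: "c \<le> nuc_norm Y" if "Y \<in> F" for Y
    unfolding c_def using bdd that by (intro cInf_lower) auto
  have "\<exists>Y\<in>F. nuc_norm Y < c + 1 / real (Suc k)" for k
    using cInf_lessD[of "nuc_norm ` F" "c + 1 / real (Suc k)"] MF by (auto simp: c_def)
  then obtain Y where Y: "\<And>k. Y k \<in> F" "\<And>k. nuc_norm (Y k) < c + 1 / real (Suc k)" by metis
  have Yc: "Y k \<in> carrier_mat m n" for k using Y(1) by (auto simp: F_def)
  have nnY: "nuc_norm (Y k) \<le> c + 1" for k
  proof -
    have "1 / real (Suc k) \<le> 1" by simp
    then show ?thesis using Y(2)[of k] by linarith
  qed
  \<comment> \<open>The nuclear norm is a sum of nonnegative square roots, so it dominates each of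
    them.\<close>
  have lb: "ev (Y k) ! i \<le> (c + 1)\<^sup>2" if "i < n" for k i
  proof -
    have "sqrt (ev (Y k) ! i) \<le> nuc_norm (Y k)"
      unfolding nn[OF Yc] using that evn[OF Yc] by (intro member_le_sum) auto
    then have "sqrt (ev (Y k) ! i) \<le> c + 1" using nnY[of k] by linarith
    then show ?thesis using real_le_lsqrt real_sqrt_le_iff by (meson evn[OF Yc that] real_sqrt_ge_zero sqrt_le_D)
  qed
  \<comment> \<open>A squared entry is at most a diagonal entry of the Gram matrix, hence at most
    its trace, which is the sum of the eigenvalues just bounded.\<close>
  have eb: "(Y k $$ (i,j))\<^sup>2 \<le> n * (c + 1)\<^sup>2" if ij: "i < m" "j < n" for k i j
  proof -
    let ?G = "transpose_mat (Y k) * Y k"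
    have Gjj: "?G $$ (j,j) = (\<Sum>i<m. (Y k $$ (i,j))\<^sup>2)" if "j < n" for j
      using that Yc[of k] by (simp add: scalar_prod_def atLeast0LessThan power2_eq_square)
    have "(Y k $$ (i,j))\<^sup>2 \<le> ?G $$ (j,j)"
      unfolding Gjj[OF ij(2)] using ij by (intro member_le_sum) auto
    also have "\<dots> \<le> (\<Sum>j<n. ?G $$ (j,j))"
      using ij by (intro member_le_sum) (auto simp: Gjj sum_nonneg)
    also have "\<dots> = sum_list (ev (Y k))"
      using Yc[of k] ev[OF Yc[of k]] by (intro trace_eq_sum_roots) auto
    also have "\<dots> = (\<Sum>i<n. ev (Y k) ! i)"
      using ev[OF Yc[of k]] by (simp add: sum_list_sum_nth atLeast0LessThan)
    also have "\<dots> \<le> (\<Sum>i<n. (c + 1)\<^sup>2)" using lb by (intro sum_mono) auto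
    finally show ?thesis by simp
  qed
  \<comment> \<open>Entries and eigenvalues share one index type, so that a single subsequence
    serves both.\<close>
  define I where "I = Inl ` ({..<m} \<times> {..<n}) \<union> (Inr ` {..<n} :: ((nat \<times> nat) + nat) set)"
  define f where "f k x = (case x of Inl ij \<Rightarrow> Y k $$ ij | Inr i \<Rightarrow> ev (Y k) ! i)" for k x
  define K where "K x = (case x of Inl (ij :: nat \<times> nat) \<Rightarrow> sqrt (n * (c + 1)\<^sup>2) | Inr (i :: nat) \<Rightarrow> (c + 1)\<^sup>2)" for x
  have "\<exists>r L. strict_mono (r :: nat \<Rightarrow> nat) \<and> (\<forall>x\<in>I. (\<lambda>k. f (r k) x) \<longlonglongrightarrow> L x)"
  proof (rule finite_bounded_imp_convergent_subseq)
    fix k x assume "x \<in> I"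
    then consider i j where "x = Inl (i,j)" "i < m" "j < n" | i where "x = Inr i" "i < n"
      by (auto simp: I_def)
    then show "\<bar>f k x\<bar> \<le> K x"
    proof cases
      case 1
      then show ?thesis using eb[of i j k] real_le_rsqrt[of "\<bar>Y k $$ (i,j)\<bar>"] by (simp add: f_def K_def)
    next
      case 2
      then show ?thesis using lb[of i k] evn[OF Yc, of i k] by (simp add: f_def K_def)
    qed
  qed (simp add: I_def)
  then obtain q L where q: "strict_mono (q :: nat \<Rightarrow> nat)" and L: "\<And>x. x \<in> I \<Longrightarrow> (\<lambda>k. f (q k) x) \<longlonglongrightarrow> L x"
    by blast
  define X where "X = Matrix.mat m n (\<lambda>ij. L (Inl ij))"
  have X: "X \<in> carrier_mat m n" by (simp add: X_def)
  have Xlim: "(\<lambda>k. Y (q k) $$ (i,j)) \<longlonglongrightarrow> X $$ (i,j)" if "i < m" "j < n" for i j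
    using L[of "Inl (i,j)"] that by (simp add: I_def f_def X_def)
  have elim: "(\<lambda>k. ev (Y (q k)) ! i) \<longlonglongrightarrow> L (Inr i)" if "i < n" for i
    using L[of "Inr i"] that by (simp add: I_def f_def)
  have "X $$ (i,j) = M $$ (i,j)" if "(i,j) \<in> Obs" for i j
  proof -
    have "(\<lambda>k. Y (q k) $$ (i,j)) = (\<lambda>k. M $$ (i,j))" using Y(1) that by (auto simp: F_def)
    then show ?thesis using Xlim[of i j] Obs that LIMSEQ_unique[OF tendsto_const] by (auto simp: LIMSEQ_const_iff)
  qed
  then have XF: "X \<in> F" using X by (auto simp: F_def)
  have "poly (char_poly (transpose_mat X * X)) x = (\<Prod>i<n. x - L (Inr i))" for x
  proof -
    let ?G = "\<lambda>Y :: real mat. transpose_mat Y * Y"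
    have G: "?G Z \<in> carrier_mat n n" if "Z \<in> carrier_mat m n" for Z using that by auto
    \<comment> \<open>At a fixed point the characteristic polynomials converge twice: as
      determinants, to the value for \<open>X\<close>, and as products over roots, to the product
      over the limits of the roots.\<close>
    have "(\<lambda>k. poly (char_poly (?G (Y (q k)))) x) \<longlonglongrightarrow> poly (char_poly (?G X)) x"
      unfolding char_poly_matrix[OF G[OF Yc]] char_poly_matrix[OF G[OF X]]
    proof (rule det_tendsto)
      fix i j assume ij: "i < n" "j < n"
      have e: "(- char_matrix (?G Z) x) $$ (i,j) = - ((\<Sum>h<m. Z $$ (h,i) * Z $$ (h,j)) + (if i = j then - x else 0))"
        if "Z \<in> carrier_mat m n" for Z
        using that ij by (simp add: char_matrix_def scalar_prod_def atLeast0LessThan)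
      show "(\<lambda>k. (- char_matrix (?G (Y (q k))) x) $$ (i,j)) \<longlonglongrightarrow> (- char_matrix (?G X) x) $$ (i,j)"
        unfolding e[OF Yc] e[OF X] using ij by (intro tendsto_intros Xlim) auto
    qed (use X in \<open>auto simp: char_matrix_def Yc[THEN carrier_matD(2)] intro!: carrier_matI\<close>)
    moreover have "(\<lambda>k. poly (char_poly (?G (Y (q k)))) x) \<longlonglongrightarrow> (\<Prod>i<n. x - L (Inr i))"
      unfolding pcp[OF Yc] by (intro tendsto_intros elim) auto
    ultimately show ?thesis by (rule LIMSEQ_unique)
  qed
  moreover have "poly (\<Prod>a\<leftarrow>map (\<lambda>i. L (Inr i)) [0..<n]. [:- a, 1:]) x = (\<Prod>i<n. x - L (Inr i))" for x
    by (simp add: poly_prod_list poly_prod prod.distinct_set_conv_list[symmetric] atLeast0LessThan o_def)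
  ultimately have cpX: "char_poly (transpose_mat X * X) = (\<Prod>a\<leftarrow>map (\<lambda>i. L (Inr i)) [0..<n]. [:- a, 1:])"
    by (intro poly_eq_poly_eq_iff[THEN iffD1]) (auto intro!: ext)
  have "nuc_norm X = (\<Sum>i<n. sqrt (L (Inr i)))"
    using nuc_norm_eq[OF cpX] by (simp add: sum_list_sum_nth atLeast0LessThan)
  moreover have "(\<lambda>k. nuc_norm (Y (q k))) \<longlonglongrightarrow> (\<Sum>i<n. sqrt (L (Inr i)))"
    unfolding nn[OF Yc] by (intro tendsto_intros elim) auto
  moreover have "(\<lambda>k. nuc_norm (Y (q k))) \<longlonglongrightarrow> c"
  proof (rule real_tendsto_sandwich)
    show "\<forall>\<^sub>F k in sequentially. c \<le> nuc_norm (Y (q k))" using c_le Y(1) by simp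
    show "\<forall>\<^sub>F k in sequentially. nuc_norm (Y (q k)) \<le> c + 1 / real (Suc (q k))"
      using Y(2) by (simp add: less_imp_le)
    have "(\<lambda>k. 1 / real (Suc k)) \<longlonglongrightarrow> 0" using LIMSEQ_inverse_real_of_nat by (simp add: inverse_eq_divide)
    from LIMSEQ_subseq_LIMSEQ[OF this q] have "(\<lambda>k. 1 / real (Suc (q k))) \<longlonglongrightarrow> 0" by (simp add: o_def)
    from tendsto_add[OF tendsto_const[of c] this] show "(\<lambda>k. c + 1 / real (Suc (q k))) \<longlonglongrightarrow> c" by simp
  qed simp
  ultimately have "nuc_norm X = c" using LIMSEQ_unique by metis
  then have "nnm_min m n Obs M X"
    using XF c_le unfolding nnm_min_def F_def by auto
  then show ?thesis ..
qed

section \<open>Deterministic recovery\<close>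

text \<open>\<open>C0\<close> solves the system exactly, so the least residual is 0 and every
  minimiser is an exact solution; \<open>det\<close> leaves only one in each row.\<close>

lemma cls_out_iff:
  assumes B1: "dim_col B1 = r" and fin: "finite Obs"
    and sol: "\<And>a b i. (a,b,i) \<in> Obs \<Longrightarrow> (\<Sum>l<r. B1 $$ (a,l) * B2 $$ (b,l) * C0 i l) = X a b i"
    and det: "\<And>i c. i < n \<Longrightarrow> (\<And>a b. (a,b,i) \<in> Obs \<Longrightarrow> (\<Sum>l<r. B1 $$ (a,l) * B2 $$ (b,l) * c l) = 0)
       \<Longrightarrow> \<forall>l<r. c l = 0"
  shows "cls_out B1 B2 n Obs X C \<longleftrightarrow> C \<in> carrier_mat n r \<and> (\<forall>i<n. \<forall>l<r. C $$ (i,l) = C0 i l)"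
proof -
  have nonneg: "cls_resid B1 B2 Obs X i c \<ge> 0" for i c
    unfolding cls_resid_def by (rule sum_nonneg) auto
  have fin': "finite {q \<in> Obs. snd (snd q) = i}" for i using fin by simp
  have zero_iff: "cls_resid B1 B2 Obs X i c = 0 \<longleftrightarrow>
      (\<forall>a b. (a,b,i) \<in> Obs \<longrightarrow> (\<Sum>l<r. B1 $$ (a,l) * B2 $$ (b,l) * c l) = X a b i)" for i c
    unfolding cls_resid_def B1 by (subst sum_nonneg_eq_0_iff[OF fin']) auto
  have zero: "cls_resid B1 B2 Obs X i (C0 i) = 0" for i
    unfolding zero_iff using sol by blast
  show ?thesis
  proof
    assume out: "cls_out B1 B2 n Obs X C"
    have "C $$ (i,l) = C0 i l" if i: "i < n" and l: "l < r" for i l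
    proof -
      have "cls_resid B1 B2 Obs X i (\<lambda>l. C $$ (i,l)) \<le> cls_resid B1 B2 Obs X i (C0 i)"
        using out i unfolding cls_out_def by blast
      then have z: "cls_resid B1 B2 Obs X i (\<lambda>l. C $$ (i,l)) = 0"
        using zero[of i] nonneg[of i "\<lambda>l. C $$ (i,l)"] by simp
      have "(\<Sum>l<r. B1 $$ (a,l) * B2 $$ (b,l) * (C $$ (i,l) - C0 i l)) = 0" if "(a,b,i) \<in> Obs" for a b
        using z that sol[OF that] unfolding zero_iff by (simp add: right_diff_distrib sum_subtractf)
      from det[OF i this] l show ?thesis by simp
    qed
    then show "C \<in> carrier_mat n r \<and> (\<forall>i<n. \<forall>l<r. C $$ (i,l) = C0 i l)"
      using out B1 by (auto simp: cls_out_def)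
  next
    assume C: "C \<in> carrier_mat n r \<and> (\<forall>i<n. \<forall>l<r. C $$ (i,l) = C0 i l)"
    have "cls_resid B1 B2 Obs X i (\<lambda>l. C $$ (i,l)) = 0" if "i < n" for i
      unfolding zero_iff using sol C that by (auto intro!: trans[OF sum.cong[OF refl] sol])
    then show "cls_out B1 B2 n Obs X C" using C B1 nonneg by (simp add: cls_out_def)
  qed
qed

section \<open>Recovery for a fixed sample\<close>

context
  fixes d r s :: nat and n :: "nat \<Rightarrow> nat" and A :: "nat \<Rightarrow> real mat" and S :: "nat set"
    and istar :: "nat \<Rightarrow> nat" and mu0 :: real
    and OmM :: "(nat \<times> nat \<times> nat) set" and Oms :: "nat \<Rightarrow> (nat \<times> nat \<times> nat) set"
    and h :: "nat \<Rightarrow> nat \<Rightarrow> real" and Mt :: "nat \<Rightarrow> real mat"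
  defines "h \<equiv> \<lambda>k l. \<Prod>j\<in>{3..d}-{k}. A j $$ (istar j, l)"
    and "Mt \<equiv> \<lambda>t. Matrix.mat (n 1) (n 2) (\<lambda>(i,j). \<Sum>l<r. (A 3 $$ (t,l) * h 3 l) * A 1 $$ (i,l) * A 2 $$ (j,l))"
  assumes hyps: "deli_hyps d n r A s S istar mu0"
begin

lemma hyps_d: "d \<ge> 3" and hyps_A: "\<And>k. k \<in> {1..d} \<Longrightarrow> A k \<in> carrier_mat (n k) r"
  and hyps_istar: "\<And>k. k \<in> {3..d} \<Longrightarrow> istar k < n k"
  and hyps_nz: "\<And>k i l. k \<in> {3..d} \<Longrightarrow> i < n k \<Longrightarrow> l < r \<Longrightarrow> A k $$ (i,l) \<noteq> 0"
  and hyps_rank: "mrank (A 1) = r" "mrank (A 2) = r"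
  using hyps by (auto simp: deli_hyps_def)

text \<open>The modes frozen at \<open>istar\<close> contribute only the scalar \<open>h k l\<close>
  to each rank-one term, so the slab is a three-mode tensor with a rescaled third factor.\<close>

lemma fidx_cp:
  assumes k: "k \<in> {3..d}"
  shows "cp d r A (fidx d istar k a b c) = (\<Sum>l<r. A 1 $$ (a,l) * A 2 $$ (b,l) * (A k $$ (c,l) * h k l))"
  unfolding cp_def
proof (rule sum.cong[OF refl])
  fix l
  define K where "K = {3..d} - {k}"
  have eq: "{1..d} = insert 1 (insert 2 (insert k K))" and K: "finite K" "1 \<notin> K" "2 \<notin> K" "k \<notin> K" "k \<noteq> 1" "k \<noteq> 2"
    using k by (auto simp: K_def)
  have "(\<Prod>j\<in>K. A j $$ (fidx d istar k a b c j, l)) = h k l"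
    unfolding h_def K_def by (rule prod.cong) (auto simp: fidx_def)
  moreover have "fidx d istar k a b c 1 = a" "fidx d istar k a b c 2 = b" "fidx d istar k a b c k = c"
    using K by (simp_all add: fidx_def)
  ultimately show "(\<Prod>j\<in>{1..d}. A j $$ (fidx d istar k a b c j, l)) = A 1 $$ (a,l) * A 2 $$ (b,l) * (A k $$ (c,l) * h k l)"
    unfolding eq using K by (simp add: mult.assoc)
qed

lemma slice_eq_Mt:
  "Matrix.mat (n 1) (n 2) (\<lambda>(a,b). cp d r A (fidx d istar 3 a b t)) = Mt t"
  unfolding Mt_def using hyps_d
  by (intro eq_matI) (auto simp: fidx_cp mult_ac)

lemma h_nz: "l < r \<Longrightarrow> h k l \<noteq> 0"
  unfolding h_def using hyps_nz hyps_istar by (simp add: prod_zero_iff)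

lemma h_last: "h d l = (\<Prod>k\<in>{3..<d}. A k $$ (istar k, l))"
  unfolding h_def by (rule prod.cong) auto

context
  fixes \<pi> :: "nat \<Rightarrow> nat" and \<alpha> \<beta> :: "nat \<Rightarrow> real" and B1 B2 :: "real mat"
  assumes bij: "bij_betw \<pi> {..<r} {..<r}"
    and nz: "\<And>l. l < r \<Longrightarrow> \<alpha> l \<noteq> 0" "\<And>l. l < r \<Longrightarrow> \<beta> l \<noteq> 0"
    and B: "\<And>i l. i < n 1 \<Longrightarrow> l < r \<Longrightarrow> B1 $$ (i,l) = \<alpha> l * A 1 $$ (i, \<pi> l)"
      "\<And>i l. i < n 2 \<Longrightarrow> l < r \<Longrightarrow> B2 $$ (i,l) = \<beta> l * A 2 $$ (i, \<pi> l)"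
      "B1 \<in> carrier_mat (n 1) r" "B2 \<in> carrier_mat (n 2) r"
begin

lemma \<pi>_less: "l < r \<Longrightarrow> \<pi> l < r"
  using bij by (auto simp: bij_betw_def)

text \<open>The true third factor of the slab, reordered by \<open>\<pi>\<close> and divided by the
  scalings that the first two modes have picked up.\<close>

definition cls_solution :: "nat \<Rightarrow> nat \<Rightarrow> nat \<Rightarrow> real" where
  "cls_solution k i l = A k $$ (i, \<pi> l) * h k (\<pi> l) / (\<alpha> l * \<beta> l)"

lemma cls_out_permuted_iff:
  assumes k: "k \<in> {3..d}" and sub: "Oms k \<subseteq> {..<n 1} \<times> {..<n 2} \<times> {..<n k}"
    and inj: "\<And>i c. i < n k \<Longrightarrow> (\<And>a b. (a,b,i) \<in> Oms k \<Longrightarrow> (\<Sum>l<r. c l * (A 1 $$ (a,l) * A 2 $$ (b,l))) = 0)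
       \<Longrightarrow> \<forall>l<r. c l = 0"
  shows "cls_out B1 B2 (n k) (Oms k) (\<lambda>a b c. cp d r A (fidx d istar k a b c)) C \<longleftrightarrow>
    C \<in> carrier_mat (n k) r \<and> (\<forall>i<n k. \<forall>l<r. C $$ (i,l) = cls_solution k i l)"
proof (rule cls_out_iff)
  show "dim_col B1 = r" using B by auto
  show "finite (Oms k)" by (rule finite_subset[OF sub]) auto
next
  fix a b i assume "(a,b,i) \<in> Oms k"
  then have ab: "a < n 1" "b < n 2" "i < n k" using sub by auto
  have "(\<Sum>l<r. B1 $$ (a,l) * B2 $$ (b,l) * cls_solution k i l) =
     (\<Sum>l<r. A 1 $$ (a,\<pi> l) * A 2 $$ (b,\<pi> l) * (A k $$ (i,\<pi> l) * h k (\<pi> l)))"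
    using ab nz by (intro sum.cong) (auto simp: B cls_solution_def field_simps)
  also have "\<dots> = (\<Sum>l<r. A 1 $$ (a,l) * A 2 $$ (b,l) * (A k $$ (i,l) * h k l))"
    by (rule sum.reindex_bij_betw[OF bij])
  finally show "(\<Sum>l<r. B1 $$ (a,l) * B2 $$ (b,l) * cls_solution k i l) = cp d r A (fidx d istar k a b i)"
    by (simp add: fidx_cp[OF k])
next
  fix i c assume i: "i < n k" and z: "\<And>a b. (a,b,i) \<in> Oms k \<Longrightarrow> (\<Sum>l<r. B1 $$ (a,l) * B2 $$ (b,l) * c l) = 0"
  define \<sigma> where "\<sigma> = inv_into {..<r} \<pi>"
  have \<sigma>: "\<sigma> (\<pi> l) = l" if "l < r" for l
    using bij that unfolding \<sigma>_def by (intro inv_into_f_f) (auto simp: bij_betw_def)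
  \<comment> \<open>Moves the coefficients from the recovered factors to the original ones, to which
    \<open>inj\<close> refers; as the scalings are nonzero, \<open>c' = 0\<close> gives
    \<open>c = 0\<close>.\<close>
  define c' where "c' m = \<alpha> (\<sigma> m) * \<beta> (\<sigma> m) * c (\<sigma> m)" for m
  have "(\<Sum>l<r. c' l * (A 1 $$ (a,l) * A 2 $$ (b,l))) = 0" if ab: "(a,b,i) \<in> Oms k" for a b
  proof -
    have "(\<Sum>l<r. c' l * (A 1 $$ (a,l) * A 2 $$ (b,l))) = (\<Sum>l<r. c' (\<pi> l) * (A 1 $$ (a,\<pi> l) * A 2 $$ (b,\<pi> l)))"
      by (rule sum.reindex_bij_betw[OF bij, symmetric])
    also have "\<dots> = (\<Sum>l<r. B1 $$ (a,l) * B2 $$ (b,l) * c l)"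
      using ab sub by (intro sum.cong) (auto simp: B c'_def \<sigma> mult_ac)
    finally show ?thesis using z[OF ab] by simp
  qed
  then have c': "\<forall>l<r. c' l = 0" using inj[OF i] by blast
  have "c l = 0" if "l < r" for l
    using c' \<pi>_less[OF that] nz that by (auto simp: c'_def \<sigma>)
  then show "\<forall>l<r. c l = 0" by blast
qed

text \<open>Each mode k >= 3 carries the factor \<open>?q k\<close>, that is h_k / (\<alpha>
  \<beta>). The division in mode d cancels h_d and the factors \<open>?q k\<close> of the middle
  modes; what remains is 1 / (\<alpha> \<beta>), which cancels with the scalings of modes 1 and
  2.\<close>

lemma cp_recombined:
  assumes C: "\<And>k i l. k \<in> {3..d} \<Longrightarrow> i < n k \<Longrightarrow> l < r \<Longrightarrow> C k $$ (i,l) = cls_solution k i l"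
    and Bf: "Bf 1 = B1" "Bf 2 = B2" "\<And>k. k \<in> {3..<d} \<Longrightarrow> Bf k = C k"
      "Bf d = Matrix.mat (n d) r (\<lambda>(i,l). C d $$ (i,l) / (\<Prod>k\<in>{3..<d}. C k $$ (istar k, l)))"
    and i: "i \<in> tidx d n"
  shows "cp d r Bf i = cp d r A i"
proof -
  have ik: "i k < n k" if "k \<in> {1..d}" for k using i that by (auto simp: tidx_def)
  have eq: "{1..d} = insert 1 (insert 2 (insert d {3..<d}))" using hyps_d by auto
  have "(\<Prod>k\<in>{1..d}. Bf k $$ (i k, l)) = (\<Prod>k\<in>{1..d}. A k $$ (i k, \<pi> l))" if l: "l < r" for l
  proof -
    let ?q = "\<lambda>k. h k (\<pi> l) / (\<alpha> l * \<beta> l)"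
    have q: "?q k \<noteq> 0" for k using h_nz[OF \<pi>_less[OF l]] nz l by simp
    have Cs: "C k $$ (istar k, l) = A k $$ (istar k, \<pi> l) * ?q k" if "k \<in> {3..<d}" for k
      using C[of k "istar k" l] that hyps_istar[of k] l by (simp add: cls_solution_def)
    have Bk: "Bf k $$ (i k, l) = A k $$ (i k, \<pi> l) * ?q k" if "k \<in> {3..<d}" for k
      using C[of k "i k" l] that ik[of k] l Bf(3)[OF that] by (simp add: cls_solution_def)
    have "Bf d $$ (i d, l) = C d $$ (i d, l) / (\<Prod>k\<in>{3..<d}. C k $$ (istar k, l))"
      unfolding Bf(4) using ik[of d] l hyps_d by simp
    also have "(\<Prod>k\<in>{3..<d}. C k $$ (istar k, l)) = h d (\<pi> l) * (\<Prod>k\<in>{3..<d}. ?q k)"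
      unfolding h_last prod.distrib[symmetric] by (rule prod.cong) (auto simp: Cs)
    also have "C d $$ (i d, l) = A d $$ (i d, \<pi> l) * ?q d"
      using C[of d "i d" l] hyps_d ik[of d] l by (simp add: cls_solution_def)
    finally have Bd: "Bf d $$ (i d, l) = A d $$ (i d, \<pi> l) * ?q d / (h d (\<pi> l) * (\<Prod>k\<in>{3..<d}. ?q k))" .
    have mid: "(\<Prod>k\<in>{3..<d}. Bf k $$ (i k, l)) = (\<Prod>k\<in>{3..<d}. A k $$ (i k, \<pi> l)) * (\<Prod>k\<in>{3..<d}. ?q k)"
      unfolding prod.distrib[symmetric] by (rule prod.cong) (auto simp: Bk)
    have qp: "(\<Prod>k\<in>{3..<d}. ?q k) \<noteq> 0" using q by (simp add: prod_zero_iff)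
    have hd: "h d (\<pi> l) \<noteq> 0" using h_nz[OF \<pi>_less[OF l]] .
    have B12: "Bf 1 $$ (i 1, l) = \<alpha> l * A 1 $$ (i 1, \<pi> l)" "Bf 2 $$ (i 2, l) = \<beta> l * A 2 $$ (i 2, \<pi> l)"
      using B ik[of 1] ik[of 2] l hyps_d Bf(1,2) by simp_all
    have "(\<Prod>k\<in>{1..d}. Bf k $$ (i k, l)) =
        Bf 1 $$ (i 1, l) * (Bf 2 $$ (i 2, l) * (Bf d $$ (i d, l) * (\<Prod>k\<in>{3..<d}. Bf k $$ (i k, l))))"
      unfolding eq using hyps_d by simp
    also have "\<dots> = A 1 $$ (i 1, \<pi> l) * (A 2 $$ (i 2, \<pi> l) * (A d $$ (i d, \<pi> l) * (\<Prod>k\<in>{3..<d}. A k $$ (i k, \<pi> l))))"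
    proof -
      define Q where "Q = (\<Prod>k\<in>{3..<d}. ?q k)"
      have "Q \<noteq> 0" using qp Q_def by simp
      then show ?thesis
        unfolding B12 Bd mid Q_def[symmetric] using hd nz[OF l] by (simp add: field_simps)
    qed
    also have "\<dots> = (\<Prod>k\<in>{1..d}. A k $$ (i k, \<pi> l))"
      unfolding eq using hyps_d by simp
    finally show ?thesis .
  qed
  then have "cp d r Bf i = (\<Sum>l<r. \<Prod>k\<in>{1..d}. A k $$ (i k, \<pi> l))"
    unfolding cp_def by (intro sum.cong) auto
  also have "\<dots> = cp d r A i"
    unfolding cp_def by (rule sum.reindex_bij_betw[OF bij])
  finally show ?thesis .
qed

end

lemma deli_success_deterministic:
  assumes OmM: "OmM \<subseteq> {..<n 1} \<times> {..<n 2} \<times> S"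
    and Oms: "\<And>k. k \<in> {3..d} \<Longrightarrow> Oms k \<subseteq> {..<n 1} \<times> {..<n 2} \<times> {..<n k}"
    and nnm: "\<And>t X. t \<in> S \<Longrightarrow> nnm_min (n 1) (n 2) {(a,b). (a,b,t) \<in> OmM} (Mt t) X \<Longrightarrow> X = Mt t"
    and inj: "\<And>k i c. k \<in> {3..d} \<Longrightarrow> i < n k \<Longrightarrow>
       (\<And>a b. (a,b,i) \<in> Oms k \<Longrightarrow> (\<Sum>l<r. c l * (A 1 $$ (a,l) * A 2 $$ (b,l))) = 0) \<Longrightarrow> \<forall>l<r. c l = 0"
    and du: "\<And>l. l < r \<Longrightarrow> (\<Sum>t\<in>S. u t * (A 3 $$ (t,l) * h 3 l)) \<noteq> 0"
    and dv: "\<And>l. l < r \<Longrightarrow> (\<Sum>t\<in>S. v t * (A 3 $$ (t,l) * h 3 l)) \<noteq> 0"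
    and neq: "\<And>l m. l < r \<Longrightarrow> m < r \<Longrightarrow> l \<noteq> m \<Longrightarrow>
      (\<Sum>t\<in>S. u t * (A 3 $$ (t,l) * h 3 l)) * (\<Sum>t\<in>S. v t * (A 3 $$ (t,m) * h 3 m)) \<noteq>
      (\<Sum>t\<in>S. u t * (A 3 $$ (t,m) * h 3 m)) * (\<Sum>t\<in>S. v t * (A 3 $$ (t,l) * h 3 l))"
  shows "deli_success d n r S istar (cp d r A) OmM Oms u v"
proof -
  have A12: "A 1 \<in> carrier_mat (n 1) r" "A 2 \<in> carrier_mat (n 2) r" using hyps_A[of 1] hyps_A[of 2] hyps_d by auto
  have Mtc: "Mt t \<in> carrier_mat (n 1) (n 2)" for t by (simp add: Mt_def)
  let ?g = "\<lambda>t l. A 3 $$ (t,l) * h 3 l"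
  let ?du = "\<lambda>l. \<Sum>t\<in>S. u t * ?g t l" and ?dv = "\<lambda>l. \<Sum>t\<in>S. v t * ?g t l"
  \<comment> \<open>\<open>nnm\<close> only restricts minimisers. Some minimiser exists, and it must
    then be the slice itself.\<close>
  have nnm': "nnm_min (n 1) (n 2) {(a,b). (a,b,t) \<in> OmM} (Mt t) (Mt t)" if t: "t \<in> S" for t
  proof -
    have "{(a,b). (a,b,t) \<in> OmM} \<subseteq> {..<n 1} \<times> {..<n 2}" using OmM by auto
    from nnm_min_exists[OF Mtc this] obtain X where "nnm_min (n 1) (n 2) {(a,b). (a,b,t) \<in> OmM} (Mt t) X" by blast
    then show ?thesis using nnm[OF t] by blast
  qed
  have "\<exists>B. deli_out d n r S istar (cp d r A) OmM Oms u v B"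
  proof -
    \<comment> \<open>An admissible run is built from the original factors, with identity
      permutation and unit scalings.\<close>
    have id: "bij_betw (\<lambda>l. l) {..<r} {..<r}" by (simp add: bij_betw_def)
    let ?sol = "cls_solution (\<lambda>l. l) (\<lambda>l. 1) (\<lambda>l. 1)"
    define C where "C k = Matrix.mat (n k) r (\<lambda>(i,l). ?sol k i l)" for k
    have C: "cls_out (A 1) (A 2) (n k) (Oms k) (\<lambda>a b c. cp d r A (fidx d istar k a b c)) (C k)"
      if k: "k \<in> {3..d}" for k
      using cls_out_permuted_iff[OF id _ _ _ _ A12 k Oms[OF k] inj[OF k], of "\<lambda>l. 1" "\<lambda>l. 1"]
      by (simp add: C_def)
    define Bf where "Bf k = (if k = 1 then A 1 else if k = 2 then A 2 else if k = d then
       Matrix.mat (n d) r (\<lambda>(i,l). C d $$ (i,l) / (\<Prod>k\<in>{3..<d}. C k $$ (istar k, l))) else C k)" for k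
    have "jennrich_out (n 1) (n 2) r S Mt u v (A 1) (A 2)"
      by (rule jennrich_out_exact[where g = ?g and du = ?du and dv = ?dv, OF A12(1) hyps_rank(1) A12(2) hyps_rank(2) _ refl du refl dv neq])
        (simp_all add: Mt_def)
    then have "deli_out d n r S istar (cp d r A) OmM Oms u v Bf"
      unfolding deli_out_def slice_eq_Mt using nnm' C hyps_d
      by (intro exI[of _ Mt] exI[of _ C]) (auto simp: Bf_def)
    then show ?thesis by (rule exI[of _ Bf])
  qed
  moreover have "cp d r Bf i = cp d r A i"
    if out: "deli_out d n r S istar (cp d r A) OmM Oms u v Bf" and i: "i \<in> tidx d n" for Bf i
  proof -
    obtain Xs C where Xs: "\<And>t. t \<in> S \<Longrightarrow> nnm_min (n 1) (n 2) {(a,b). (a,b,t) \<in> OmM} (Mt t) (Xs t)"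
      and J: "jennrich_out (n 1) (n 2) r S Xs u v (Bf 1) (Bf 2)"
      and C: "\<And>k. k \<in> {3..d} \<Longrightarrow> cls_out (Bf 1) (Bf 2) (n k) (Oms k) (\<lambda>a b c. cp d r A (fidx d istar k a b c)) (C k)"
      and Bf: "\<And>k. k \<in> {3..<d} \<Longrightarrow> Bf k = C k"
        "Bf d = Matrix.mat (n d) r (\<lambda>(i,l). C d $$ (i,l) / (\<Prod>k\<in>{3..<d}. C k $$ (istar k, l)))"
      using out unfolding deli_out_def slice_eq_Mt by blast
    have XM: "Xs t = Matrix.mat (n 1) (n 2) (\<lambda>(i,j). \<Sum>l<r. (A 3 $$ (t,l) * h 3 l) * A 1 $$ (i,l) * A 2 $$ (j,l))"
      if "t \<in> S" for t
      using nnm[OF that Xs[OF that]] by (simp add: Mt_def)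
    obtain \<pi> \<alpha> \<beta> where p: "bij_betw \<pi> {..<r} {..<r}" "\<And>l. l < r \<Longrightarrow> \<alpha> l \<noteq> 0" "\<And>l. l < r \<Longrightarrow> \<beta> l \<noteq> 0"
      "\<And>i l. i < n 1 \<Longrightarrow> l < r \<Longrightarrow> Bf 1 $$ (i,l) = \<alpha> l * A 1 $$ (i, \<pi> l)"
      "\<And>i l. i < n 2 \<Longrightarrow> l < r \<Longrightarrow> Bf 2 $$ (i,l) = \<beta> l * A 2 $$ (i, \<pi> l)"
      "Bf 1 \<in> carrier_mat (n 1) r" "Bf 2 \<in> carrier_mat (n 2) r"
      by (rule jennrich_out_unique[where g = ?g and du = ?du and dv = ?dv, OF A12(1) hyps_rank(1) A12(2) hyps_rank(2) XM refl du refl dv neq J]; (assumption | (rule that; blast)))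
    have "cls_out (Bf 1) (Bf 2) (n k) (Oms k) (\<lambda>a b c. cp d r A (fidx d istar k a b c)) (C k) \<longleftrightarrow>
       C k \<in> carrier_mat (n k) r \<and> (\<forall>j<n k. \<forall>l<r. C k $$ (j,l) = cls_solution \<pi> \<alpha> \<beta> k j l)"
      if k: "k \<in> {3..d}" for k
      by (rule cls_out_permuted_iff[OF p k Oms[OF k]]; (assumption | (rule inj[OF k]; (assumption | blast))))
    then have "C k $$ (j,l) = cls_solution \<pi> \<alpha> \<beta> k j l" if "k \<in> {3..d}" "j < n k" "l < r" for k j l
      using C that by blast
    note sol = this
    show ?thesis by (rule cp_recombined[OF p sol refl refl Bf i])
  qed
  ultimately show ?thesis by (auto simp: deli_success_def)
qed

end

section \<open>Success probability and sample complexity\<close>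

text \<open>Full rank of \<open>B\<close> gives the factor D B^T a right inverse, Q^T times the
  inverse of D, so multiplying \<open>A\<close> by it does not shrink the column space.\<close>

lemma col_space_factored:
  assumes A: "A \<in> carrier_mat n r" and B: "B \<in> carrier_mat m r" "mrank B = r"
    and f: "\<And>l. l < r \<Longrightarrow> f l \<noteq> (0 :: real)"
  shows "col_space (A * (mat_diag r f * transpose_mat B)) = col_space A"
proof -
  obtain Q where Q: "Q \<in> carrier_mat r m" "Q * B = 1\<^sub>m r" using full_mrank_left_inverse[OF B] by metis
  let ?X = "A * (mat_diag r f * transpose_mat B)" and ?h = "\<lambda>l. 1 / f l"
  have dd: "dim_row (mat_diag r k) = r" "dim_col (mat_diag r k) = r" for k :: "nat \<Rightarrow> real"
    by (simp_all add: mat_diag_def)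
  note dims = A[THEN carrier_matD(1)] A[THEN carrier_matD(2)] B(1)[THEN carrier_matD(1)] B(1)[THEN carrier_matD(2)]
    Q(1)[THEN carrier_matD(1)] Q(1)[THEN carrier_matD(2)] dd
  have BQ: "transpose_mat B * transpose_mat Q = 1\<^sub>m r"
    using transpose_mult[OF Q(1) B(1)] unfolding Q(2) by simp
  have DH: "mat_diag r f * mat_diag r ?h = 1\<^sub>m r"
    unfolding mat_diag_diag using f by (auto simp: mat_diag_def intro!: eq_matI)
  have "mat_diag r f * (transpose_mat B * (transpose_mat Q * mat_diag r ?h)) = 1\<^sub>m r"
  proof -
    have "transpose_mat B * (transpose_mat Q * mat_diag r ?h) = mat_diag r ?h"
      by (rule mult_mat_cancel) (simp_all add: BQ dims)
    then show ?thesis using DH by simp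
  qed
  then have XQ: "?X * (transpose_mat Q * mat_diag r ?h) = A"
    using A by (simp add: mult_mat_assoc_dim dims)
  show ?thesis
  proof
    show "col_space ?X \<subseteq> col_space A"
    proof
      fix x assume "x \<in> col_space ?X"
      then obtain c where c: "c \<in> carrier_vec m" "x = ?X *\<^sub>v c" by (auto simp: col_space_def dims)
      then have "x = A *\<^sub>v ((mat_diag r f * transpose_mat B) *\<^sub>v c)"
        by (simp add: mult_mat_vec_assoc_dim dims carrier_vecD)
      moreover have "(mat_diag r f * transpose_mat B) *\<^sub>v c \<in> carrier_vec (dim_col A)"
        by (rule carrier_vecI) (simp add: dims)
      ultimately show "x \<in> col_space A" unfolding col_space_def by blast
    qed
    show "col_space A \<subseteq> col_space ?X"
    proof
      fix x assume "x \<in> col_space A"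
      then obtain c where c: "c \<in> carrier_vec r" "x = A *\<^sub>v c" by (auto simp: col_space_def dims)
      then have "x = (?X * (transpose_mat Q * mat_diag r ?h)) *\<^sub>v c" using XQ by simp
      also have "\<dots> = ?X *\<^sub>v ((transpose_mat Q * mat_diag r ?h) *\<^sub>v c)"
        using c by (intro mult_mat_vec_assoc_dim) (simp_all add: dims carrier_vecD)
      finally have "x = ?X *\<^sub>v ((transpose_mat Q * mat_diag r ?h) *\<^sub>v c)" .
      moreover have "(transpose_mat Q * mat_diag r ?h) *\<^sub>v c \<in> carrier_vec (dim_col ?X)"
        by (rule carrier_vecI) (simp add: dims)
      ultimately show "x \<in> col_space ?X" unfolding col_space_def by blast
    qed
  qed
qed

text \<open>\<open>mrank\<close> and \<open>coh\<close> see a matrix only through its column space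
  and its number of rows, so a slice inherits them from \<open>A\<close> and its transpose from
  \<open>B\<close>. These are the data that Chen's guarantee asks for.\<close>

lemma coherence_factored:
  assumes A: "A \<in> carrier_mat n r" "mrank A = r" and B: "B \<in> carrier_mat m r" "mrank B = r"
    and f: "\<And>l. l < r \<Longrightarrow> f l \<noteq> (0 :: real)"
  defines "M \<equiv> Matrix.mat n m (\<lambda>(i,j). \<Sum>l<r. f l * A $$ (i,l) * B $$ (j,l))"
  shows "mrank M = r" "coh M r = coherence A" "coh (transpose_mat M) r = coherence B"
proof -
  have M: "M = A * (mat_diag r f * transpose_mat B)"
    unfolding M_def diagonal_factorization[OF A(1) B(1)] ..
  have MT: "transpose_mat M = B * (mat_diag r f * transpose_mat A)"
    unfolding M_def diagonal_factorization[OF B(1) A(1)]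
    by (intro eq_matI) (auto simp: mult_ac intro!: sum.cong)
  have c: "col_space M = col_space A" "col_space (transpose_mat M) = col_space B"
    unfolding MT unfolding M
    using col_space_factored[OF A(1) B f] col_space_factored[OF B(1) A f] by auto
  have d: "dim_row M = dim_row A" "dim_row (transpose_mat M) = dim_row B"
    using A B by (auto simp: M_def)
  show "mrank M = r" using mrank_cong[OF d(1) c(1)] A by simp
  show "coh M r = coherence A" "coh (transpose_mat M) r = coherence B"
    using coh_cong[OF d(1) c(1), of r] coh_cong[OF d(2) c(2), of r] A B by (auto simp: coherence_def)
qed

section \<open>Kruskal rank; leverage and independence of the rank-one terms\<close>

lemma pick_lessThan:
  assumes "j < r"
  shows "pick {..<r} j = j"
proof -
  have eq: "{a. a < r \<and> a \<in> UNIV} = {..<r}" by auto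
  have "pick UNIV j = pick {..<r} j"
    using pick_reduce_set[of j r UNIV] assms unfolding eq by simp
  then show ?thesis using pick_UNIV[of j] by simp
qed

lemma kruskal_rank_ge_2_imp:
  assumes A: "A \<in> carrier_mat m r" and kr: "kruskal_rank (submatrix A S {..<r}) \<ge> 2"
  shows "r \<ge> 2"
    "\<And>l l' a b. l < r \<Longrightarrow> l' < r \<Longrightarrow> l \<noteq> l' \<Longrightarrow> (\<And>t. t \<in> S \<Longrightarrow> a * A $$ (t,l) + b * A $$ (t,l') = 0) \<Longrightarrow> a = 0 \<and> b = 0"
proof -
  let ?M = "submatrix A S {..<r}"
  let ?P = "\<lambda>k. k \<le> dim_col ?M \<and> (\<forall>L. L \<subseteq> {..<dim_col ?M} \<and> card L = k \<longrightarrow> cols_lin_indep ?M L)"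
  have dc: "dim_col ?M = r"
  proof -
    have "{j. j < dim_col A \<and> j \<in> {..<r}} = {..<r}" using A by auto
    then show ?thesis by (simp add: dim_submatrix)
  qed
  \<comment> \<open>Size 0 always qualifies, so the maximum in \<open>kruskal_rank\<close> is
    attained.\<close>
  have "?P 0" by (auto simp: cols_lin_indep_def finite_subset[OF _ finite_lessThan])
  then have P: "?P (kruskal_rank ?M)"
    unfolding kruskal_rank_def by (rule GreatestI_nat[where b = "dim_col ?M"]) auto
  show r: "r \<ge> 2" using P kr dc by linarith
  fix l l' a b
  assume l: "l < r" "l' < r" "l \<noteq> l'" and z: "\<And>t. t \<in> S \<Longrightarrow> a * A $$ (t,l) + b * A $$ (t,l') = 0"
  \<comment> \<open>The Kruskal rank speaks of column sets of exactly that size, so the pair is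
    enlarged to one of them and the other coefficients are set to 0.\<close>
  have "\<exists>L. {l,l'} \<subseteq> L \<and> L \<subseteq> {..<r} \<and> card L = kruskal_rank ?M"
    using P kr dc l by (intro exists_subset_between) auto
  then obtain L where L: "{l,l'} \<subseteq> L" "L \<subseteq> {..<r}" "card L = kruskal_rank ?M" by blast
  have indep: "cols_lin_indep ?M L" using P L dc by simp
  define c where "c j = (if j = l then a else if j = l' then b else 0)" for j
  have "(\<Sum>j\<in>L. c j * ?M $$ (i,j)) = 0" if i: "i < dim_row ?M" for i
  proof -
    have i': "i < card {t. t < dim_row A \<and> t \<in> S}" using i by (simp add: dim_submatrix)
    have e: "?M $$ (i,j) = A $$ (pick S i, j)" if "j < r" for j
      using submatrix_index[OF i', of j "{..<r}"] that dc by (simp add: dim_submatrix pick_lessThan)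
    have S: "pick S i \<in> S"
    proof (cases "infinite S")
      case True
      then show ?thesis by (rule pick_in_set_inf)
    next
      case False
      have "card {t. t < dim_row A \<and> t \<in> S} \<le> card S" using False by (intro card_mono) auto
      then show ?thesis using i' by (intro pick_in_set_le) simp
    qed
    have "(\<Sum>j\<in>L. c j * ?M $$ (i,j)) = (\<Sum>j\<in>{l,l'}. c j * ?M $$ (i,j))"
      using L by (intro sum.mono_neutral_right) (auto simp: c_def finite_subset[OF L(2)])
    also have "\<dots> = a * A $$ (pick S i, l) + b * A $$ (pick S i, l')"
      using l by (simp add: c_def e)
    finally show ?thesis using z[OF S] by simp
  qed
  then have "\<forall>j\<in>L. c j = 0" using indep unfolding cols_lin_indep_def by blast
  then show "a = 0 \<and> b = 0" using L(1) l(3) by (auto simp: c_def split: if_splits)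
qed

text \<open>Coherence is used once in each variable: with the second index fixed, \<open>w\<close>
  lies in the column space of \<open>A\<close>, with the first fixed in that of \<open>B\<close>.
  The two leverage bounds multiply.\<close>

lemma tensor_leverage:
  fixes A B :: "real mat"
  assumes A: "A \<in> carrier_mat n r" "mrank A = r" "coherence A \<le> \<mu>"
    and B: "B \<in> carrier_mat m r" "mrank B = r" "coherence B \<le> \<mu>"
    and r: "r > 0" and \<mu>: "\<mu> > 0"
    and w: "w \<in> linspan r (\<lambda>l (a,b). A $$ (a,l) * B $$ (b,l))"
    and x: "x \<in> {..<n} \<times> {..<m}"
  shows "(w x)\<^sup>2 \<le> (\<mu> * r / n * (\<mu> * r / m)) * (\<Sum>y\<in>{..<n} \<times> {..<m}. (w y)\<^sup>2)"
proof -
  obtain c where c: "\<And>a b. w (a,b) = (\<Sum>l<r. c l * (A $$ (a,l) * B $$ (b,l)))"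
    using w by (auto simp: linspan_def)
  obtain a b where ab: "x = (a,b)" "a < n" "b < m" using x by auto
  have wA: "w (a,b) = (\<Sum>l<r. (c l * B $$ (b,l)) * A $$ (a,l))" for a b
    unfolding c by (intro sum.cong) (auto simp: mult_ac)
  have wB: "w (a,b) = (\<Sum>l<r. (c l * A $$ (a,l)) * B $$ (b,l))" for a b
    unfolding c by (intro sum.cong) (auto simp: mult_ac)
  have "(w (a,b))\<^sup>2 \<le> \<mu> * r / n * (\<Sum>i<n. (w (i,b))\<^sup>2)"
    unfolding wA by (rule coherence_leverage[OF A(1,2) r A(3) ab(2)])
  also have "\<dots> \<le> \<mu> * r / n * (\<Sum>i<n. \<mu> * r / m * (\<Sum>j<m. (w (i,j))\<^sup>2))"
  proof (intro mult_left_mono sum_mono)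
    fix i
    show "(w (i,b))\<^sup>2 \<le> \<mu> * r / m * (\<Sum>j<m. (w (i,j))\<^sup>2)"
      unfolding wB by (rule coherence_leverage[OF B(1,2) r B(3) ab(3)])
  qed (use \<mu> in auto)
  also have "\<dots> = (\<mu> * r / n * (\<mu> * r / m)) * (\<Sum>i<n. \<Sum>j<m. (w (i,j))\<^sup>2)"
    by (simp add: sum_distrib_left mult.assoc)
  also have "(\<Sum>i<n. \<Sum>j<m. (w (i,j))\<^sup>2) = (\<Sum>y\<in>{..<n} \<times> {..<m}. (w y)\<^sup>2)"
    by (simp add: sum.cartesian_product case_prod_unfold)
  finally show ?thesis using ab by simp
qed

text \<open>For fixed \<open>a\<close>, independence of the columns of \<open>B\<close> makes c_l
  times the (a,l) entry of \<open>A\<close> zero; a nonzero c_l would make a whole column of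
  \<open>A\<close> vanish.\<close>

lemma tensor_independent:
  fixes A B :: "real mat"
  assumes A: "A \<in> carrier_mat n r" "mrank A = r" and B: "B \<in> carrier_mat m r" "mrank B = r"
    and z: "\<And>a b. a < n \<Longrightarrow> b < m \<Longrightarrow> (\<Sum>l<r. c l * (A $$ (a,l) * B $$ (b,l))) = 0" and l: "l < r"
  shows "c l = 0"
proof (rule ccontr)
  assume cl: "c l \<noteq> 0"
  have "c l * A $$ (a,l) = 0" if a: "a < n" for a
  proof (rule full_mrank_indep[OF B, where c = "\<lambda>l. c l * A $$ (a,l)"])
    fix b assume "b < m"
    then show "(\<Sum>l<r. c l * A $$ (a,l) * B $$ (b,l)) = 0"
      using z[OF a] by (simp add: mult.assoc)
  qed (rule l)
  then have "A $$ (a,l) = 0" if "a < n" for a using cl that by auto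
  then have "(\<Sum>j<r. (if j = l then 1 else 0) * A $$ (a,j)) = 0" if "a < n" for a
    using that by (intro sum.neutral) auto
  from full_mrank_indep[OF A, where c = "\<lambda>j. if j = l then 1 else 0", OF this l] show False by simp
qed

text \<open>Independence of the rank-one terms turns a nonzero coefficient vector into a function
  that is not zero on the grid, which is the form of failure bounded above.\<close>

lemma prob_bern_set_tensor_not_determining:
  fixes A B :: "real mat" and c3 :: real
  assumes A: "A \<in> carrier_mat n r" "mrank A = r" "coherence A \<le> \<mu>"
    and B: "B \<in> carrier_mat m r" "mrank B = r" "coherence B \<le> \<mu>"
    and r: "r > 0" and \<mu>: "\<mu> > 0" and nm: "n > 0" "m > 0" "k > 0" "c3 \<ge> 0"
  shows "measure_pmf.prob (bern_set ({..<n} \<times> {..<m})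
      (min 1 (c3 * \<mu>\<^sup>2 * (real r)\<^sup>2 * ln (real k) / (real n * real m))))
    {Obs. \<exists>c. (\<forall>(a,b)\<in>Obs. (\<Sum>l<r. c l * (A $$ (a,l) * B $$ (b,l))) = 0) \<and> (\<exists>l<r. c l \<noteq> 0)}
    \<le> r * real k powr (- c3)"
proof -
  let ?D = "{..<n} \<times> {..<m}"
  let ?\<phi> = "\<lambda>l (a,b). A $$ (a,l) * B $$ (b,l)"
  let ?p = "c3 * \<mu>\<^sup>2 * (real r)\<^sup>2 * ln (real k) / (real n * real m)"
  let ?R = "\<mu> * r / n * (\<mu> * r / m)"
  let ?Bad = "{S. \<exists>w\<in>linspan r ?\<phi>. (\<forall>x\<in>S. w x = 0) \<and> (\<exists>x\<in>?D. w x \<noteq> 0)}"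
  have R: "?R > 0" using r \<mu> nm by simp
  have "measure_pmf.prob (bern_set ?D (min 1 ?p))
    {Obs. \<exists>c. (\<forall>(a,b)\<in>Obs. (\<Sum>l<r. c l * (A $$ (a,l) * B $$ (b,l))) = 0) \<and> (\<exists>l<r. c l \<noteq> 0)}
    \<le> measure_pmf.prob (bern_set ?D (min 1 ?p)) ?Bad"
  proof (intro measure_pmf.finite_measure_mono subsetI)
    fix S assume "S \<in> {Obs. \<exists>c. (\<forall>(a,b)\<in>Obs. (\<Sum>l<r. c l * (A $$ (a,l) * B $$ (b,l))) = 0) \<and> (\<exists>l<r. c l \<noteq> 0)}"
    then obtain c l where "\<forall>(a,b)\<in>S. (\<Sum>l<r. c l * (A $$ (a,l) * B $$ (b,l))) = 0" and cl: "l < r" "c l \<noteq> 0"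
      by blast
    then have c: "(\<Sum>l<r. c l * (A $$ (a,l) * B $$ (b,l))) = 0" if "(a,b) \<in> S" for a b
      using that by auto
    define w where "w = (\<lambda>x. \<Sum>l<r. c l * ?\<phi> l x)"
    have "w \<in> linspan r ?\<phi>" by (auto simp: w_def linspan_def)
    moreover have "\<forall>x\<in>S. w x = 0" using c by (auto simp: w_def)
    moreover have "\<exists>x\<in>?D. w x \<noteq> 0"
    proof (rule ccontr)
      assume "\<not> (\<exists>x\<in>?D. w x \<noteq> 0)"
      then have "(\<Sum>l<r. c l * (A $$ (a,l) * B $$ (b,l))) = 0" if "a < n" "b < m" for a b
        using that by (auto simp: w_def)
      from tensor_independent[OF A(1,2) B(1,2) this cl(1)] cl(2) show False by simp
    qed
    ultimately show "S \<in> ?Bad" by blast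
  qed simp
  also have "\<dots> \<le> r * exp (- ?p / ?R)"
    using nm tensor_leverage[OF A B r \<mu>] R
    by (intro prob_bern_set_not_determining) auto
  \<comment> \<open>The sampling rate is the leverage bound times c3 ln k, so everything else
    cancels.\<close>
  also have "- ?p / ?R = - c3 * ln k"
    using r \<mu> nm by (simp add: field_simps power2_eq_square)
  also have "exp (- c3 * ln k) = real k powr (- c3)"
    using nm by (simp add: powr_def)
  finally show ?thesis .
qed

text \<open>First \<open>u\<close> avoids the hyperplanes on which some weight \<open>?L u l\<close>
  vanishes. For each such \<open>u\<close> the ratio condition is linear in \<open>v\<close>, so
  that \<open>v\<close> has only finitely many further hyperplanes to avoid.\<close>

lemma AE_deli_success:
  fixes mu0 :: real
  assumes hyps: "deli_hyps d n r A s S istar mu0"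
    and OmM: "OmM \<subseteq> {..<n 1} \<times> {..<n 2} \<times> S"
    and Oms: "\<And>k. k \<in> {3..d} \<Longrightarrow> Oms k \<subseteq> {..<n 1} \<times> {..<n 2} \<times> {..<n k}"
  defines "h \<equiv> \<lambda>l. \<Prod>j\<in>{3..d}-{3}. A j $$ (istar j, l)"
  defines "Mt \<equiv> \<lambda>t. Matrix.mat (n 1) (n 2) (\<lambda>(i,j). \<Sum>l<r. (A 3 $$ (t,l) * h l) * A 1 $$ (i,l) * A 2 $$ (j,l))"
  assumes nnm: "\<And>t X. t \<in> S \<Longrightarrow> nnm_min (n 1) (n 2) {(a,b). (a,b,t) \<in> OmM} (Mt t) X \<Longrightarrow> X = Mt t"
    and inj: "\<And>k i c. k \<in> {3..d} \<Longrightarrow> i < n k \<Longrightarrow>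
       (\<And>a b. (a,b,i) \<in> Oms k \<Longrightarrow> (\<Sum>l<r. c l * (A 1 $$ (a,l) * A 2 $$ (b,l))) = 0) \<Longrightarrow> \<forall>l<r. c l = 0"
  shows "AE u in gauss_vec S. AE v in gauss_vec S. deli_success d n r S istar (cp d r A) OmM Oms u v"
proof -
  let ?g = "\<lambda>t l. A 3 $$ (t,l) * h l"
  let ?L = "\<lambda>w l. \<Sum>t\<in>S. w t * ?g t l"
  have d: "d \<ge> 3" and S: "S \<subseteq> {..<n 3}" "card S = s" "s \<ge> 1"
    and nz: "\<And>k i l. k \<in> {3..d} \<Longrightarrow> i < n k \<Longrightarrow> l < r \<Longrightarrow> A k $$ (i,l) \<noteq> 0"
    and istar: "\<And>k. k \<in> {3..d} \<Longrightarrow> istar k < n k"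
    and A3: "A 3 \<in> carrier_mat (n 3) r"
    and kr: "kruskal_rank (submatrix (A 3) S {..<r}) \<ge> 2"
    using hyps by (auto simp: deli_hyps_def)
  have finS: "finite S" using S(1) finite_subset by blast
  obtain t0 where t0: "t0 \<in> S" using S by fastforce
  have hnz: "h l \<noteq> 0" if "l < r" for l
    unfolding h_def using nz istar that by (simp add: prod_zero_iff)
  have AEu: "AE u in gauss_vec S. \<forall>l\<in>{..<r}. ?L u l \<noteq> 0"
  proof (rule AE_finite_allI)
    fix l assume l: "l \<in> {..<r}"
    have "t0 < n 3" using t0 S(1) by auto
    then have "?g t0 l \<noteq> 0" using l nz[of 3 t0 l] hnz d by auto
    from AE_gauss_vec_linear_ne_0[OF finS t0, where c = "\<lambda>t. ?g t l", OF this]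
    show "AE u in gauss_vec S. ?L u l \<noteq> 0" by (simp add: mult.commute)
  qed simp
  have AEv: "AE v in gauss_vec S. \<forall>(l,m)\<in>{(l,m). l < r \<and> m < r \<and> l \<noteq> m}. ?L u l * ?L v m \<noteq> ?L u m * ?L v l"
    if u: "\<forall>l\<in>{..<r}. ?L u l \<noteq> 0" for u
  proof (rule AE_finite_allI)
    show "finite {(l,m). l < r \<and> m < r \<and> l \<noteq> m}"
      by (rule finite_subset[of _ "{..<r} \<times> {..<r}"]) auto
    fix p assume "p \<in> {(l,m). l < r \<and> m < r \<and> l \<noteq> m}"
    then obtain l m where p: "p = (l,m)" "l < r" "m < r" "l \<noteq> m" by auto
    let ?c = "\<lambda>t. ?L u l * ?g t m - ?L u m * ?g t l"
    \<comment> \<open>Otherwise columns l and m of \<open>A 3\<close> would be dependent on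
      \<open>S\<close>, with the nonzero coefficient \<open>?L u l * h m\<close>, against Kruskal
      rank at least 2.\<close>
    have "\<exists>t\<in>S. ?c t \<noteq> 0"
    proof (rule ccontr)
      assume "\<not> (\<exists>t\<in>S. ?c t \<noteq> 0)"
      then have "(?L u l * h m) * A 3 $$ (t,m) + (- ?L u m * h l) * A 3 $$ (t,l) = 0" if "t \<in> S" for t
        using that by (auto simp: algebra_simps)
      from kruskal_rank_ge_2_imp(2)[OF A3 kr p(3,2) p(4)[symmetric] this]
      have "?L u l * h m = 0" by blast
      then show False using u p hnz[OF p(3)] by auto
    qed
    then obtain t where t: "t \<in> S" "?c t \<noteq> 0" by blast
    have eq: "(\<Sum>t\<in>S. ?c t * v t) = ?L u l * ?L v m - ?L u m * ?L v l" for v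
      unfolding sum_distrib_left sum_subtractf[symmetric]
      by (intro sum.cong) (auto simp: algebra_simps)
    show "AE v in gauss_vec S. case p of (l,m) \<Rightarrow> ?L u l * ?L v m \<noteq> ?L u m * ?L v l"
      using AE_gauss_vec_linear_ne_0[OF finS t(1), where c = ?c, OF t(2)] unfolding eq p(1) by simp
  qed
  from AEu show ?thesis
  proof eventually_elim
    case u: (elim u)
    show ?case
      using AEu AEv[OF u]
    proof eventually_elim
      case (elim v)
      let ?h = "\<lambda>l. \<Prod>j\<in>{3..d}-{3}. A j $$ (istar j, l)"
      have u': "(\<Sum>t\<in>S. u t * (A 3 $$ (t,l) * ?h l)) \<noteq> 0" "(\<Sum>t\<in>S. v t * (A 3 $$ (t,l) * ?h l)) \<noteq> 0"
        if "l < r" for l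
        using u elim(1) that unfolding h_def by blast+
      have neq: "(\<Sum>t\<in>S. u t * (A 3 $$ (t,l) * ?h l)) * (\<Sum>t\<in>S. v t * (A 3 $$ (t,m) * ?h m)) \<noteq>
          (\<Sum>t\<in>S. u t * (A 3 $$ (t,m) * ?h m)) * (\<Sum>t\<in>S. v t * (A 3 $$ (t,l) * ?h l))"
        if "l < r" "m < r" "l \<noteq> m" for l m
        using elim(2) that unfolding h_def by blast
      show ?case
        by (rule deli_success_deterministic[OF hyps OmM Oms nnm[unfolded Mt_def h_def] inj u' neq]; (assumption | blast))
    qed
  qed
qed

section \<open>Bad events, their union bound, and the sample count\<close>

lemma prob_slice_not_completed:
  assumes chen: "chen_constants c0 c1 c2" and hyps: "deli_hyps d n r A s S istar mu0" and r: "r > 0"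
    and f: "\<And>l. l < r \<Longrightarrow> f l \<noteq> (0 :: real)"
  defines "M \<equiv> Matrix.mat (n 1) (n 2) (\<lambda>(i,j). \<Sum>l<r. f l * A 1 $$ (i,l) * A 2 $$ (j,l))"
  shows "measure_pmf.prob (bern_set ({..<n 1} \<times> {..<n 2})
        (min 1 (c0 * mu0 * real r * (ln (real (n 1 + n 2)))\<^sup>2 / real (min (n 1) (n 2)))))
      {Obs. \<exists>X. nnm_min (n 1) (n 2) Obs M X \<and> X \<noteq> M} \<le> c1 * real (n 1 + n 2) powr (- c2)"
proof -
  have A: "A 1 \<in> carrier_mat (n 1) r" "mrank (A 1) = r" and B: "A 2 \<in> carrier_mat (n 2) r" "mrank (A 2) = r"
    and mu: "coherence (A 1) \<le> mu0" "coherence (A 2) \<le> mu0" and n: "n 1 > 0" "n 2 > 0"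
    using hyps by (auto simp: deli_hyps_def)
  have cf: "mrank M = r" "coh M r = coherence (A 1)" "coh (transpose_mat M) r = coherence (A 2)"
    unfolding M_def by (rule coherence_factored[OF A B]; rule f; assumption)+
  let ?p = "min 1 (c0 * mu0 * real r * (ln (real (n 1 + n 2)))\<^sup>2 / real (min (n 1) (n 2)))"
  let ?P = "bern_set ({..<n 1} \<times> {..<n 2}) ?p"
  have "M \<in> carrier_mat (n 1) (n 2)" by (simp add: M_def)
  then have "M \<in> carrier_mat (n 1) (n 2) \<and> n 1 > 0 \<and> n 2 > 0 \<and> coh M (mrank M) \<le> mu0 \<and> coh (transpose_mat M) (mrank M) \<le> mu0"
    using n mu cf by simp
  from chen[unfolded chen_constants_def, THEN conjunct2, THEN conjunct2, THEN conjunct2,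
      THEN spec[of _ "n 1"], THEN spec[of _ "n 2"], THEN spec[of _ mu0], THEN spec[of _ M], THEN mp, OF this]
  have "measure_pmf.prob ?P {Obs. \<forall>X. nnm_min (n 1) (n 2) Obs M X \<longrightarrow> X = M} \<ge> 1 - c1 * real (n 1 + n 2) powr (- c2)"
    unfolding cf(1) .
  moreover have "measure_pmf.prob ?P (UNIV - {Obs. \<forall>X. nnm_min (n 1) (n 2) Obs M X \<longrightarrow> X = M})
     = 1 - measure_pmf.prob ?P {Obs. \<forall>X. nnm_min (n 1) (n 2) Obs M X \<longrightarrow> X = M}"
    by (subst measure_pmf.prob_compl[symmetric]) auto
  moreover have "UNIV - {Obs. \<forall>X. nnm_min (n 1) (n 2) Obs M X \<longrightarrow> X = M} = {Obs. \<exists>X. nnm_min (n 1) (n 2) Obs M X \<and> X \<noteq> M}"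
    by auto
  ultimately show ?thesis by simp
qed

text \<open>Links the joint sample to the bounds for a single matrix: a union bound sees only the
  marginal law of each slice.\<close>

lemma deli_samples_marginals:
  fixes c0 c3 mu0 :: real
  defines "p0 \<equiv> \<lambda>n r. min 1 (c0 * mu0 * real r * (ln (real (n 1 + n 2)))\<^sup>2 / real (min (n 1) (n (2::nat))))"
    and "p \<equiv> \<lambda>n r k. min 1 (c3 * mu0\<^sup>2 * (real r)\<^sup>2 * ln (real (n k)) / (real (n 1) * real (n (2::nat))))"
  shows "finite S \<Longrightarrow> t \<in> S \<Longrightarrow> measure_pmf.prob (deli_samples c0 c3 mu0 d n r S)
      {(M, N). {x \<in> {..<n 1} \<times> {..<n 2}. (fst x, snd x, t) \<in> M} \<in> E}
      = measure_pmf.prob (bern_set ({..<n 1} \<times> {..<n 2}) (p0 n r)) E"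
    and "k \<in> {3..d} \<Longrightarrow> i < n k \<Longrightarrow> measure_pmf.prob (deli_samples c0 c3 mu0 d n r S)
      {(M, N). {x \<in> {..<n 1} \<times> {..<n 2}. (fst x, snd x, i) \<in> N k} \<in> E}
      = measure_pmf.prob (bern_set ({..<n 1} \<times> {..<n 2}) (p n r k)) E"
proof -
  let ?E = "{..<n 1} \<times> {..<n 2}"
  have inj: "inj (\<lambda>x::nat \<times> nat. (fst x, snd x, i :: nat))" for i by (auto simp: inj_def)
  {
    assume S: "finite S" "t \<in> S"
    have "bern_set ?E (p0 n r) = map_pmf (\<lambda>M. {x \<in> ?E. (fst x, snd x, t) \<in> M}) (bern_set ({..<n 1} \<times> {..<n 2} \<times> S) (p0 n r))"
      by (rule map_bern_set_vimage[symmetric, OF _ inj]) (use S in auto)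
    also have "\<dots> = map_pmf (\<lambda>M. {x \<in> ?E. (fst x, snd x, t) \<in> M}) (map_pmf fst (deli_samples c0 c3 mu0 d n r S))"
      by (simp add: deli_samples_def map_fst_pair_pmf p0_def)
    finally show "measure_pmf.prob (deli_samples c0 c3 mu0 d n r S)
      {(M, N). {x \<in> ?E. (fst x, snd x, t) \<in> M} \<in> E} = measure_pmf.prob (bern_set ?E (p0 n r)) E"
      by (simp add: vimage_def case_prod_unfold)
  }
  {
    assume k: "k \<in> {3..d}" "i < n k"
    have "bern_set ?E (p n r k) = map_pmf (\<lambda>M. {x \<in> ?E. (fst x, snd x, i) \<in> M}) (bern_set ({..<n 1} \<times> {..<n 2} \<times> {..<n k}) (p n r k))"
      by (rule map_bern_set_vimage[symmetric, OF _ inj]) (use k in auto)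
    also have "bern_set ({..<n 1} \<times> {..<n 2} \<times> {..<n k}) (p n r k) = map_pmf (\<lambda>N. N k) (map_pmf snd (deli_samples c0 c3 mu0 d n r S))"
      using k by (simp add: deli_samples_def map_snd_pair_pmf p_def Pi_pmf_component)
    finally show "measure_pmf.prob (deli_samples c0 c3 mu0 d n r S)
      {(M, N). {x \<in> ?E. (fst x, snd x, i) \<in> N k} \<in> E} = measure_pmf.prob (bern_set ?E (p n r k)) E"
      by (simp add: vimage_def case_prod_unfold)
  }
qed

lemma deli_recovery_probability:
  fixes c0 c1 c2 c3 :: real
  assumes chen: "chen_constants c0 c1 c2" and c3: "c3 > 1" and hyps: "deli_hyps d n r A s S istar mu0"
  shows "measure_pmf.prob (deli_samples c0 c3 mu0 d n r S)
              {(OmM, Oms). AE u in gauss_vec S. AE v in gauss_vec S.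
                 deli_success d n r S istar (cp d r A) OmM Oms u v}
            \<ge> 1 - c1 * real s * real (n 1 + n 2) powr (- c2)
                - real r * (\<Sum>k=3..d. real (n k) powr (- (c3 - 1)))"
proof -
  let ?Q = "deli_samples c0 c3 mu0 d n r S"
  let ?G = "{(OmM, Oms). AE u in gauss_vec S. AE v in gauss_vec S. deli_success d n r S istar (cp d r A) OmM Oms u v}"
  let ?E = "{..<n 1} \<times> {..<n 2}"
  have d: "d \<ge> 3" and S: "S \<subseteq> {..<n 3}" "card S = s"
    and nz: "\<And>k i l. k \<in> {3..d} \<Longrightarrow> i < n k \<Longrightarrow> l < r \<Longrightarrow> A k $$ (i,l) \<noteq> 0"
    and istar: "\<And>k. k \<in> {3..d} \<Longrightarrow> istar k < n k"
    and A: "A 1 \<in> carrier_mat (n 1) r" "mrank (A 1) = r" "coherence (A 1) \<le> mu0"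
    and B: "A 2 \<in> carrier_mat (n 2) r" "mrank (A 2) = r" "coherence (A 2) \<le> mu0"
    and A3: "A 3 \<in> carrier_mat (n 3) r" and mu: "mu0 > 0" and n: "\<And>k. k \<in> {1..d} \<Longrightarrow> n k > 0"
    and kr: "kruskal_rank (submatrix (A 3) S {..<r}) \<ge> 2"
    using hyps by (auto simp: deli_hyps_def)
  have finS: "finite S" using S(1) finite_subset by blast
  have r: "r > 0" using kruskal_rank_ge_2_imp(1)[OF A3 kr] by simp
  define h where "h l = (\<Prod>j\<in>{3..d}-{3}. A j $$ (istar j, l))" for l
  define Mt where "Mt t = Matrix.mat (n 1) (n 2) (\<lambda>(i,j). \<Sum>l<r. (A 3 $$ (t,l) * h l) * A 1 $$ (i,l) * A 2 $$ (j,l))" for t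
  have hnz: "h l \<noteq> 0" if "l < r" for l
    unfolding h_def using nz istar that by (simp add: prod_zero_iff)
  define B1 where "B1 t = {(M, N :: nat \<Rightarrow> (nat \<times> nat \<times> nat) set). {x \<in> ?E. (fst x, snd x, t) \<in> M} \<in>
      {Obs. \<exists>X. nnm_min (n 1) (n 2) Obs (Mt t) X \<and> X \<noteq> Mt t}}" for t :: nat
  define B2 where "B2 k i = {(M :: (nat \<times> nat \<times> nat) set, N). {x \<in> ?E. (fst x, snd x, i) \<in> N k} \<in>
      {Obs. \<exists>c. (\<forall>(a,b)\<in>Obs. (\<Sum>l<r. c l * (A 1 $$ (a,l) * A 2 $$ (b,l))) = 0) \<and> (\<exists>l<r. c l \<noteq> 0)}}" for k i :: nat
  have P1: "measure_pmf.prob ?Q (B1 t) \<le> c1 * real (n 1 + n 2) powr (- c2)" if t: "t \<in> S" for t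
  proof -
    have "t < n 3" using t S(1) by auto
    then have "A 3 $$ (t,l) * h l \<noteq> 0" if "l < r" for l using nz[of 3 t l] hnz that d by auto
    from prob_slice_not_completed[OF chen hyps r, where f = "\<lambda>l. A 3 $$ (t,l) * h l", OF this]
    show ?thesis unfolding B1_def deli_samples_marginals(1)[OF finS t] Mt_def .
  qed
  have P2: "measure_pmf.prob ?Q (B2 k i) \<le> r * real (n k) powr (- c3)" if k: "k \<in> {3..d}" and i: "i < n k" for k i
    unfolding B2_def deli_samples_marginals(2)[where n = n and k = k and d = d, OF k i]
    using n[of 1] n[of 2] n[of k] d k c3
    by (intro prob_bern_set_tensor_not_determining[OF A B r mu]) auto
  \<comment> \<open>The intersection with the support supplies the inclusions of the samples in
    their index ranges, and it does not change the probability.\<close>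
  have sub: "(UNIV - ?G) \<inter> set_pmf ?Q \<subseteq> (\<Union>t\<in>S. B1 t) \<union> (\<Union>k\<in>{3..d}. \<Union>i\<in>{..<n k}. B2 k i)"
  proof (rule subsetI, rule ccontr)
    fix q assume q: "q \<in> (UNIV - ?G) \<inter> set_pmf ?Q" and nq: "q \<notin> (\<Union>t\<in>S. B1 t) \<union> (\<Union>k\<in>{3..d}. \<Union>i\<in>{..<n k}. B2 k i)"
    obtain M N where MN: "q = (M,N)" by force
    have supp: "M \<in> set_pmf (bern_set ({..<n 1} \<times> {..<n 2} \<times> S) (min 1 (c0 * mu0 * real r * (ln (real (n 1 + n 2)))\<^sup>2 / real (min (n 1) (n 2)))))"
      "N \<in> set_pmf (Pi_pmf {3..d} {} (\<lambda>k. bern_set ({..<n 1} \<times> {..<n 2} \<times> {..<n k})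
          (min 1 (c3 * mu0\<^sup>2 * (real r)\<^sup>2 * ln (real (n k)) / (real (n 1) * real (n 2))))))"
      using q MN by (auto simp: deli_samples_def)
    have Msub: "M \<subseteq> {..<n 1} \<times> {..<n 2} \<times> S" using set_bern_set_subset[OF supp(1)] .
    have Nsub: "N k \<subseteq> {..<n 1} \<times> {..<n 2} \<times> {..<n k}" if "k \<in> {3..d}" for k
      using supp(2) that by (auto simp: set_Pi_pmf PiE_dflt_def dest!: bspec set_bern_set_subset)
    have "AE u in gauss_vec S. AE v in gauss_vec S. deli_success d n r S istar (cp d r A) M N u v"
    proof (rule AE_deli_success[OF hyps Msub Nsub])
      fix t X assume t: "t \<in> S" and X: "nnm_min (n 1) (n 2) {(a,b). (a,b,t) \<in> M}
        (Matrix.mat (n 1) (n 2) (\<lambda>(i,j). \<Sum>l<r. (A 3 $$ (t,l) * (\<Prod>j\<in>{3..d}-{3}. A j $$ (istar j, l))) * A 1 $$ (i,l) * A 2 $$ (j,l))) X"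
      have eq: "{(a,b). (a,b,t) \<in> M} = {x \<in> ?E. (fst x, snd x, t) \<in> M}" using Msub by auto
      have "nnm_min (n 1) (n 2) {x \<in> ?E. (fst x, snd x, t) \<in> M} (Mt t) X"
        using X unfolding eq Mt_def h_def .
      moreover have "q \<notin> B1 t" using nq t by blast
      ultimately have "X = Mt t" unfolding MN B1_def by blast
      then show "X = Matrix.mat (n 1) (n 2) (\<lambda>(i,j). \<Sum>l<r. (A 3 $$ (t,l) * (\<Prod>j\<in>{3..d}-{3}. A j $$ (istar j, l))) * A 1 $$ (i,l) * A 2 $$ (j,l))"
        unfolding Mt_def h_def .
    next
      fix k i c assume k: "k \<in> {3..d}" "i < n k"
        and z: "\<And>a b. (a,b,i) \<in> N k \<Longrightarrow> (\<Sum>l<r. c l * (A 1 $$ (a,l) * A 2 $$ (b,l))) = 0"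
      have "q \<notin> B2 k i" using nq k by blast
      moreover have "\<forall>(a,b)\<in>{x \<in> ?E. (fst x, snd x, i) \<in> N k}. (\<Sum>l<r. c l * (A 1 $$ (a,l) * A 2 $$ (b,l))) = 0"
        using z by auto
      ultimately show "\<forall>l<r. c l = 0" unfolding MN B2_def by blast
    qed
    then show False using q MN by auto
  qed
  have "measure_pmf.prob ?Q (UNIV - ?G) = measure_pmf.prob ?Q ((UNIV - ?G) \<inter> set_pmf ?Q)"
    by (rule measure_Int_set_pmf[symmetric])
  also have "\<dots> \<le> measure_pmf.prob ?Q ((\<Union>t\<in>S. B1 t) \<union> (\<Union>k\<in>{3..d}. \<Union>i\<in>{..<n k}. B2 k i))"
    by (rule measure_pmf.finite_measure_mono[OF sub]) simp
  also have "\<dots> \<le> measure_pmf.prob ?Q (\<Union>t\<in>S. B1 t) + measure_pmf.prob ?Q (\<Union>k\<in>{3..d}. \<Union>i\<in>{..<n k}. B2 k i)"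
    by (rule measure_Un_le) auto
  also have "\<dots> \<le> (\<Sum>t\<in>S. c1 * real (n 1 + n 2) powr (- c2)) + (\<Sum>k\<in>{3..d}. \<Sum>i\<in>{..<n k}. r * real (n k) powr (- c3))"
  proof (rule add_mono)
    have "measure_pmf.prob ?Q (\<Union>t\<in>S. B1 t) \<le> (\<Sum>t\<in>S. measure_pmf.prob ?Q (B1 t))"
      by (rule measure_UNION_le[OF finS]) auto
    also have "\<dots> \<le> (\<Sum>t\<in>S. c1 * real (n 1 + n 2) powr (- c2))" by (rule sum_mono) (rule P1)
    finally show "measure_pmf.prob ?Q (\<Union>t\<in>S. B1 t) \<le> (\<Sum>t\<in>S. c1 * real (n 1 + n 2) powr (- c2))" .
    have "measure_pmf.prob ?Q (\<Union>k\<in>{3..d}. \<Union>i\<in>{..<n k}. B2 k i) \<le> (\<Sum>k\<in>{3..d}. measure_pmf.prob ?Q (\<Union>i\<in>{..<n k}. B2 k i))"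
      by (rule measure_UNION_le) auto
    also have "\<dots> \<le> (\<Sum>k\<in>{3..d}. \<Sum>i\<in>{..<n k}. measure_pmf.prob ?Q (B2 k i))"
      by (rule sum_mono, rule measure_UNION_le) auto
    also have "\<dots> \<le> (\<Sum>k\<in>{3..d}. \<Sum>i\<in>{..<n k}. r * real (n k) powr (- c3))"
      by (rule sum_mono, rule sum_mono, rule P2) auto
    finally show "measure_pmf.prob ?Q (\<Union>k\<in>{3..d}. \<Union>i\<in>{..<n k}. B2 k i) \<le> (\<Sum>k\<in>{3..d}. \<Sum>i\<in>{..<n k}. r * real (n k) powr (- c3))" .
  qed
  also have "(\<Sum>t\<in>S. c1 * real (n 1 + n 2) powr (- c2)) = c1 * real s * real (n 1 + n 2) powr (- c2)"
    using S(2) by simp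
  also have "(\<Sum>k\<in>{3..d}. \<Sum>i\<in>{..<n k}. r * real (n k) powr (- c3)) = real r * (\<Sum>k=3..d. real (n k) powr (- (c3 - 1)))"
  proof -
    \<comment> \<open>The union over the n_k rows costs one factor n_k, which lowers the exponent
      from c3 to c3 - 1.\<close>
    have "(\<Sum>i\<in>{..<n k}. r * real (n k) powr (- c3)) = r * real (n k) powr (- (c3 - 1))" if "k \<in> {3..d}" for k
    proof -
      have "real (n k) > 0" using n[of k] that by simp
      then have "real (n k) powr (- (c3 - 1)) = real (n k) * real (n k) powr (- c3)"
        by (simp add: powr_diff powr_minus divide_inverse)
      then show ?thesis by (simp add: mult_ac)
    qed
    then have "(\<Sum>k\<in>{3..d}. \<Sum>i\<in>{..<n k}. r * real (n k) powr (- c3)) = (\<Sum>k\<in>{3..d}. r * real (n k) powr (- (c3 - 1)))"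
      by (rule sum.cong[OF refl])
    also have "\<dots> = real r * (\<Sum>k=3..d. real (n k) powr (- (c3 - 1)))"
      by (rule sum_distrib_left[symmetric])
    finally show ?thesis .
  qed
  finally have "measure_pmf.prob ?Q (UNIV - ?G) \<le> c1 * real s * real (n 1 + n 2) powr (- c2) + real r * (\<Sum>k=3..d. real (n k) powr (- (c3 - 1)))" .
  moreover have "measure_pmf.prob ?Q (UNIV - ?G) = 1 - measure_pmf.prob ?Q ?G"
    by (subst measure_pmf.prob_compl[symmetric]) auto
  ultimately show ?thesis by linarith
qed

text \<open>The mean count is at most (c0 + c3) Bd, and the Chernoff exponent is twice the mean
  minus the threshold; the extra 1 in the constant leaves - Bd.\<close>

lemma deli_sample_complexity:
  fixes c0 c3 :: real
  assumes c: "c0 > 0" "c3 > 0" and hyps: "deli_hyps d n r A s S istar mu0"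
  defines "Bd \<equiv> real s * mu0 * real r * real (max (n 1) (n 2)) * (ln (real (n 1 + n 2)))\<^sup>2
                      + mu0\<^sup>2 * (real r)\<^sup>2 * (\<Sum>k=3..d. real (n k) * ln (real (n k)))"
  shows "measure_pmf.prob (deli_samples c0 c3 mu0 d n r S)
                  {(OmM, Oms). real (card OmM + (\<Sum>k=3..d. card (Oms k))) \<le> (1 + 2 * (c0 + c3)) * Bd}
                \<ge> 1 - exp (- Bd)"
proof -
  have d: "d \<ge> 3" and S: "S \<subseteq> {..<n 3}" "card S = s" and mu: "mu0 > 0" and n: "\<And>k. k \<in> {1..d} \<Longrightarrow> n k > 0"
    using hyps by (auto simp: deli_hyps_def)
  have finS: "finite S" using S(1) finite_subset by blast
  have n12: "n 1 > 0" "n 2 > 0" using n d by auto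
  let ?xM = "c0 * mu0 * real r * (ln (real (n 1 + n 2)))\<^sup>2 / real (min (n 1) (n 2))"
  let ?x = "\<lambda>k. c3 * mu0\<^sup>2 * (real r)\<^sup>2 * ln (real (n k)) / (real (n 1) * real (n 2))"
  let ?pM = "min 1 ?xM" and ?p = "\<lambda>k. min 1 (?x k)"
  let ?DM = "{..<n 1} \<times> {..<n 2} \<times> S" and ?D = "\<lambda>k. {..<n 1} \<times> {..<n 2} \<times> {..<n k}"
  define b1 where "b1 = real s * mu0 * real r * real (max (n 1) (n 2)) * (ln (real (n 1 + n 2)))\<^sup>2"
  define b2 where "b2 = mu0\<^sup>2 * (real r)\<^sup>2 * (\<Sum>k=3..d. real (n k) * ln (real (n k)))"
  have Bd: "Bd = b1 + b2" by (simp add: Bd_def b1_def b2_def)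
  have ln0: "ln (real (n k)) \<ge> 0" if "k \<in> {3..d}" for k using n[of k] that by simp
  have b0: "b1 \<ge> 0" "b2 \<ge> 0"
    using mu ln0 by (auto simp: b1_def b2_def intro!: mult_nonneg_nonneg sum_nonneg)
  have x0: "?xM \<ge> 0" using c mu by simp
  have x: "?x k \<ge> 0" if "k \<in> {3..d}" for k using c ln0[OF that] by simp
  have e1: "?pM * card ?DM \<le> c0 * b1"
  proof -
    \<comment> \<open>Writing n1 n2 as minimum times maximum lets the denominator of the rate cancel
      the minimum.\<close>
    have card: "real (card ?DM) = real (min (n 1) (n 2)) * real (max (n 1) (n 2)) * s"
      using S by (simp add: min_def max_def card_cartesian_product)
    have "?pM * card ?DM \<le> ?xM * card ?DM" by (rule mult_right_mono) auto
    also have "\<dots> = c0 * b1" unfolding card b1_def using n12 by simp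
    finally show ?thesis .
  qed
  have e2: "(\<Sum>k=3..d. ?p k * card (?D k)) \<le> c3 * b2"
  proof -
    have "(\<Sum>k=3..d. ?p k * card (?D k)) \<le> (\<Sum>k=3..d. ?x k * card (?D k))"
      by (intro sum_mono mult_right_mono) auto
    also have "\<dots> = (\<Sum>k=3..d. c3 * (mu0\<^sup>2 * (real r)\<^sup>2 * (real (n k) * ln (real (n k)))))"
      using n12 by (intro sum.cong) auto
    also have "\<dots> = c3 * b2" by (simp add: b2_def sum_distrib_left)
    finally show ?thesis .
  qed
  define tot where "tot = ?pM * card ?DM + (\<Sum>k=3..d. ?p k * card (?D k))"
  have "tot \<le> c0 * b1 + c3 * b2" unfolding tot_def by (rule add_mono[OF e1 e2])
  also have "\<dots> \<le> (c0 + c3) * Bd"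
    using b0 c mult_nonneg_nonneg[of c0 b2] mult_nonneg_nonneg[of c3 b1] by (simp add: Bd algebra_simps)
  finally have "2 * tot - (1 + 2 * (c0 + c3)) * Bd \<le> - Bd"
    by (simp add: algebra_simps)
  then have "1 - exp (- Bd) \<le> 1 - exp (2 * tot - (1 + 2 * (c0 + c3)) * Bd)"
    by simp
  also have "\<dots> \<le> measure_pmf.prob (deli_samples c0 c3 mu0 d n r S)
      {(OmM, Oms). real (card OmM + (\<Sum>k=3..d. card (Oms k))) \<le> (1 + 2 * (c0 + c3)) * Bd}"
    unfolding deli_samples_def tot_def
    by (rule prob_total_card_le) (use finS x0 x in auto)
  finally show ?thesis .
qed

theorem theorem4:
  fixes c0 c1 c2 c3 :: real
  assumes "chen_constants c0 c1 c2"
    and "c3 > 1"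
  shows "(\<forall>d n r A s S istar mu0. deli_hyps d n r A s S istar mu0 \<longrightarrow>
            measure_pmf.prob (deli_samples c0 c3 mu0 d n r S)
              {(OmM, Oms). AE u in gauss_vec S. AE v in gauss_vec S.
                 deli_success d n r S istar (cp d r A) OmM Oms u v}
            \<ge> 1 - c1 * real s * real (n 1 + n 2) powr (- c2)
                - real r * (\<Sum>k=3..d. real (n k) powr (- (c3 - 1))))
       \<and> (\<exists>C>0. \<forall>d n r A s S istar mu0. deli_hyps d n r A s S istar mu0 \<longrightarrow>
            (let Bd = real s * mu0 * real r * real (max (n 1) (n 2)) * (ln (real (n 1 + n 2)))\<^sup>2
                      + mu0\<^sup>2 * (real r)\<^sup>2 * (\<Sum>k=3..d. real (n k) * ln (real (n k)))
             in measure_pmf.prob (deli_samples c0 c3 mu0 d n r S)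
                  {(OmM, Oms). real (card OmM + (\<Sum>k=3..d. card (Oms k))) \<le> C * Bd}
                \<ge> 1 - exp (- Bd)))"
proof -
  have c: "c0 > 0" "c3 > 0" using assms by (auto simp: chen_constants_def)
  show ?thesis
  \<comment> \<open>The constant depends only on c0 and c3, so it can be fixed before the
    tensor.\<close>
  proof (intro conjI allI impI exI[of _ "1 + 2 * (c0 + c3)"])
    show "0 < 1 + 2 * (c0 + c3)" using c by simp
  qed (use deli_recovery_probability[OF assms] deli_sample_complexity[OF c] in \<open>auto simp: Let_def\<close>)
qed

end
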